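(* Let $K$ be a field with $\operatorname{char} K=0$, let $(E,\omega)$ be a finite connected weighted graph, and put $A=L_K(E,\omega)$, the weighted Leavitt path algebra of $(E,\omega)$ over $K$. Then the following statements are equivalent: (1) $A^\times$ is abelian. (2) $A$ is a domain. (3) One of the following holds: (a) $E^0=\{v\}$ and $E^{\mathrm{st}}=\emptyset$; (b) $E^0=\{v\}$, $E^{\mathrm{st}}=\{e\}$, and $\omega(e)=1$; (c) $(E,\omega)$ is an LV-rose. (4) One of the following holds: (a) $A=Kv$ for a vertex $v\in E^0$, and so $A^\times\cong K^\times$; (b) $A\cong K[x,x^{-1}]$, and so (under this identification) $A^\times=K^\times\langle x\rangle$, where $\langle x\rangle$ denotes the cyclic subgroup of $K[x,x^{-1}]^\times$ generated by $x$; (c) $E^0=\{v\}$, $(E,\omega)$ is an LV-rose, and $A^\times\cong K^\times$. (5) $A^\times$ contains no non-cyclic free subgroup.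
   Context: A weighted graph $(E,\omega)=(E^0,E^{\mathrm{st}},s,r,\omega)$ consists of a set $E^0$ of vertices, a set $E^{\mathrm{st}}$ of structured edges, source and range maps $s,r:E^{\mathrm{st}}\to E^0$, and a weight map $\omega:E^{\mathrm{st}}\to\{1,2,3,\dots\}$. Each structured edge $e$ gives real edges $e_1,\dots,e_{\omega(e)}$ with $s(e_i)=s(e)$, $r(e_i)=r(e)$. A vertex $v$ is a sink if $s^{-1}(v)=\emptyset$; for a non-sink $v$, $\omega(v)=\max\{\omega(e)\mid e\in s^{-1}(v)\}$, and $\omega(v)=0$ for a sink. Finite means that $E^0$ and $E^{\mathrm{st}}$ are finite; connected means that the underlying undirected graph is connected (in particular $E^0\neq\emptyset$). The weighted Leavitt path algebra $L_K(E,\omega)$ is the associative $K$-algebra generated by $\{v\mid v\in E^0\}\cup\{e_i,e_i^*\mid e\in E^{\mathrm{st}},\,1\le i\le\omega(e)\}$ subject to: (W1) $uv=\delta_{uv}u$ for $u,v\in E^0$; (W2) $s(e)e_i=e_i=e_ir(e)$ and $r(e)e_i^*=e_i^*=e_i^*s(e)$ for $e\in E^{\mathrm{st}}$, $1\le i\le\omega(e)$; (W3) $\sum_{e\in s^{-1}(v)}e_ie_j^*=\delta_{ij}v$ for every non-sink $v\in E^0$ and $1\le i,j\le\omega(v)$; (W4) $\sum_{i=1}^{\max\{\omega(e),\omega(f)\}}e_i^*f_i=\delta_{ef}r(e)$ for all $e,f\in E^{\mathrm{st}}$; where in (W3), (W4) one sets $e_i=e_i^*=0$ whenever $i>\omega(e)$.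 For a finite weighted graph this algebra is unital with $1=\sum_{v\in E^0}v$, and $A^\times$ denotes the group of units of $A$. A domain is a nonzero, not necessarily commutative, ring without zero divisors. An LV-graph is a connected weighted graph with $E^{\mathrm{st}}\neq\emptyset$ such that $\omega(e)\ge2$ for every $e\in E^{\mathrm{st}}$ and $|\{e\in s^{-1}(v)\mid\omega(e)=\omega(v)\}|\ge2$ for every non-sink vertex $v$. An LV-rose is an LV-graph with exactly one vertex. *)

theory Defs
  imports "HOL-Algebra.Algebra" "HOL-Algebra.Algebraic_Closure_Type" "HOL-Library.Poly_Mapping"
begin

record ('v, 'e) wgraph =
  verts :: "'v set"
  sedges :: "'e set"
  src :: "'e \<Rightarrow> 'v"
  rng :: "'e \<Rightarrow> 'v"
  wt :: "'e \<Rightarrow> nat"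

definition weighted_graph :: "('v, 'e) wgraph \<Rightarrow> bool" where
  "weighted_graph G \<longleftrightarrow>
     (\<forall>e\<in>sedges G. src G e \<in> verts G \<and> rng G e \<in> verts G \<and> 1 \<le> wt G e)"

definition finite_wgraph :: "('v, 'e) wgraph \<Rightarrow> bool" where
  "finite_wgraph G \<longleftrightarrow> finite (verts G) \<and> finite (sedges G)"

definition connected_wgraph :: "('v, 'e) wgraph \<Rightarrow> bool" where
  "connected_wgraph G \<longleftrightarrow> verts G \<noteq> {} \<and>
     (\<forall>u\<in>verts G. \<forall>v\<in>verts G.
        (u, v) \<in> ((\<Union>e\<in>sedges G. {(src G e, rng G e), (rng G e, src G e)})\<^sup>*))"

definition out_edges :: "('v, 'e) wgraph \<Rightarrow> 'v \<Rightarrow> 'e set" where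
  "out_edges G v = {e \<in> sedges G. src G e = v}"

definition is_sink :: "('v, 'e) wgraph \<Rightarrow> 'v \<Rightarrow> bool" where
  "is_sink G v \<longleftrightarrow> out_edges G v = {}"

text \<open>The use of \<^const>\<open>Max\<close> here, of \<^const>\<open>card\<close> in the definition of LV-graphs and of
  the sum in relation (W3) presuppose that only finitely many edges start at each vertex.\<close>

definition vwt :: "('v, 'e) wgraph \<Rightarrow> 'v \<Rightarrow> nat" where
  "vwt G v = (if is_sink G v then 0 else Max (wt G ` out_edges G v))"

definition LV_graph :: "('v, 'e) wgraph \<Rightarrow> bool" where
  "LV_graph G \<longleftrightarrow> weighted_graph G \<and> connected_wgraph G \<and> sedges G \<noteq> {} \<and>
     (\<forall>e\<in>sedges G. 2 \<le> wt G e) \<and>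
     (\<forall>v\<in>verts G. \<not> is_sink G v \<longrightarrow> 2 \<le> card {e \<in> out_edges G v. wt G e = vwt G v})"

definition LV_rose :: "('v, 'e) wgraph \<Rightarrow> bool" where
  "LV_rose G \<longleftrightarrow> LV_graph G \<and> (\<exists>v. verts G = {v})"

text \<open>Words form the free monoid under concatenation. With this instance, the type
  \<open>'x list \<Rightarrow>\<^sub>0 'k\<close> carries the multiplication of the free associative algebra.\<close>

instantiation list :: (type) monoid_add
begin

definition zero_list :: "'a list" where "zero_list = []"

definition plus_list :: "'a list \<Rightarrow> 'a list \<Rightarrow> 'a list" where "plus_list = (@)"

instance by standard (simp_all add: zero_list_def plus_list_def)

end

definition pm_scale :: "'k::field \<Rightarrow> ('m \<Rightarrow>\<^sub>0 'k) \<Rightarrow> ('m \<Rightarrow>\<^sub>0 'k)" where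
  "pm_scale k = Poly_Mapping.map ((*) k)"

datatype ('v, 'e) gen = Vtx 'v | Edge 'e nat | Ghost 'e nat

type_synonym ('v, 'e, 'k) free_elt = "('v, 'e) gen list \<Rightarrow>\<^sub>0 'k"

definition gens :: "('v, 'e) wgraph \<Rightarrow> ('v, 'e) gen set" where
  "gens G = Vtx ` verts G
     \<union> {Edge e i | e i. e \<in> sedges G \<and> 1 \<le> i \<and> i \<le> wt G e}
     \<union> {Ghost e i | e i. e \<in> sedges G \<and> 1 \<le> i \<and> i \<le> wt G e}"

definition vtx :: "'v \<Rightarrow> ('v, 'e, 'k::field) free_elt" where
  "vtx v = Poly_Mapping.single [Vtx v] 1"

text \<open>The convention that \<open>e\<^sub>i\<close> and its ghost are zero for \<open>i > wt G e\<close> is built in.\<close>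

definition redge :: "('v, 'e) wgraph \<Rightarrow> 'e \<Rightarrow> nat \<Rightarrow> ('v, 'e, 'k::field) free_elt" where
  "redge G e i = (if 1 \<le> i \<and> i \<le> wt G e then Poly_Mapping.single [Edge e i] 1 else 0)"

definition rghost :: "('v, 'e) wgraph \<Rightarrow> 'e \<Rightarrow> nat \<Rightarrow> ('v, 'e, 'k::field) free_elt" where
  "rghost G e i = (if 1 \<le> i \<and> i \<le> wt G e then Poly_Mapping.single [Ghost e i] 1 else 0)"

definition W1_rels :: "('v, 'e) wgraph \<Rightarrow> ('v, 'e, 'k::field) free_elt set" where
  "W1_rels G = {vtx u * vtx v - (if u = v then vtx u else 0) | u v. u \<in> verts G \<and> v \<in> verts G}"

definition W2_rels :: "('v, 'e) wgraph \<Rightarrow> ('v, 'e, 'k::field) free_elt set" where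
  "W2_rels G = (\<Union>e\<in>sedges G. \<Union>i\<in>{1..wt G e}.
     {vtx (src G e) * redge G e i - redge G e i,
      redge G e i * vtx (rng G e) - redge G e i,
      vtx (rng G e) * rghost G e i - rghost G e i,
      rghost G e i * vtx (src G e) - rghost G e i})"

definition W3_rels :: "('v, 'e) wgraph \<Rightarrow> ('v, 'e, 'k::field) free_elt set" where
  "W3_rels G = {(\<Sum>e\<in>out_edges G v. redge G e i * rghost G e j) - (if i = j then vtx v else 0)
     | v i j. v \<in> verts G \<and> \<not> is_sink G v \<and> i \<in> {1..vwt G v} \<and> j \<in> {1..vwt G v}}"

definition W4_rels :: "('v, 'e) wgraph \<Rightarrow> ('v, 'e, 'k::field) free_elt set" where
  "W4_rels G = {(\<Sum>i = 1..max (wt G e) (wt G f). rghost G e i * redge G f i)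
       - (if e = f then vtx (rng G e) else 0)
     | e f. e \<in> sedges G \<and> f \<in> sedges G}"

text \<open>The presentation is one of not necessarily unital algebras, so the free algebra is
  spanned by the nonempty words in the generators. The \<open>one\<close> field holds the sum of the
  vertices: it is not neutral here, but its class is the identity of the quotient by the
  relations when the vertex set is finite.\<close>

definition free_alg :: "('v, 'e) wgraph \<Rightarrow> ('v, 'e, 'k::field) free_elt ring" where
  "free_alg G =
     \<lparr>carrier = {p. Poly_Mapping.keys p \<subseteq> lists (gens G) - {[]}},
      monoid.mult = (*), one = (\<Sum>v\<in>verts G. vtx v), ring.zero = 0, add = (+)\<rparr>"

inductive_set wlpa_ideal :: "('v, 'e) wgraph \<Rightarrow> ('v, 'e, 'k::field) free_elt set"
  for G :: "('v, 'e) wgraph"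
where
  rel: "p \<in> W1_rels G \<union> W2_rels G \<union> W3_rels G \<union> W4_rels G \<Longrightarrow> p \<in> wlpa_ideal G"
| zero: "0 \<in> wlpa_ideal G"
| add: "p \<in> wlpa_ideal G \<Longrightarrow> q \<in> wlpa_ideal G \<Longrightarrow> p + q \<in> wlpa_ideal G"
| scale: "p \<in> wlpa_ideal G \<Longrightarrow> pm_scale k p \<in> wlpa_ideal G"
| lmult: "p \<in> wlpa_ideal G \<Longrightarrow> a \<in> carrier (free_alg G) \<Longrightarrow> a * p \<in> wlpa_ideal G"
| rmult: "p \<in> wlpa_ideal G \<Longrightarrow> a \<in> carrier (free_alg G) \<Longrightarrow> p * a \<in> wlpa_ideal G"

definition wlpa :: "('v, 'e) wgraph \<Rightarrow> ('k::field, ('v, 'e, 'k) free_elt set) module" where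
  "wlpa G = ring.extend (free_alg G Quot wlpa_ideal G)
     (module.fields (\<lambda>k C. \<Union>p\<in>C. wlpa_ideal G +>\<^bsub>free_alg G\<^esub> pm_scale k p))"

definition wlpa_vtx :: "('v, 'e) wgraph \<Rightarrow> 'v \<Rightarrow> ('v, 'e, 'k::field) free_elt set" where
  "wlpa_vtx G v = wlpa_ideal G +>\<^bsub>free_alg G\<^esub> vtx v"

text \<open>The locale \<^locale>\<open>domain\<close> is restricted to commutative rings.\<close>

definition nc_domain :: "('a, 'm) ring_scheme \<Rightarrow> bool" where
  "nc_domain R \<longleftrightarrow> ring R \<and> carrier R \<noteq> {\<zero>\<^bsub>R\<^esub>} \<and>
     (\<forall>a\<in>carrier R. \<forall>b\<in>carrier R. a \<otimes>\<^bsub>R\<^esub> b = \<zero>\<^bsub>R\<^esub> \<longrightarrow> a = \<zero>\<^bsub>R\<^esub> \<or> b = \<zero>\<^bsub>R\<^esub>)"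

definition alg_iso :: "('k, 'a) module \<Rightarrow> ('k, 'b) module \<Rightarrow> ('a \<Rightarrow> 'b) set" where
  "alg_iso A B = {\<phi> \<in> ring_iso A B.
     \<forall>k. \<forall>a\<in>carrier A. \<phi> (k \<odot>\<^bsub>A\<^esub> a) = k \<odot>\<^bsub>B\<^esub> \<phi> a}"

text \<open>\<open>K[x, x\<^sup>-\<^sup>1]\<close> as the group algebra of the integers\<close>

definition laurent :: "('k::field, int \<Rightarrow>\<^sub>0 'k) module" where
  "laurent = \<lparr>carrier = UNIV, monoid.mult = (*), one = 1, ring.zero = 0, add = (+),
     module.smult = pm_scale\<rparr>"

definition laurent_const :: "'k::field \<Rightarrow> (int \<Rightarrow>\<^sub>0 'k)" where
  "laurent_const k = Poly_Mapping.single 0 k"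

definition laurent_X :: "int \<Rightarrow>\<^sub>0 'k::field" where
  "laurent_X = Poly_Mapping.single 1 1"

text \<open>A word in the letters \<open>S\<^sup>\<plusminus>\<^sup>1\<close> is a list of pairs \<open>(s, b)\<close>, standing for \<open>s\<close> if \<open>b\<close> holds
  and for the inverse of \<open>s\<close> otherwise.\<close>

definition word_value :: "('a, 'm) monoid_scheme \<Rightarrow> ('a \<times> bool) list \<Rightarrow> 'a" where
  "word_value G w =
     foldr (\<lambda>(s, b) a. (if b then s else inv\<^bsub>G\<^esub> s) \<otimes>\<^bsub>G\<^esub> a) w \<one>\<^bsub>G\<^esub>"

definition reduced_word :: "('a \<times> bool) list \<Rightarrow> bool" where
  "reduced_word w \<longleftrightarrow> (\<nexists>u v s b. w = u @ [(s, b), (s, \<not> b)] @ v)"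

definition free_basis :: "('a, 'm) monoid_scheme \<Rightarrow> 'a set \<Rightarrow> bool" where
  "free_basis G S \<longleftrightarrow> S \<subseteq> carrier G \<and> generate G S = carrier G \<and>
     (\<forall>w\<in>lists (S \<times> UNIV). w \<noteq> [] \<and> reduced_word w \<longrightarrow> word_value G w \<noteq> \<one>\<^bsub>G\<^esub>)"

definition free_group :: "('a, 'm) monoid_scheme \<Rightarrow> bool" where
  "free_group G \<longleftrightarrow> group G \<and> (\<exists>S. free_basis G S)"

end

theory Submission
  imports Defs
begin

text \<open>The algebra acts on the space spanned by the words that avoid the leading words of (W3) and
  (W4), so these normal words are linearly independent modulo the relations.

  If condition (3) fails, there are elements \<open>a\<close> and \<open>b\<close> of square zero that act on a suitable
  pair of coordinates like \<open>2 \<times> 2\<close> matrix units. Then \<open>A\<close> is not a domain, and \<open>1 + 2a\<close> and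
  \<open>1 + 2b\<close> generate a free group of rank two by Sanov's ping-pong argument. A non-loop gives such a
  pair through \<open>e\<^sub>1\<close> and \<open>e\<^sub>1\<^sup>*\<close> or \<open>e\<^sub>2\<^sup>*\<close>; with one vertex there is an element with a one-sided
  inverse only, and hence a system of matrix units.

  If there is one vertex, the normal words form a basis. In an LV-rose the product of two normal
  words is, up to shorter words, a signed sum of normal words obtained by a single rewriting step at
  the junction. There are enough edges and enough weights for the top components of a product never
  to cancel. Word length is therefore additive on products, which gives a domain whose units are
  scalars.\<close>

section \<open>Finitely supported functions\<close>

text \<open>Solving (W3) and (W4) for leading words leaves overlaps such as
  \<open>e_i e_1^* f_1\<close> that reduce in two ways. The action settles them: once the relations
  annihilate the span of the normal words, no combination of these words is lost in the quotient.
  The chosen edges have maximal weight because (W3) runs over all indices up to the weight of the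
  vertex; index 1 is used in (W4) because every edge has it. The factor 2 is there because the
  matrices with entry 1 generate SL(2,Z), which has torsion. Characteristic 0 keeps integer
  coordinates distinct. If a non-loop has weight at least 2 and another edge at its source has
  maximal weight, (W3) and (W4) need not make a single product \<open>e_i e_i^*\<close> or
  \<open>e_i^* e_i\<close> a vertex. Words in \<open>e_1\<close> and \<open>e_2^*\<close> keep
  growing there, and a functional that adds up coefficients has to exhibit the matrix action. In a
  rose, two maximal edges leave a replacement word for each forbidden \<open>e_i e_j^*\<close>, and
  weights at least 2 leave one for \<open>e_1^* f_1\<close>. Such a word remembers enough of the
  junction to be traced back to one pair of factors.\<close>

lemma lookup_pm_scale [simp]:
  "Poly_Mapping.lookup (pm_scale k p) x = k * Poly_Mapping.lookup p x"
  unfolding pm_scale_def by (simp add: Poly_Mapping.map.rep_eq when_def)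

lemma pm_scale_add: "pm_scale k (p + q) = pm_scale k p + pm_scale k q"
  by (rule poly_mapping_eqI) (simp add: lookup_add algebra_simps)

lemma pm_scale_diff: "pm_scale k (p - q) = pm_scale k p - pm_scale k q"
  by (rule poly_mapping_eqI) (simp add: lookup_minus algebra_simps)

lemma pm_scale_add_left: "pm_scale (k + l) p = pm_scale k p + pm_scale l p"
  by (rule poly_mapping_eqI) (simp add: lookup_add algebra_simps)

lemma pm_scale_scale [simp]: "pm_scale k (pm_scale l p) = pm_scale (k * l) p"
  by (rule poly_mapping_eqI) (simp add: algebra_simps)

lemma pm_scale_0 [simp]: "pm_scale k 0 = 0" "pm_scale 0 p = 0"
  by (auto intro!: poly_mapping_eqI)

lemma pm_scale_1 [simp]: "pm_scale 1 p = p"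
  by (auto intro!: poly_mapping_eqI)

lemma pm_scale_minus_1: "pm_scale (-1) p = - p"
  by (auto intro!: poly_mapping_eqI)

lemma pm_scale_single [simp]: "pm_scale k (Poly_Mapping.single w c) = Poly_Mapping.single w (k * c)"
  unfolding pm_scale_def by simp

lemma pm_scale_conv_mult: "pm_scale k p = Poly_Mapping.single 0 k * p"
  unfolding pm_scale_def by (rule mult_map_scale_conv_mult)

lemma pm_scale_mult_left: "pm_scale k p * q = pm_scale k (p * q)"
  by (simp add: pm_scale_conv_mult mult.assoc)

lemma keys_pm_scale: "Poly_Mapping.keys (pm_scale k p) \<subseteq> Poly_Mapping.keys p"
  by (auto simp: in_keys_iff)

lemma poly_mapping_sum_single:
  fixes p :: "'a \<Rightarrow>\<^sub>0 'b::comm_monoid_add"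
  shows "p = (\<Sum>w\<in>Poly_Mapping.keys p. Poly_Mapping.single w (Poly_Mapping.lookup p w))"
  by (rule poly_mapping_eqI)
     (auto simp: lookup_sum lookup_single when_def in_keys_iff sum.delta)

text \<open>The case \<open>single\<close> keeps the word inside the support of the given
  \<open>p\<close>, so conditions on the support, such as membership in \<open>V\<close> or in the
  free algebra, are available there without entering the induction predicate.\<close>

lemma pm_induct [case_names zero single add]:
  fixes p :: "'a \<Rightarrow>\<^sub>0 'b::comm_monoid_add"
  assumes "P 0" "\<And>w c. w \<in> Poly_Mapping.keys p \<Longrightarrow> P (Poly_Mapping.single w c)"
    "\<And>p q. P p \<Longrightarrow> P q \<Longrightarrow> P (p + q)"
  shows "P p"
proof -
  have "P (\<Sum>w\<in>S. Poly_Mapping.single w (Poly_Mapping.lookup p w))"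
    if "S \<subseteq> Poly_Mapping.keys p" for S
    using that by (induction S rule: infinite_finite_induct) (auto intro: assms)
  from this[OF order_refl] show ?thesis
    by (simp flip: poly_mapping_sum_single)
qed

lemma pm_scale_mult_right: "p * pm_scale k q = pm_scale k (p * q)"
proof (induction p rule: pm_induct)
  case (single w c)
  show ?case
  proof (induction q rule: pm_induct)
    case (single w' c')
    show ?case by (simp add: mult_single algebra_simps)
  qed (simp_all add: pm_scale_add distrib_left)
qed (simp_all add: pm_scale_add distrib_right)

text \<open>The linear map with prescribed values on a basis. The action of a letter, the passage
  from normal words to the algebra, the evaluation in Laurent polynomials and the functional
  \<open>altsum\<close> are instances.\<close>

definition lext :: "('a \<Rightarrow> 'b \<Rightarrow>\<^sub>0 'k::field) \<Rightarrow> ('a \<Rightarrow>\<^sub>0 'k) \<Rightarrow> ('b \<Rightarrow>\<^sub>0 'k)" where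
  "lext f p = (\<Sum>w\<in>Poly_Mapping.keys p. pm_scale (Poly_Mapping.lookup p w) (f w))"

lemma lext_superset:
  assumes "finite S" "Poly_Mapping.keys p \<subseteq> S"
  shows "lext f p = (\<Sum>w\<in>S. pm_scale (Poly_Mapping.lookup p w) (f w))"
  unfolding lext_def using assms by (intro sum.mono_neutral_left) (auto simp: in_keys_iff)

lemma lext_0 [simp]: "lext f 0 = 0"
  by (simp add: lext_def)

lemma lext_single [simp]: "lext f (Poly_Mapping.single w c) = pm_scale c (f w)"
  by (subst lext_superset[where S = "{w}"]) auto

lemma lext_add: "lext f (p + q) = lext f p + lext f q"
proof -
  let ?S = "Poly_Mapping.keys p \<union> Poly_Mapping.keys q"
  have "Poly_Mapping.keys (p + q) \<subseteq> ?S"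
    by (rule Poly_Mapping.keys_add)
  hence "lext f (p + q) = (\<Sum>w\<in>?S. pm_scale (Poly_Mapping.lookup (p + q) w) (f w))"
    by (intro lext_superset) auto
  also have "\<dots> = lext f p + lext f q"
    by (simp add: lookup_add pm_scale_add_left sum.distrib lext_superset[where S = ?S])
  finally show ?thesis .
qed

lemma lext_scale: "lext f (pm_scale k p) = pm_scale k (lext f p)"
  by (induction p rule: pm_induct) (simp_all add: pm_scale_add lext_add)

lemma lext_uminus: "lext f (- p) = - lext f p"
  using lext_scale[of f "-1" p] by (simp add: pm_scale_minus_1)

lemma lext_diff: "lext f (p - q) = lext f p - lext f q"
  using lext_add[of f p "- q"] by (simp add: lext_uminus)

lemma lext_sum: "lext f (sum g A) = (\<Sum>x\<in>A. lext f (g x))"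
  by (induction A rule: infinite_finite_induct) (auto simp: lext_add)

lemma lookup_lext:
  "Poly_Mapping.lookup (lext f p) x =
    (\<Sum>w\<in>Poly_Mapping.keys p. Poly_Mapping.lookup p w * Poly_Mapping.lookup (f w) x)"
  by (simp add: lext_def lookup_sum)

lemma lext_cong:
  assumes "\<And>w. w \<in> Poly_Mapping.keys p \<Longrightarrow> f w = g w"
  shows "lext f p = lext g p"
  using assms by (simp add: lext_def)

lemma lext_lext: "lext f (lext g p) = lext (\<lambda>w. lext f (g w)) p"
  by (induction p rule: pm_induct) (simp_all add: lext_add lext_scale)

lemma lext_id: "lext (\<lambda>w. Poly_Mapping.single w 1) p = p"
  by (induction p rule: pm_induct) (simp_all add: lext_add)

lemma keys_lext:
  "Poly_Mapping.keys (lext f p) \<subseteq> (\<Union>w\<in>Poly_Mapping.keys p. Poly_Mapping.keys (f w))"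
proof
  fix x assume "x \<in> Poly_Mapping.keys (lext f p)"
  hence "(\<Sum>w\<in>Poly_Mapping.keys p. Poly_Mapping.lookup p w * Poly_Mapping.lookup (f w) x) \<noteq> 0"
    by (simp add: in_keys_iff lookup_lext)
  then obtain w where "w \<in> Poly_Mapping.keys p" "Poly_Mapping.lookup p w * Poly_Mapping.lookup (f w) x \<noteq> 0"
    by (meson sum.neutral)
  thus "x \<in> (\<Union>w\<in>Poly_Mapping.keys p. Poly_Mapping.keys (f w))"
    by (auto simp: in_keys_iff)
qed

lemma list_plus_eq: "u + v = u @ v" and list_zero_eq: "0 = []"
  by (simp_all add: plus_list_def zero_list_def)

section \<open>The quotient algebra\<close>

definition cl :: "('v, 'e) wgraph \<Rightarrow> ('v, 'e, 'k::field) free_elt \<Rightarrow> ('v, 'e, 'k) free_elt set" where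
  "cl G p = wlpa_ideal G +>\<^bsub>free_alg G\<^esub> p"

lemma free_alg_simps [simp]:
  "p \<otimes>\<^bsub>free_alg G\<^esub> q = p * q" "p \<oplus>\<^bsub>free_alg G\<^esub> q = p + q" "\<zero>\<^bsub>free_alg G\<^esub> = 0"
  by (simp_all add: free_alg_def)

lemma carrier_free_alg:
  "p \<in> carrier (free_alg G) \<longleftrightarrow> Poly_Mapping.keys p \<subseteq> lists (gens G) - {[]}"
  by (simp add: free_alg_def)

lemma free_alg_single [simp]:
  "w \<noteq> [] \<Longrightarrow> set w \<subseteq> gens G \<Longrightarrow> Poly_Mapping.single w c \<in> carrier (free_alg G)"
  by (auto simp: carrier_free_alg)

lemma free_alg_0 [simp]: "0 \<in> carrier (free_alg G)"
  by (simp add: carrier_free_alg)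

lemma free_alg_add [simp]:
  "p \<in> carrier (free_alg G) \<Longrightarrow> q \<in> carrier (free_alg G) \<Longrightarrow> p + q \<in> carrier (free_alg G)"
  unfolding carrier_free_alg using Poly_Mapping.keys_add[of p q] by blast

lemma free_alg_scale [simp]: "p \<in> carrier (free_alg G) \<Longrightarrow> pm_scale k p \<in> carrier (free_alg G)"
  unfolding carrier_free_alg using keys_pm_scale[of k p] by blast

lemma free_alg_uminus [simp]: "p \<in> carrier (free_alg G) \<Longrightarrow> - p \<in> carrier (free_alg G)"
  using free_alg_scale[of p G "-1"] by (simp add: pm_scale_minus_1)

lemma free_alg_diff [simp]:
  "p \<in> carrier (free_alg G) \<Longrightarrow> q \<in> carrier (free_alg G) \<Longrightarrow> p - q \<in> carrier (free_alg G)"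
  using free_alg_add[of p G "- q"] by simp

lemma free_alg_sum [simp]:
  "(\<And>x. x \<in> S \<Longrightarrow> f x \<in> carrier (free_alg G)) \<Longrightarrow> sum f S \<in> carrier (free_alg G)"
  by (induction S rule: infinite_finite_induct) auto

lemma free_alg_mult [simp]:
  assumes "p \<in> carrier (free_alg G)" "q \<in> carrier (free_alg G)"
  shows "p * q \<in> carrier (free_alg G)"
proof -
  have "Poly_Mapping.keys (p * q) \<subseteq> {a + b | a b. a \<in> Poly_Mapping.keys p \<and> b \<in> Poly_Mapping.keys q}"
    by (rule Poly_Mapping.keys_mult)
  thus ?thesis
    using assms unfolding carrier_free_alg by (fastforce simp: list_plus_eq)
qed

lemma vtx_in [simp]: "v \<in> verts G \<Longrightarrow> vtx v \<in> carrier (free_alg G)"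
  by (auto simp: vtx_def gens_def)

lemma redge_in [simp]: "e \<in> sedges G \<Longrightarrow> redge G e i \<in> carrier (free_alg G)"
  by (auto simp: redge_def gens_def)

lemma rghost_in [simp]: "e \<in> sedges G \<Longrightarrow> rghost G e i \<in> carrier (free_alg G)"
  by (auto simp: rghost_def gens_def)

lemma ideal_uminus: "p \<in> wlpa_ideal G \<Longrightarrow> - p \<in> wlpa_ideal G"
  using wlpa_ideal.scale[of p G "-1"] by (simp add: pm_scale_minus_1)

lemma ideal_diff: "p \<in> wlpa_ideal G \<Longrightarrow> q \<in> wlpa_ideal G \<Longrightarrow> p - q \<in> wlpa_ideal G"
  using wlpa_ideal.add[of p G "- q"] by (simp add: ideal_uminus)

lemma ideal_sum: "(\<And>x. x \<in> S \<Longrightarrow> f x \<in> wlpa_ideal G) \<Longrightarrow> sum f S \<in> wlpa_ideal G"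
  by (induction S rule: infinite_finite_induct) (auto intro: wlpa_ideal.intros)

lemma cl_alt: "cl G p = {q. q - p \<in> wlpa_ideal G}"
proof -
  have "cl G p = (\<lambda>i. i + p) ` wlpa_ideal G"
    by (auto simp: cl_def a_r_coset_def r_coset_def free_alg_def)
  also have "\<dots> = {q. q - p \<in> wlpa_ideal G}"
    by (force simp: image_iff)
  finally show ?thesis .
qed

text \<open>The ideal is an additive subgroup of the whole type, so classes can be compared without
  placing the representatives in the free algebra.\<close>

lemma cl_eq_iff: "cl G p = cl G q \<longleftrightarrow> p - q \<in> wlpa_ideal G"
proof
  assume "cl G p = cl G q"
  moreover have "p \<in> cl G p" by (simp add: cl_alt wlpa_ideal.zero)
  ultimately show "p - q \<in> wlpa_ideal G" by (simp add: cl_alt)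
next
  assume *: "p - q \<in> wlpa_ideal G"
  have "x - p \<in> wlpa_ideal G \<longleftrightarrow> x - q \<in> wlpa_ideal G" for x
    using wlpa_ideal.add[OF _ *, of "x - p"] ideal_diff[OF _ *, of "x - q"] by auto
  thus "cl G p = cl G q" by (simp add: cl_alt)
qed

lemma cl_0: "cl G 0 = wlpa_ideal G"
  by (simp add: cl_alt)

lemma in_cl_iff: "q \<in> cl G p \<longleftrightarrow> cl G q = cl G p"
  unfolding cl_eq_iff by (simp add: cl_alt)

text \<open>The ideal absorbs combinations of nonempty words. This inclusion makes every
  representative of an element of the quotient such a combination, so products can be computed on
  representatives.\<close>

lemma wlpa_ideal_subset:
  assumes "weighted_graph G" "finite_wgraph G"
  shows "wlpa_ideal G \<subseteq> carrier (free_alg G)"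
proof
  fix p assume "p \<in> wlpa_ideal G"
  thus "p \<in> carrier (free_alg G)"
  proof induction
    case (rel p)
    thus ?case using assms
      by (auto simp: W1_rels_def W2_rels_def W3_rels_def W4_rels_def weighted_graph_def
          out_edges_def intro!: free_alg_diff free_alg_sum free_alg_mult)
  qed auto
qed

lemma wlpa_carrier: "carrier (wlpa G) = cl G ` carrier (free_alg G)"
  by (auto simp: wlpa_def ring.defs module.defs FactRing_def A_RCOSETS_def' cl_def)

lemma cl_in_wlpa [simp]: "p \<in> carrier (free_alg G) \<Longrightarrow> cl G p \<in> carrier (wlpa G)"
  by (simp add: wlpa_carrier)

lemma wlpa_zero: "\<zero>\<^bsub>wlpa G\<^esub> = cl G 0"
  by (simp add: wlpa_def ring.defs FactRing_def cl_0)

lemma wlpa_one: "\<one>\<^bsub>wlpa G\<^esub> = cl G (\<Sum>v\<in>verts G. vtx v)"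
  by (simp add: wlpa_def ring.defs monoid.defs FactRing_def free_alg_def cl_def)

lemma wlpa_add: "cl G p \<oplus>\<^bsub>wlpa G\<^esub> cl G q = cl G (p + q)"
proof -
  have "cl G p \<oplus>\<^bsub>wlpa G\<^esub> cl G q = {x + y | x y. x \<in> cl G p \<and> y \<in> cl G q}"
    by (auto simp: wlpa_def ring.defs FactRing_def set_add_def')
  also have "\<dots> = cl G (p + q)"
  proof safe
    fix x y assume "x \<in> cl G p" "y \<in> cl G q"
    thus "x + y \<in> cl G (p + q)"
      using wlpa_ideal.add[of "x - p" G "y - q"] by (simp add: cl_alt algebra_simps)
  next
    fix x assume "x \<in> cl G (p + q)"
    hence "x - q \<in> cl G p" "q \<in> cl G q" "x = (x - q) + q"
      by (auto simp: cl_alt algebra_simps wlpa_ideal.zero)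
    thus "\<exists>a b. x = a + b \<and> a \<in> cl G p \<and> b \<in> cl G q" by blast
  qed
  finally show ?thesis .
qed

lemma wlpa_smult: "k \<odot>\<^bsub>wlpa G\<^esub> cl G p = cl G (pm_scale k p)"
proof -
  have "k \<odot>\<^bsub>wlpa G\<^esub> cl G p = (\<Union>q\<in>cl G p. cl G (pm_scale k q))"
    by (simp add: wlpa_def ring.defs module.defs FactRing_def cl_def)
  moreover have "cl G (pm_scale k q) = cl G (pm_scale k p)" if "q \<in> cl G p" for q
    using wlpa_ideal.scale[of "q - p" G k] that by (simp add: cl_alt[of G p] cl_eq_iff pm_scale_diff)
  moreover have "p \<in> cl G p" by (simp add: cl_alt wlpa_ideal.zero)
  ultimately show ?thesis by blast
qed

text \<open>In \<open>p * q - p' * q' = p * (q - q') + (p - p') * q'\<close> only \<open>p\<close>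
  and \<open>q'\<close> occur as multipliers of ideal elements, hence the membership conditions on
  just these two.\<close>

lemma cl_mult_cong:
  assumes "p \<in> carrier (free_alg G)" "q' \<in> carrier (free_alg G)"
    "cl G p = cl G p'" "cl G q = cl G q'"
  shows "cl G (p * q) = cl G (p' * q')"
proof -
  have "p * (q - q') \<in> wlpa_ideal G" "(p - p') * q' \<in> wlpa_ideal G"
    using assms by (auto simp: cl_eq_iff intro: wlpa_ideal.lmult wlpa_ideal.rmult)
  from wlpa_ideal.add[OF this] show ?thesis
    by (simp add: cl_eq_iff algebra_simps)
qed

locale fin_wgraph =
  fixes G :: "('v, 'e) wgraph"
  assumes wgraph: "weighted_graph G" and fin: "finite_wgraph G"
begin

lemma finite_verts [simp]: "finite (verts G)" and finite_sedges [simp]: "finite (sedges G)"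
  using fin by (auto simp: finite_wgraph_def)

lemma finite_out_edges [simp]: "finite (out_edges G v)"
  by (simp add: out_edges_def)

lemma src_in [simp]: "e \<in> sedges G \<Longrightarrow> src G e \<in> verts G"
  and rng_in [simp]: "e \<in> sedges G \<Longrightarrow> rng G e \<in> verts G"
  and wt_pos: "e \<in> sedges G \<Longrightarrow> 1 \<le> wt G e"
  using wgraph by (auto simp: weighted_graph_def)

lemma in_cl_carrier: "p \<in> carrier (free_alg G) \<Longrightarrow> q \<in> cl G p \<Longrightarrow> q \<in> carrier (free_alg G)"
  using wlpa_ideal_subset[OF wgraph fin] free_alg_add[of "q - p" G p] by (auto simp: cl_alt)

lemma wlpa_mult:
  assumes "p \<in> carrier (free_alg G)" "q \<in> carrier (free_alg G)"
  shows "cl G p \<otimes>\<^bsub>wlpa G\<^esub> cl G q = cl G (p * q)"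
proof -
  have "cl G p \<otimes>\<^bsub>wlpa G\<^esub> cl G q = (\<Union>a\<in>cl G p. \<Union>b\<in>cl G q. cl G (a * b))"
    by (simp add: wlpa_def ring.defs monoid.defs FactRing_def rcoset_mult_def cl_def)
  moreover have "cl G (a * b) = cl G (p * q)" if "a \<in> cl G p" "b \<in> cl G q" for a b
    using that assms in_cl_carrier by (intro cl_mult_cong) (auto simp: in_cl_iff)
  moreover have "p \<in> cl G p" "q \<in> cl G q" by (simp_all add: cl_alt wlpa_ideal.zero)
  ultimately show ?thesis by blast
qed

lemma cl_relI: "p - q \<in> W1_rels G \<union> W2_rels G \<union> W3_rels G \<union> W4_rels G \<Longrightarrow> cl G p = cl G q"
  by (simp add: cl_eq_iff wlpa_ideal.rel)

lemma cl_W1: "u \<in> verts G \<Longrightarrow> v \<in> verts G \<Longrightarrow>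
    cl G (vtx u * vtx v) = cl G (if u = v then vtx u else 0)"
  by (rule cl_relI) (auto simp: W1_rels_def)

text \<open>For an index outside the range of the weight both generators are 0 by convention, so the
  equations extend to all \<open>i\<close>.\<close>

lemma cl_W2:
  assumes "e \<in> sedges G"
  shows "cl G (vtx (src G e) * redge G e i :: ('v, 'e, 'k::field) free_elt) = cl G (redge G e i)"
    "cl G (redge G e i * vtx (rng G e) :: ('v, 'e, 'k::field) free_elt) = cl G (redge G e i)"
    "cl G (vtx (rng G e) * rghost G e i :: ('v, 'e, 'k::field) free_elt) = cl G (rghost G e i)"
    "cl G (rghost G e i * vtx (src G e) :: ('v, 'e, 'k::field) free_elt) = cl G (rghost G e i)"
proof -
  consider "i \<in> {1..wt G e}" | "redge G e i = (0 :: ('v, 'e, 'k::field) free_elt)" "rghost G e i = (0 :: ('v, 'e, 'k::field) free_elt)"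
    by (cases "i \<in> {1..wt G e}") (auto simp: redge_def rghost_def)
  hence "cl G (vtx (src G e) * redge G e i :: ('v, 'e, 'k::field) free_elt) = cl G (redge G e i) \<and>
    cl G (redge G e i * vtx (rng G e) :: ('v, 'e, 'k::field) free_elt) = cl G (redge G e i) \<and>
    cl G (vtx (rng G e) * rghost G e i :: ('v, 'e, 'k::field) free_elt) = cl G (rghost G e i) \<and>
    cl G (rghost G e i * vtx (src G e) :: ('v, 'e, 'k::field) free_elt) = cl G (rghost G e i)"
  proof cases
    case 1
    thus ?thesis using assms
      by (intro conjI) (rule cl_relI, unfold W2_rels_def, blast)+
  qed auto
  thus "cl G (vtx (src G e) * redge G e i :: ('v, 'e, 'k::field) free_elt) = cl G (redge G e i)"
    "cl G (redge G e i * vtx (rng G e) :: ('v, 'e, 'k::field) free_elt) = cl G (redge G e i)"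
    "cl G (vtx (rng G e) * rghost G e i :: ('v, 'e, 'k::field) free_elt) = cl G (rghost G e i)"
    "cl G (rghost G e i * vtx (src G e) :: ('v, 'e, 'k::field) free_elt) = cl G (rghost G e i)"
    by blast+
qed

lemma cl_W3:
  assumes "v \<in> verts G" "\<not> is_sink G v" "i \<in> {1..vwt G v}" "j \<in> {1..vwt G v}"
  shows "cl G (\<Sum>e\<in>out_edges G v. redge G e i * rghost G e j) = cl G (if i = j then vtx v else 0)"
  using assms by (intro cl_relI) (auto simp: W3_rels_def)

lemma cl_W4:
  assumes "e \<in> sedges G" "f \<in> sedges G"
  shows "cl G (\<Sum>i = 1..max (wt G e) (wt G f). rghost G e i * redge G f i) =
    cl G (if e = f then vtx (rng G e) else 0)"
  using assms by (intro cl_relI) (auto simp: W4_rels_def)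

text \<open>A ghost letter runs against its edge. A word is composable when \<open>grng\<close> of
  each letter equals \<open>gsrc\<close> of the next.\<close>

definition gsrc where "gsrc x = (case x of Vtx v \<Rightarrow> v | Edge e i \<Rightarrow> src G e | Ghost e i \<Rightarrow> rng G e)"
definition grng where "grng x = (case x of Vtx v \<Rightarrow> v | Edge e i \<Rightarrow> rng G e | Ghost e i \<Rightarrow> src G e)"

lemma gen_unit:
  assumes "x \<in> gens G"
  shows "gsrc x \<in> verts G" "grng x \<in> verts G"
    "cl G (vtx (gsrc x) * Poly_Mapping.single [x] 1 :: ('v, 'e, 'k::field) free_elt) = cl G (Poly_Mapping.single [x] 1)"
    "cl G (Poly_Mapping.single [x] 1 * vtx (grng x) :: ('v, 'e, 'k::field) free_elt) = cl G (Poly_Mapping.single [x] 1)"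
proof -
  consider v where "x = Vtx v" "v \<in> verts G"
    | e i where "x = Edge e i" "e \<in> sedges G" "1 \<le> i" "i \<le> wt G e"
    | e i where "x = Ghost e i" "e \<in> sedges G" "1 \<le> i" "i \<le> wt G e"
    using assms by (auto simp: gens_def)
  hence "gsrc x \<in> verts G \<and> grng x \<in> verts G \<and>
    cl G (vtx (gsrc x) * Poly_Mapping.single [x] 1 :: ('v, 'e, 'k::field) free_elt) = cl G (Poly_Mapping.single [x] 1) \<and>
    cl G (Poly_Mapping.single [x] 1 * vtx (grng x) :: ('v, 'e, 'k::field) free_elt) = cl G (Poly_Mapping.single [x] 1)"
  proof cases
    case 1
    thus ?thesis using cl_W1[of v v] by (simp add: gsrc_def grng_def vtx_def)
  next
    case 2
    thus ?thesis using cl_W2[of e i] by (simp add: gsrc_def grng_def redge_def)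
  next
    case 3
    thus ?thesis using cl_W2[of e i] by (simp add: gsrc_def grng_def rghost_def)
  qed
  thus "gsrc x \<in> verts G" "grng x \<in> verts G"
    "cl G (vtx (gsrc x) * Poly_Mapping.single [x] 1 :: ('v, 'e, 'k::field) free_elt) = cl G (Poly_Mapping.single [x] 1)"
    "cl G (Poly_Mapping.single [x] 1 * vtx (grng x) :: ('v, 'e, 'k::field) free_elt) = cl G (Poly_Mapping.single [x] 1)"
    by blast+
qed

lemma cl_mult_left:
  "\<lbrakk>p \<in> carrier (free_alg G); cl G q = cl G q'\<rbrakk> \<Longrightarrow> cl G (p * q) = cl G (p * q')"
  using wlpa_ideal.lmult[of "q - q'" G p] by (simp add: cl_eq_iff algebra_simps)

lemma cl_mult_right:
  "\<lbrakk>q \<in> carrier (free_alg G); cl G p = cl G p'\<rbrakk> \<Longrightarrow> cl G (p * q) = cl G (p' * q)"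
  using wlpa_ideal.rmult[of "p - p'" G q] by (simp add: cl_eq_iff algebra_simps)

lemma cl_add_cong:
  "\<lbrakk>cl G p = cl G p'; cl G q = cl G q'\<rbrakk> \<Longrightarrow> cl G (p + q) = cl G (p' + q')"
  by (metis wlpa_add)

lemma cl_diff_cong:
  "\<lbrakk>cl G p = cl G p'; cl G q = cl G q'\<rbrakk> \<Longrightarrow> cl G (p - q) = cl G (p' - q')"
  using ideal_diff[of "p - p'" G "q - q'"] by (simp add: cl_eq_iff algebra_simps)

lemma cl_scale_cong: "cl G p = cl G p' \<Longrightarrow> cl G (pm_scale k p) = cl G (pm_scale k p')"
  by (metis wlpa_smult)

lemma cl_sum_cong:
  "(\<And>x. x \<in> S \<Longrightarrow> cl G (f x) = cl G (g x)) \<Longrightarrow> cl G (sum f S) = cl G (sum g S)"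
  using ideal_sum[of S "\<lambda>x. f x - g x" G] by (simp add: cl_eq_iff sum_subtractf)

lemma vtx_sum_mult:
  assumes "v \<in> verts G"
  shows "cl G ((\<Sum>u\<in>verts G. vtx u) * vtx v :: ('v, 'e, 'k::field) free_elt) = cl G (vtx v)"
    "cl G (vtx v * (\<Sum>u\<in>verts G. vtx u) :: ('v, 'e, 'k::field) free_elt) = cl G (vtx v)"
proof -
  have "cl G ((\<Sum>u\<in>verts G. vtx u * vtx v) :: ('v, 'e, 'k::field) free_elt) = cl G (\<Sum>u\<in>verts G. if u = v then vtx u else 0)"
    using assms by (intro cl_sum_cong cl_W1)
  thus "cl G ((\<Sum>u\<in>verts G. vtx u) * vtx v :: ('v, 'e, 'k::field) free_elt) = cl G (vtx v)"
    using assms by (simp add: sum_distrib_right)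
  have "cl G ((\<Sum>u\<in>verts G. vtx v * vtx u) :: ('v, 'e, 'k::field) free_elt) = cl G (\<Sum>u\<in>verts G. if v = u then vtx v else 0)"
    using assms by (intro cl_sum_cong cl_W1)
  thus "cl G (vtx v * (\<Sum>u\<in>verts G. vtx u) :: ('v, 'e, 'k::field) free_elt) = cl G (vtx v)"
    using assms by (simp add: sum_distrib_left)
qed

text \<open>The outermost letter of a word absorbs its own vertex, and the sum of all vertices
  absorbs that vertex. One-letter words are treated apart because the remaining factor would be the
  empty word, which is not in the free algebra.\<close>

lemma cl_one_mult:
  fixes p :: "('v, 'e, 'k::field) free_elt"
  assumes "p \<in> carrier (free_alg G)"
  shows "cl G ((\<Sum>u\<in>verts G. vtx u) * p) = cl G p" "cl G (p * (\<Sum>u\<in>verts G. vtx u)) = cl G p"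
proof -
  let ?o = "(\<Sum>u\<in>verts G. vtx u) :: ('v, 'e, 'k) free_elt"
  have o: "?o \<in> carrier (free_alg G)" by simp
  have L: "cl G (?o * Poly_Mapping.single [x] 1) = cl G (Poly_Mapping.single [x] 1)"
    and R: "cl G (Poly_Mapping.single [x] 1 * ?o) = cl G (Poly_Mapping.single [x] 1)"
    if x: "x \<in> gens G" for x
  proof -
    let ?x = "Poly_Mapping.single [x] 1 :: ('v, 'e, 'k) free_elt"
    have x': "?x \<in> carrier (free_alg G)" using x by simp
    have "cl G (?o * ?x) = cl G (?o * (vtx (gsrc x) * ?x))"
      using gen_unit[OF x] o by (intro cl_mult_left) auto
    also have "\<dots> = cl G (vtx (gsrc x) * ?x)"
      unfolding mult.assoc[symmetric] using vtx_sum_mult gen_unit[OF x] x' by (intro cl_mult_right) auto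
    also have "\<dots> = cl G ?x" using gen_unit[OF x] by simp
    finally show "cl G (?o * ?x) = cl G ?x" .
    have "cl G (?x * ?o) = cl G (?x * vtx (grng x) * ?o)"
      using gen_unit[OF x] o by (intro cl_mult_right) auto
    also have "\<dots> = cl G (?x * vtx (grng x))"
      unfolding mult.assoc using vtx_sum_mult gen_unit[OF x] x' by (intro cl_mult_left) auto
    also have "\<dots> = cl G ?x" using gen_unit[OF x] by simp
    finally show "cl G (?x * ?o) = cl G ?x" .
  qed
  have "cl G (?o * p) = cl G p \<and> cl G (p * ?o) = cl G p"
  proof (induction p rule: pm_induct)
    case (single w c)
    hence w: "set w \<subseteq> gens G" "w \<noteq> []" using assms by (auto simp: carrier_free_alg)
    have 1: "cl G (?o * Poly_Mapping.single w c) = cl G (Poly_Mapping.single w c)"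
    proof (cases "length w = 1")
      case True
      then obtain x where "w = [x]" by (auto simp: length_Suc_conv)
      thus ?thesis using cl_scale_cong[OF L[of x], of c] w
        by (simp add: pm_scale_mult_right[symmetric])
    next
      case False
      then obtain x w' where w': "w = x # w'" "w' \<noteq> []" using w by (cases w) (auto)
      have e: "Poly_Mapping.single w c = Poly_Mapping.single [x] 1 * Poly_Mapping.single w' c"
        by (simp add: mult_single list_plus_eq w')
      show ?thesis unfolding e mult.assoc[symmetric]
        using L w w' by (intro cl_mult_right) auto
    qed
    have 2: "cl G (Poly_Mapping.single w c * ?o) = cl G (Poly_Mapping.single w c)"
    proof (cases "length w = 1")
      case True
      then obtain x where "w = [x]" by (auto simp: length_Suc_conv)
      thus ?thesis using cl_scale_cong[OF R[of x], of c] w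
        by (simp add: pm_scale_mult_left[symmetric])
    next
      case False
      then obtain x w' where w': "w = w' @ [x]" "w' \<noteq> []" using w by (cases w rule: rev_cases) (auto)
      have e: "Poly_Mapping.single w c = Poly_Mapping.single w' c * Poly_Mapping.single [x] 1"
        by (simp add: mult_single list_plus_eq w')
      show ?thesis unfolding e mult.assoc
        using R w w' by (intro cl_mult_left) auto
    qed
    from 1 2 show ?case by blast
  next
    case (add p q)
    thus ?case using cl_add_cong by (simp add: distrib_left distrib_right) blast
  qed simp
  thus "cl G (?o * p) = cl G p" "cl G (p * ?o) = cl G p" by blast+
qed

lemma wlpa_ring: "ring (wlpa G)"
proof (rule ringI)
  show "abelian_group (wlpa G)"
  proof (rule abelian_groupI)
    fix x assume "x \<in> carrier (wlpa G)"
    then obtain p where "p \<in> carrier (free_alg G)" "x = cl G p" by (auto simp: wlpa_carrier)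
    thus "\<exists>y\<in>carrier (wlpa G). y \<oplus>\<^bsub>wlpa G\<^esub> x = \<zero>\<^bsub>wlpa G\<^esub>"
      by (intro bexI[of _ "cl G (- p)"]) (auto simp: wlpa_add wlpa_zero)
  qed (auto simp: wlpa_carrier wlpa_add wlpa_zero add.commute add.left_commute add.assoc)
  show "monoid (wlpa G)"
    by (rule monoidI) (auto simp: wlpa_carrier wlpa_mult wlpa_one mult.assoc cl_one_mult)
qed (auto simp: wlpa_carrier wlpa_mult wlpa_add distrib_left distrib_right)

end

abbreviation sing :: "'a \<Rightarrow> 'a \<Rightarrow>\<^sub>0 'k::field" where
  "sing w \<equiv> Poly_Mapping.single w 1"

section \<open>The action on normal words\<close>

text \<open>The edge \<open>al v\<close> has maximal weight at \<open>v\<close>, and \<open>z\<close> is the vertex at which all words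
  end; \<open>K\<close> only fixes the field.\<close>

locale nf_rep = fin_wgraph G for G :: "('v, 'e) wgraph" +
  fixes al :: "'v \<Rightarrow> 'e" and z :: 'v and K :: "'k::field itself"
  assumes al: "v \<in> verts G \<Longrightarrow> \<not> is_sink G v \<Longrightarrow> al v \<in> out_edges G v \<and> wt G (al v) = vwt G v"
begin

lemma wt_le_vwt: "e \<in> out_edges G v \<Longrightarrow> wt G e \<le> vwt G v"
  unfolding vwt_def is_sink_def by (auto intro!: Max_ge)

lemma out_edges_simps: "e \<in> out_edges G v \<longleftrightarrow> e \<in> sedges G \<and> src G e = v"
  by (auto simp: out_edges_def)

definition start :: "('v, 'e) gen list \<Rightarrow> 'v" where
  "start w = (case w of [] \<Rightarrow> z | x # _ \<Rightarrow> gsrc x)"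

lemma start_simps [simp]: "start [] = z" "start (x # w) = gsrc x"
  by (simp_all add: start_def)

lemma gsrc_simps [simp]: "gsrc (Vtx v) = v" "gsrc (Edge e i) = src G e" "gsrc (Ghost e i) = rng G e"
  and grng_simps [simp]: "grng (Vtx v) = v" "grng (Edge e i) = rng G e" "grng (Ghost e i) = src G e"
  by (simp_all add: gsrc_def grng_def)

text \<open>The forbidden subwords \<open>xy\<close> are \<open>\<alpha>\<^sub>i\<alpha>\<^sub>j\<^sup>*\<close> for the chosen edges \<open>\<alpha>\<close>, and \<open>e\<^sub>1\<^sup>*f\<^sub>1\<close>.
  The relations rewrite such an \<open>xy\<close> to \<open>delta x y\<close> minus the sum of the words in
  \<open>alts x y\<close>. Only composable words are considered, so \<open>bad\<close> need not check that \<open>e\<close> and \<open>f\<close>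
  have the same source.\<close>

fun bad :: "('v, 'e) gen \<Rightarrow> ('v, 'e) gen \<Rightarrow> bool" where
  "bad (Edge e i) (Ghost f j) \<longleftrightarrow> e = f \<and> e = al (src G e)"
| "bad (Ghost e i) (Edge f j) \<longleftrightarrow> i = 1 \<and> j = 1"
| "bad _ _ \<longleftrightarrow> False"

fun delta :: "('v, 'e) gen \<Rightarrow> ('v, 'e) gen \<Rightarrow> bool" where
  "delta (Edge e i) (Ghost f j) \<longleftrightarrow> i = j"
| "delta (Ghost e i) (Edge f j) \<longleftrightarrow> e = f"
| "delta _ _ \<longleftrightarrow> False"

fun alts :: "('v, 'e) gen \<Rightarrow> ('v, 'e) gen \<Rightarrow> (('v, 'e) gen \<times> ('v, 'e) gen) set" where
  "alts (Edge e i) (Ghost f j) =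
     (\<lambda>g. (Edge g i, Ghost g j)) ` {g \<in> out_edges G (src G e) - {e}. i \<le> wt G g \<and> j \<le> wt G g}"
| "alts (Ghost e i) (Edge f j) = (\<lambda>k. (Ghost e k, Edge f k)) ` {2..min (wt G e) (wt G f)}"
| "alts _ _ = {}"

text \<open>Left multiplication of a normal word by a generator. One rewriting step suffices: the
  delta term is a suffix of a normal word, and the replacement letters form no forbidden pair with
  each other or with their neighbours.\<close>

fun actg :: "('v, 'e) gen \<Rightarrow> ('v, 'e) gen list \<Rightarrow> (('v, 'e) gen list \<Rightarrow>\<^sub>0 'k)" where
  "actg (Vtx v) w = (if start w = v then sing w else 0)"
| "actg x [] = (if z = grng x then sing [x] else 0)"
| "actg x (y # w) = (if gsrc y = grng x
     then if bad x y
       then (if delta x y then sing w else 0) - (\<Sum>(x', y')\<in>alts x y. sing (x' # y' # w))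
       else sing (x # y # w)
     else 0)"

definition letter :: "('v, 'e) gen \<Rightarrow> bool" where
  "letter x \<longleftrightarrow> x \<in> gens G \<and> (\<forall>v. x \<noteq> Vtx v)"

lemma letter_simps [simp]:
  "letter (Edge e i) \<longleftrightarrow> e \<in> sedges G \<and> 1 \<le> i \<and> i \<le> wt G e"
  "letter (Ghost e i) \<longleftrightarrow> e \<in> sedges G \<and> 1 \<le> i \<and> i \<le> wt G e"
  "\<not> letter (Vtx v)"
  by (auto simp: letter_def gens_def)

lemma letter_cases [consumes 1, case_names Edge Ghost]:
  assumes "letter x"
  obtains e i where "x = Edge e i" "e \<in> sedges G" "1 \<le> i" "i \<le> wt G e"
  | e i where "x = Ghost e i" "e \<in> sedges G" "1 \<le> i" "i \<le> wt G e"
  using assms by (cases x) auto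

text \<open>The normal words. Since \<open>start []\<close> is \<open>z\<close>, the condition on
  the last letter says that the word ends at \<open>z\<close>.\<close>

primrec nod :: "('v, 'e) gen list \<Rightarrow> bool" where
  "nod [] \<longleftrightarrow> True"
| "nod (x # w) \<longleftrightarrow> letter x \<and> grng x = start w \<and> (w \<noteq> [] \<longrightarrow> \<not> bad x (hd w)) \<and> nod w"

lemma finite_alts [simp]: "finite (alts x y)"
  by (cases "(x, y)" rule: alts.cases) auto

text \<open>A replacement changes the edge and keeps the indices, or changes the index and keeps the
  edges. Whether the outer neighbour forms a bad pair depends on the datum that is kept, so no new
  bad pair arises.\<close>

lemma alts_props:
  assumes "(x', y') \<in> alts x y" "letter x" "letter y" "bad x y" "grng x = gsrc y"
  shows "letter x'" "letter y'" "gsrc x' = gsrc x" "grng y' = grng y" "grng x' = gsrc y'"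
    "\<not> bad x' y'" "bad u x' \<Longrightarrow> bad u x" "bad y' u \<Longrightarrow> bad y u"
  using assms
  by (induction x y rule: bad.induct; cases u; auto simp: out_edges_simps)+

lemma nod_letter [simp]: "nod w \<Longrightarrow> x \<in> set w \<Longrightarrow> letter x"
  by (induction w) auto

lemma keys_sum_sing: "Poly_Mapping.keys (\<Sum>x\<in>S. sing (f x)) \<subseteq> f ` S"
  using Poly_Mapping.keys_sum[of "\<lambda>x. sing (f x)" S] by auto

lemma keys_actg_bad:
  assumes "bad x y"
  shows "Poly_Mapping.keys (actg x (y # w)) \<subseteq>
    {u. u = w \<and> delta x y} \<union> (\<lambda>(x', y'). x' # y' # w) ` alts x y"
proof -
  have "Poly_Mapping.keys ((if delta x y then sing w else 0) - (\<Sum>(x', y')\<in>alts x y. sing (x' # y' # w)))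
    \<subseteq> {u. u = w \<and> delta x y} \<union> (\<lambda>(x', y'). x' # y' # w) ` alts x y"
    using keys_sum_sing[of "\<lambda>(x', y'). x' # y' # w" "alts x y"]
      Poly_Mapping.keys_diff[of "if delta x y then sing w else 0" "\<Sum>(x', y')\<in>alts x y. sing (x' # y' # w)"]
    by (fastforce simp: case_prod_unfold split: if_splits)
  thus ?thesis using assms by (cases x) auto
qed

lemma actg_good:
  assumes "letter x" "grng x = start w" "w \<noteq> [] \<Longrightarrow> \<not> bad x (hd w)"
  shows "actg x w = sing (x # w)"
  using assms by (cases x; cases w) auto

lemma actg_not_start: "start w \<noteq> grng x \<Longrightarrow> actg x w = 0"
  by (cases x; cases w) auto

lemma actg_bad:
  assumes "bad x y" "gsrc y = grng x"
  shows "actg x (y # w) = (if delta x y then sing w else 0) - (\<Sum>(x', y')\<in>alts x y. sing (x' # y' # w))"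
  using assms by (cases x) auto

text \<open>Normality makes the span of the normal words invariant, the start vertex gives (W2), and
  the length bound makes word length a filtration.\<close>

lemma actg_nod:
  assumes "nod w" "x \<in> gens G" "u \<in> Poly_Mapping.keys (actg x w :: _ \<Rightarrow>\<^sub>0 'k)"
  shows "nod u \<and> start u = gsrc x \<and> length u \<le> length w + 1"
proof (cases "\<exists>v. x = Vtx v")
  case True
  thus ?thesis using assms by (auto split: if_splits)
next
  case False
  hence x: "letter x" using assms(2) by (simp add: letter_def)
  show ?thesis
  proof (cases "start w = grng x")
    case st: True
    show ?thesis
    proof (cases "w \<noteq> [] \<and> bad x (hd w)")
      case True
      then obtain y w' where w: "w = y # w'" "bad x y" by (cases w) auto
      have y: "letter y" "grng y = start w'" "grng x = gsrc y" using assms(1) st w by auto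
      from keys_actg_bad[OF w(2)] assms(3) w consider "u = w'" "delta x y"
        | x' y' where "(x', y') \<in> alts x y" "u = x' # y' # w'" by fast
      thus ?thesis
      proof cases
        case 1
        from w(2) y 1(2) have "gsrc x = start w'"
          by (cases "(x, y)" rule: bad.cases) auto
        thus ?thesis using assms(1) w 1 by simp
      next
        case 2
        note * = alts_props[OF 2(1) x y(1) w(2) y(3)]
        show ?thesis using assms(1) w y 2 * by auto
      qed
    next
      case False
      hence "actg x w = (sing (x # w) :: _ \<Rightarrow>\<^sub>0 'k)"
        using x st by (intro actg_good) auto
      hence "u = x # w" using assms(3) by simp
      thus ?thesis using assms(1) x st False by auto
    qed
  next
    case False
    thus ?thesis using assms(3) by (simp add: actg_not_start)
  qed
qed

section \<open>The action of the free algebra\<close>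

definition actw :: "('v, 'e) gen list \<Rightarrow> (('v, 'e) gen list \<Rightarrow>\<^sub>0 'k) \<Rightarrow> (('v, 'e) gen list \<Rightarrow>\<^sub>0 'k)" where
  "actw w v = foldr (\<lambda>x. lext (actg x)) w v"

definition act :: "('v, 'e, 'k) free_elt \<Rightarrow> (('v, 'e) gen list \<Rightarrow>\<^sub>0 'k) \<Rightarrow> (('v, 'e) gen list \<Rightarrow>\<^sub>0 'k)" where
  "act p v = lext (\<lambda>w. actw w v) p"

lemma actw_simps [simp]: "actw [] v = v" "actw (x # w) v = lext (actg x) (actw w v)"
  by (simp_all add: actw_def)

lemma actw_append: "actw (u @ w) v = actw u (actw w v)"
  by (simp add: actw_def)

lemma actw_add: "actw w (v + v') = actw w v + actw w v'"
  by (induction w) (auto simp: lext_add)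

lemma actw_scale: "actw w (pm_scale k v) = pm_scale k (actw w v)"
  by (induction w) (auto simp: lext_scale)

lemma actw_0 [simp]: "actw w 0 = 0"
  by (induction w) auto

lemma act_add_left: "act (p + q) v = act p v + act q v"
  and act_diff_left: "act (p - q) v = act p v - act q v"
  and act_uminus_left: "act (- p) v = - act p v"
  and act_scale_left: "act (pm_scale k p) v = pm_scale k (act p v)"
  and act_0_left [simp]: "act 0 v = 0"
  and act_single: "act (Poly_Mapping.single w c) v = pm_scale c (actw w v)"
  and act_sum_left: "act (sum f S) v = (\<Sum>x\<in>S. act (f x) v)"
  by (simp_all add: act_def lext_add lext_diff lext_scale lext_uminus lext_sum)

lemma act_add: "act p (v + v') = act p v + act p v'"
  by (induction p rule: pm_induct) (auto simp: act_add_left act_single actw_add pm_scale_add)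

lemma act_scale: "act p (pm_scale k v) = pm_scale k (act p v)"
  by (induction p rule: pm_induct)
     (auto simp: act_add_left act_single actw_scale pm_scale_add mult.commute)

lemma act_0 [simp]: "act p 0 = 0"
  using act_scale[of p 0 0] by simp

lemma act_uminus: "act p (- v) = - act p v"
  using act_scale[of p "-1" v] by (simp add: pm_scale_minus_1)

lemma act_diff: "act p (v - v') = act p v - act p v'"
  using act_add[of p v "- v'"] by (simp add: act_uminus)

lemma act_sum: "act p (sum f S) = (\<Sum>x\<in>S. act p (f x))"
  by (induction S rule: infinite_finite_induct) (auto simp: act_add)

lemma act_mult: "act (p * q) v = act p (act q v)"
proof (induction p rule: pm_induct)
  case (single w c)
  show ?case
  proof (induction q rule: pm_induct)
    case (single w' c')
    show ?case by (simp add: act_single mult_single list_plus_eq actw_append actw_scale)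
  next
    case (add q q')
    thus ?case by (simp only: distrib_left act_add_left act_add)
  qed simp
next
  case (add p p')
  thus ?case by (simp only: distrib_right act_add_left)
qed simp

text \<open>The relations are verified on normal words only; their span is the invariant subspace on
  which the quotient algebra acts.\<close>

definition V :: "(('v, 'e) gen list \<Rightarrow>\<^sub>0 'k) set" where
  "V = {v. \<forall>w\<in>Poly_Mapping.keys v. nod w}"

lemma V_sing [simp]: "nod w \<Longrightarrow> Poly_Mapping.single w c \<in> V"
  by (simp add: V_def)

lemma V_lext: "(\<And>w. w \<in> Poly_Mapping.keys p \<Longrightarrow> f w \<in> V) \<Longrightarrow> lext f p \<in> V"
  unfolding V_def using keys_lext[of f p] by blast

lemma V_nod: "v \<in> V \<Longrightarrow> w \<in> Poly_Mapping.keys v \<Longrightarrow> nod w"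
  by (simp add: V_def)

lemma V_actg: "nod w \<Longrightarrow> x \<in> gens G \<Longrightarrow> actg x w \<in> V"
  unfolding V_def using actg_nod by blast

lemma V_actw: "set w \<subseteq> gens G \<Longrightarrow> v \<in> V \<Longrightarrow> actw w v \<in> V"
proof (induction w)
  case (Cons x w)
  hence "actw w v \<in> V" "x \<in> gens G" by simp_all
  thus ?case using V_nod V_actg by (simp add: V_lext)
qed simp

lemma V_act: "p \<in> carrier (free_alg G) \<Longrightarrow> v \<in> V \<Longrightarrow> act p v \<in> V"
  unfolding act_def by (intro V_lext V_actw) (unfold carrier_free_alg, blast+)

lemma act_eq_0_on_V:
  assumes "\<And>w. nod w \<Longrightarrow> act p (sing w) = 0" "v \<in> V"
  shows "act p v = 0"
proof -
  have "act p v = act p (lext sing v)" by (simp add: lext_id)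
  also have "\<dots> = (\<Sum>w\<in>Poly_Mapping.keys v. act p (pm_scale (Poly_Mapping.lookup v w) (sing w)))"
    by (simp add: lext_def act_sum)
  also have "\<dots> = 0"
    unfolding act_scale using assms(1) V_nod[OF assms(2)] by (intro sum.neutral) simp
  finally show ?thesis .
qed

lemma act_vtx: "act (vtx u) (sing w) = (if start w = u then sing w else 0)"
  by (simp add: vtx_def act_single)

lemma act_redge:
  "act (redge G e i) (sing w) = (if 1 \<le> i \<and> i \<le> wt G e then actg (Edge e i) w else 0)"
  by (simp add: redge_def act_single)

lemma act_rghost:
  "act (rghost G e i) (sing w) = (if 1 \<le> i \<and> i \<le> wt G e then actg (Ghost e i) w else 0)"
  by (simp add: rghost_def act_single)

lemma act_vtx_lext:
  assumes "\<And>u. u \<in> Poly_Mapping.keys v \<Longrightarrow> start u = x"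
  shows "act (vtx x) v = v"
proof -
  have "act (vtx x) v = lext (actg (Vtx x)) v"
    by (simp add: vtx_def act_single)
  also have "\<dots> = lext sing v"
    using assms by (intro lext_cong) auto
  finally show ?thesis by (simp add: lext_id)
qed

section \<open>The relations act as zero on the span of the normal words\<close>

lemma act_W1: "u \<in> verts G \<Longrightarrow> v \<in> verts G \<Longrightarrow>
    act (vtx u * vtx v - (if u = v then vtx u else 0)) (sing w) = 0"
  by (auto simp: act_diff_left act_mult act_vtx)

lemma act_W2:
  assumes "e \<in> sedges G" "i \<in> {1..wt G e}" "nod w"
  shows "act (vtx (src G e) * redge G e i - redge G e i) (sing w) = 0"
    "act (redge G e i * vtx (rng G e) - redge G e i) (sing w) = 0"
    "act (vtx (rng G e) * rghost G e i - rghost G e i) (sing w) = 0"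
    "act (rghost G e i * vtx (src G e) - rghost G e i) (sing w) = 0"
proof -
  have g: "Edge e i \<in> gens G" "Ghost e i \<in> gens G"
    using assms by (auto simp: gens_def)
  have "act (vtx (src G e)) (act (redge G e i) (sing w)) = act (redge G e i) (sing w)"
    using assms actg_nod[OF assms(3) g(1)]
    by (intro act_vtx_lext) (auto simp: act_redge)
  thus "act (vtx (src G e) * redge G e i - redge G e i) (sing w) = 0"
    by (simp add: act_diff_left act_mult)
  have "act (vtx (rng G e)) (act (rghost G e i) (sing w)) = act (rghost G e i) (sing w)"
    using assms actg_nod[OF assms(3) g(2)]
    by (intro act_vtx_lext) (auto simp: act_rghost)
  thus "act (vtx (rng G e) * rghost G e i - rghost G e i) (sing w) = 0"
    by (simp add: act_diff_left act_mult)
  show "act (redge G e i * vtx (rng G e) - redge G e i) (sing w) = 0"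
    by (auto simp: act_diff_left act_mult act_vtx act_redge actg_not_start)
  show "act (rghost G e i * vtx (src G e) - rghost G e i) (sing w) = 0"
    by (auto simp: act_diff_left act_mult act_vtx act_rghost actg_not_start)
qed

text \<open>Rewriting at the chosen edge yields the delta term minus exactly the words contributed
  by the other edges, which cancel. Maximal weight ensures that both indices occur at the chosen
  edge.\<close>

lemma Edge_Ghost_sum:
  assumes v: "v \<in> verts G" "\<not> is_sink G v" and ij: "i \<in> {1..vwt G v}" "j \<in> {1..vwt G v}"
  shows "(\<Sum>e\<in>out_edges G v. if i \<le> wt G e \<and> j \<le> wt G e then actg (Edge e i) (Ghost e j # w) else 0)
    = (if i = j then sing w else 0)"
proof -
  let ?a = "al v"
  have a: "?a \<in> out_edges G v" "wt G ?a = vwt G v" using al v by auto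
  hence sa: "src G ?a = v" by (simp add: out_edges_def)
  let ?f = "\<lambda>e. if i \<le> wt G e \<and> j \<le> wt G e then actg (Edge e i) (Ghost e j # w) else 0"
  let ?S = "{g \<in> out_edges G v - {?a}. i \<le> wt G g \<and> j \<le> wt G g}"
  have "sum ?f (out_edges G v) = ?f ?a + sum ?f (out_edges G v - {?a})"
    using a by (simp add: sum.remove)
  also have "sum ?f (out_edges G v - {?a}) = (\<Sum>g\<in>?S. sing (Edge g i # Ghost g j # w))"
    by (intro sum.mono_neutral_cong_right) (auto simp: out_edges_def)
  also have "\<dots> = (\<Sum>(x', y')\<in>alts (Edge ?a i) (Ghost ?a j). sing (x' # y' # w))"
    by (simp add: sa sum.reindex inj_on_def)
  also have "?f ?a = (if i = j then sing w else 0) - \<dots>"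
    using ij a sa by simp
  finally show ?thesis by simp
qed

text \<open>The same cancellation as for (W3), with index 1 in the role of the chosen edge.\<close>

lemma Ghost_Edge_sum:
  assumes "e \<in> sedges G" "f \<in> sedges G" "src G e = src G f"
  shows "(\<Sum>i = 1..min (wt G e) (wt G f). actg (Ghost e i) (Edge f i # w)) = (if e = f then sing w else 0)"
proof -
  let ?m = "min (wt G e) (wt G f)"
  have m: "1 \<le> ?m" using assms wt_pos by auto
  have "(\<Sum>i = 1..?m. actg (Ghost e i) (Edge f i # w)) =
    actg (Ghost e 1) (Edge f 1 # w) + (\<Sum>i = 2..?m. actg (Ghost e i) (Edge f i # w))"
    using m by (simp add: sum.atLeast_Suc_atMost numeral_2_eq_2)
  also have "(\<Sum>i = 2..?m. actg (Ghost e i) (Edge f i # w)) = (\<Sum>i = 2..?m. sing (Ghost e i # Edge f i # w))"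
    using assms by (intro sum.cong) auto
  also have "\<dots> = (\<Sum>(x', y')\<in>alts (Ghost e 1) (Edge f 1). sing (x' # y' # w))"
    by (simp add: sum.reindex inj_on_def)
  also have "actg (Ghost e 1) (Edge f 1 # w) = (if e = f then sing w else 0) - \<dots>"
    using assms by simp
  finally show ?thesis by simp
qed

text \<open>The obstruction is the overlap \<open>e_i e_1^* f_1\<close> at the head of a word.
  Writing \<open>w = f_1 w'\<close>, the rewriting of \<open>e_1^* f_1\<close> gives the sum of
  \<open>f_i w'\<close> and, for each k from 2 on, minus the delta of i and k times
  \<open>f_k w'\<close>. Only i = 1 survives.\<close>

lemma act_W3_eq:
  assumes v: "v \<in> verts G" "\<not> is_sink G v" and ij: "i \<in> {1..vwt G v}" "j \<in> {1..vwt G v}"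
    and w: "nod w" "start w = v"
  shows "(\<Sum>e\<in>out_edges G v. act (redge G e i) (act (rghost G e j) (sing w))) =
    (if i = j then sing w else (0 :: _ \<Rightarrow>\<^sub>0 'k))"
proof (cases "j = 1 \<and> (\<exists>f w'. w = Edge f 1 # w')")
  case False
  have "(\<Sum>e\<in>out_edges G v. act (redge G e i) (act (rghost G e j) (sing w))) =
    (\<Sum>e\<in>out_edges G v. if i \<le> wt G e \<and> j \<le> wt G e then actg (Edge e i) (Ghost e j # w) else 0)"
  proof (rule sum.cong)
    fix e assume e: "e \<in> out_edges G v"
    have "actg (Ghost e j) w = sing (Ghost e j # w)" if "j \<le> wt G e"
    proof (rule actg_good)
      show "\<not> bad (Ghost e j) (hd w)" if "w \<noteq> []"
        using that False w by (cases w; cases "hd w") auto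
    qed (use that e w ij in \<open>auto simp: out_edges_simps\<close>)
    thus "act (redge G e i) (act (rghost G e j) (sing w)) =
      (if i \<le> wt G e \<and> j \<le> wt G e then actg (Edge e i) (Ghost e j # w) else 0)"
      using ij by (auto simp: act_rghost act_redge)
  qed auto
  thus ?thesis using Edge_Ghost_sum[OF v ij] by simp
next
  case True
  \<comment> \<open>Here \<open>e\<^sub>1\<^sup>* w\<close> gets rewritten; the words \<open>e\<^sub>k\<^sup>* f\<^sub>k w'\<close> that arise fall under
    the first case, with \<open>k\<close> in place of \<open>j\<close>.\<close>
  then obtain f w' where j: "j = 1" and ww: "w = Edge f 1 # w'" by blast
  have f: "f \<in> sedges G" "src G f = v" "rng G f = start w'" "nod w'"
    "w' \<noteq> [] \<Longrightarrow> \<not> bad (Edge f 1) (hd w')"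
    using w by (auto simp: ww)
  have fo: "f \<in> out_edges G v" using f by (simp add: out_edges_simps)
  have fv: "wt G f \<le> vwt G v" by (rule wt_le_vwt[OF fo])
  \<comment> \<open>Badness of an edge letter followed by a ghost does not depend on the index of
    the edge letter, so normality of \<open>f_1 w'\<close> carries over to
    \<open>f_k w'\<close>.\<close>
  have gd: "actg (Edge f k) w' = sing (Edge f k # w')" if "1 \<le> k" "k \<le> wt G f" for k
  proof (rule actg_good)
    show "\<not> bad (Edge f k) (hd w')" if "w' \<noteq> []"
      using f(5)[OF that] by (cases "hd w'") auto
  qed (use f that in auto)
  let ?X = "\<lambda>e. \<Sum>k = 2..wt G f. if k \<le> wt G e then sing (Ghost e k # Edge f k # w') else (0 :: _ \<Rightarrow>\<^sub>0 'k)"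
  have G1: "act (rghost G e j) (sing w) = (if e = f then sing w' else 0) - ?X e" if e: "e \<in> out_edges G v" for e
  proof -
    have "src G e = v" "e \<in> sedges G" using e by (auto simp: out_edges_simps)
    hence "act (rghost G e j) (sing w) = (if e = f then sing w' else 0) -
       (\<Sum>k=2..min (wt G e) (wt G f). sing (Ghost e k # Edge f k # w'))"
      using f wt_pos[of e] by (simp add: act_rghost ww j sum.reindex inj_on_def)
    also have "(\<Sum>k=2..min (wt G e) (wt G f). sing (Ghost e k # Edge f k # w')) = ?X e"
      by (intro sum.mono_neutral_cong_left) auto
    finally show ?thesis .
  qed
  have "(\<Sum>e\<in>out_edges G v. act (redge G e i) (act (rghost G e j) (sing w))) =
      (\<Sum>e\<in>out_edges G v. act (redge G e i) (if e = f then sing w' else 0)) -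
      (\<Sum>e\<in>out_edges G v. act (redge G e i) (?X e))"
    by (simp add: G1 act_diff sum_subtractf)
  also have "(\<Sum>e\<in>out_edges G v. act (redge G e i) (if e = f then sing w' else 0)) =
      (\<Sum>e\<in>out_edges G v. if e = f then act (redge G f i) (sing w') else 0)"
    by (intro sum.cong) auto
  also have "\<dots> = act (redge G f i) (sing w')"
    using fo by (simp add: sum.delta)
  also have "\<dots> = (if i \<le> wt G f then sing (Edge f i # w') else 0)"
    using gd[of i] ij by (auto simp: act_redge)
  also have "(\<Sum>e\<in>out_edges G v. act (redge G e i) (?X e)) =
      (\<Sum>k = 2..wt G f. \<Sum>e\<in>out_edges G v.
        if i \<le> wt G e \<and> k \<le> wt G e then actg (Edge e i) (Ghost e k # Edge f k # w') else 0)"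
    unfolding act_sum by (subst sum.swap, intro sum.cong) (use ij in \<open>auto simp: act_redge\<close>)
  also have "\<dots> = (\<Sum>k = 2..wt G f. if i = k then sing (Edge f k # w') else 0)"
    using fv ij by (intro sum.cong refl Edge_Ghost_sum v) auto
  also have "\<dots> = (if 2 \<le> i \<and> i \<le> wt G f then sing (Edge f i # w') else 0)"
    by (simp add: sum.delta)
  finally show ?thesis
    using ij j ww wt_pos[OF f(1)] by (auto split: if_splits)
qed

lemma act_W3:
  assumes v: "v \<in> verts G" "\<not> is_sink G v" and ij: "i \<in> {1..vwt G v}" "j \<in> {1..vwt G v}"
    and w: "nod w"
  shows "act ((\<Sum>e\<in>out_edges G v. redge G e i * rghost G e j) - (if i = j then vtx v else 0)) (sing w) = 0"
proof (cases "start w = v")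
  case True
  show ?thesis using act_W3_eq[OF v ij w True]
    by (auto simp: act_diff_left act_sum_left act_mult act_vtx True)
next
  case False
  have "act (rghost G e j) (sing w) = 0" if "e \<in> out_edges G v" for e
    using that False by (auto simp: act_rghost actg_not_start out_edges_simps)
  thus ?thesis using False by (auto simp: act_diff_left act_sum_left act_mult act_vtx)
qed

text \<open>The dual overlap: \<open>e_i^* f_i f_j^*\<close> with \<open>f\<close> chosen. Rewriting
  \<open>f_i f_j^*\<close> gives \<open>e_j^* w'\<close> minus, for each other edge g, the sum over
  i of \<open>e_i^* g_i g_j^* w'\<close>. That sum vanishes unless g = e, so for e different from f
  the two contributions cancel.\<close>

lemma act_W4_eq:
  assumes ef: "e \<in> sedges G" "f \<in> sedges G" "src G e = src G f" and w: "nod w" "start w = rng G f"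
  shows "(\<Sum>i = 1..min (wt G e) (wt G f). act (rghost G e i) (act (redge G f i) (sing w))) =
    (if e = f then sing w else (0 :: _ \<Rightarrow>\<^sub>0 'k))"
proof (cases "\<exists>j w'. f = al (src G f) \<and> w = Ghost f j # w'")
  case False
  have "(\<Sum>i = 1..min (wt G e) (wt G f). act (rghost G e i) (act (redge G f i) (sing w))) =
    (\<Sum>i = 1..min (wt G e) (wt G f). actg (Ghost e i) (Edge f i # w))"
  proof (rule sum.cong)
    fix i assume i: "i \<in> {1..min (wt G e) (wt G f)}"
    have "actg (Edge f i) w = sing (Edge f i # w)"
    proof (rule actg_good)
      show "\<not> bad (Edge f i) (hd w)" if "w \<noteq> []"
        using that False w by (cases w; cases "hd w") auto
    qed (use i ef w in auto)
    thus "act (rghost G e i) (act (redge G f i) (sing w)) = actg (Ghost e i) (Edge f i # w)"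
      using i by (auto simp: act_rghost act_redge)
  qed auto
  thus ?thesis using Ghost_Edge_sum[OF ef] by simp
next
  case True
  then obtain j w' where fa: "f = al (src G f)" and ww: "w = Ghost f j # w'" by blast
  define v where "v = src G f"
  have sv: "src G f = v" by (simp add: v_def)
  have bd: "bad (Edge f i) (Ghost f j)" for i using fa by simp
  have v: "v \<in> verts G" "\<not> is_sink G v" "src G e = v"
    using ef by (auto simp: v_def is_sink_def out_edges_def)
  have av: "al v = f" using fa unfolding v_def by (rule sym)
  have j: "1 \<le> j" "j \<le> wt G f" "v = start w'" "nod w'" "w' \<noteq> [] \<Longrightarrow> \<not> bad (Ghost f j) (hd w')"
    using w by (auto simp: ww v_def)
  \<comment> \<open>As \<open>f\<close> has maximal weight, the sum over i runs up to the weight of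
    \<open>e\<close>, which covers the full range needed for each other edge
    \<open>g\<close>.\<close>
  have ef': "wt G e \<le> wt G f"
    using al[OF v(1,2)] wt_le_vwt[of e v] v ef by (auto simp: out_edges_simps av)
  \<comment> \<open>Badness of a ghost followed by an edge letter depends on the indices only, so
    the edge of the ghost may be exchanged.\<close>
  have gd: "actg (Ghost g j) w' = sing (Ghost g j # w')" if "j \<le> wt G g" "g \<in> out_edges G v" for g
  proof (rule actg_good)
    show "\<not> bad (Ghost g j) (hd w')" if "w' \<noteq> []"
      using j(5)[OF that] by (cases "hd w'") auto
  qed (use that j in \<open>auto simp: out_edges_simps\<close>)
  let ?S = "{g \<in> out_edges G v - {f}. j \<le> wt G g}"
  let ?X = "\<lambda>i. \<Sum>g\<in>?S. if i \<le> wt G g then sing (Edge g i # Ghost g j # w') else (0 :: _ \<Rightarrow>\<^sub>0 'k)"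
  have G1: "act (redge G f i) (sing w) = (if i = j then sing w' else 0) - ?X i"
    if i: "i \<in> {1..min (wt G e) (wt G f)}" for i
  proof -
    have "act (redge G f i) (sing w) = (if i = j then sing w' else 0) -
      (\<Sum>g\<in>{g \<in> out_edges G v - {f}. i \<le> wt G g \<and> j \<le> wt G g}. sing (Edge g i # Ghost g j # w'))"
      using i by (simp add: act_redge ww actg_bad[OF bd] sv sum.reindex inj_on_def del: actg.simps)
    also have "(\<Sum>g\<in>{g \<in> out_edges G v - {f}. i \<le> wt G g \<and> j \<le> wt G g}. sing (Edge g i # Ghost g j # w')) = ?X i"
      by (intro sum.mono_neutral_cong_left) auto
    finally show ?thesis .
  qed
  have "(\<Sum>i = 1..min (wt G e) (wt G f). act (rghost G e i) (act (redge G f i) (sing w))) =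
    (\<Sum>i = 1..min (wt G e) (wt G f). act (rghost G e i) (if i = j then sing w' else 0)) -
    (\<Sum>i = 1..min (wt G e) (wt G f). act (rghost G e i) (?X i))"
    by (simp add: G1 act_diff sum_subtractf)
  also have "(\<Sum>i = 1..min (wt G e) (wt G f). act (rghost G e i) (if i = j then sing w' else 0)) =
    (\<Sum>i = 1..min (wt G e) (wt G f). if i = j then act (rghost G e j) (sing w') else 0)"
    by (intro sum.cong) auto
  also have "\<dots> = act (rghost G e j) (sing w')"
    using j by (auto simp: sum.delta act_rghost)
  also have "\<dots> = (if j \<le> wt G e then sing (Ghost e j # w') else 0)"
    using gd[of e] j ef v by (auto simp: act_rghost out_edges_simps)
  also have "(\<Sum>i = 1..min (wt G e) (wt G f). act (rghost G e i) (?X i)) =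
    (\<Sum>g\<in>?S. \<Sum>i = 1..min (wt G e) (wt G f).
       if i \<le> wt G g then actg (Ghost e i) (Edge g i # Ghost g j # w') else 0)"
    unfolding act_sum by (subst sum.swap, intro sum.cong) (auto simp: act_rghost)
  also have "\<dots> = (\<Sum>g\<in>?S. \<Sum>i = 1..min (wt G e) (wt G g). actg (Ghost e i) (Edge g i # Ghost g j # w'))"
    using ef' by (intro sum.cong refl sum.mono_neutral_cong_right) auto
  also have "\<dots> = (\<Sum>g\<in>?S. if e = g then sing (Ghost g j # w') else 0)"
    using ef v by (intro sum.cong refl Ghost_Edge_sum) (auto simp: out_edges_simps)
  also have "\<dots> = (if e \<noteq> f \<and> j \<le> wt G e then sing (Ghost e j # w') else 0)"
    using ef v by (auto simp: sum.delta out_edges_simps)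
  finally show ?thesis using j by (auto simp: ww)
qed

text \<open>If the sources differ, the relation demands 0. This holds because \<open>f_i\<close>
  produces words that start at the source of \<open>f\<close>, and these are killed by
  \<open>e_i^*\<close>.\<close>

lemma act_W4:
  assumes ef: "e \<in> sedges G" "f \<in> sedges G" and w: "nod w"
  shows "act ((\<Sum>i = 1..max (wt G e) (wt G f). rghost G e i * redge G f i)
       - (if e = f then vtx (rng G e) else 0)) (sing w :: _ \<Rightarrow>\<^sub>0 'k) = 0"
proof (cases "start w = rng G f")
  case False
  have "act (redge G f i) (sing w) = 0" for i
    using False by (auto simp: act_redge actg_not_start)
  thus ?thesis using False by (auto simp: act_diff_left act_sum_left act_mult act_vtx)
next
  case st: True
  have *: "(\<Sum>i = 1..max (wt G e) (wt G f). act (rghost G e i) (act (redge G f i) (sing w))) =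
    (if e = f then sing w else (0 :: _ \<Rightarrow>\<^sub>0 'k))"
  proof (cases "src G e = src G f")
    case True
    have "(\<Sum>i = 1..max (wt G e) (wt G f). act (rghost G e i) (act (redge G f i) (sing w :: _ \<Rightarrow>\<^sub>0 'k))) =
      (\<Sum>i = 1..min (wt G e) (wt G f). act (rghost G e i) (act (redge G f i) (sing w)))"
      by (intro sum.mono_neutral_right) (auto simp: rghost_def redge_def)
    thus ?thesis using act_W4_eq[OF ef True w st] by simp
  next
    case False
    have "act (rghost G e i) (act (redge G f i) (sing w :: _ \<Rightarrow>\<^sub>0 'k)) = 0" for i
    proof (cases "letter (Edge f i)")
      case True
      have "act (rghost G e i) (act (redge G f i) (sing w :: _ \<Rightarrow>\<^sub>0 'k)) =
        act (rghost G e i) (lext sing (actg (Edge f i) w))"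
        using True by (simp add: act_redge lext_id)
      also have "\<dots> = 0"
        unfolding lext_def act_sum act_scale
      proof (intro sum.neutral ballI)
        fix u assume "u \<in> Poly_Mapping.keys (actg (Edge f i) w :: _ \<Rightarrow>\<^sub>0 'k)"
        hence "start u = src G f" using actg_nod[OF w, of "Edge f i" u] True by (auto simp: letter_def)
        thus "pm_scale (Poly_Mapping.lookup (actg (Edge f i) w) u) (act (rghost G e i) (sing u)) = 0"
          using False by (auto simp: act_rghost actg_not_start)
      qed
      finally show ?thesis .
    qed (use ef in \<open>auto simp: redge_def\<close>)
    thus ?thesis using False by auto
  qed
  thus ?thesis by (auto simp: act_diff_left act_sum_left act_mult act_vtx st)
qed

text \<open>Closure under right multiplication rests on the invariance of \<open>V\<close>:
  \<open>p * a\<close> acts on \<open>v\<close> as \<open>p\<close> does on the vector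
  \<open>act a v\<close> of \<open>V\<close>.\<close>

lemma act_ideal: "p \<in> wlpa_ideal G \<Longrightarrow> v \<in> V \<Longrightarrow> act p v = 0"
proof (induction arbitrary: v rule: wlpa_ideal.induct)
  case (rel p)
  have "act p (sing w) = 0" if w: "nod w" for w
  proof -
    from rel(1) consider "p \<in> W1_rels G" | "p \<in> W2_rels G" | "p \<in> W3_rels G" | "p \<in> W4_rels G" by blast
    thus ?thesis
    proof cases
      case 1
      then obtain u v where "u \<in> verts G" "v \<in> verts G"
        "p = vtx u * vtx v - (if u = v then vtx u else 0)"
        unfolding W1_rels_def by blast
      thus ?thesis by (simp only: act_W1)
    next
      case 2
      then obtain e i where ei: "e \<in> sedges G" "i \<in> {1..wt G e}"
        and "p \<in> {vtx (src G e) * redge G e i - redge G e i,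
          redge G e i * vtx (rng G e) - redge G e i,
          vtx (rng G e) * rghost G e i - rghost G e i,
          rghost G e i * vtx (src G e) - rghost G e i}"
        unfolding W2_rels_def by blast
      thus ?thesis by (elim insertE emptyE) (simp_all only: act_W2[OF ei w])
    next
      case 3
      then obtain v i j where vij: "v \<in> verts G" "\<not> is_sink G v" "i \<in> {1..vwt G v}" "j \<in> {1..vwt G v}"
        and p: "p = (\<Sum>e\<in>out_edges G v. redge G e i * rghost G e j) - (if i = j then vtx v else 0)"
        unfolding W3_rels_def by blast
      show ?thesis unfolding p by (rule act_W3[OF vij w])
    next
      case 4
      then obtain e f where "e \<in> sedges G" "f \<in> sedges G"
        "p = (\<Sum>i = 1..max (wt G e) (wt G f). rghost G e i * redge G f i)
          - (if e = f then vtx (rng G e) else 0)"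
        unfolding W4_rels_def by blast
      thus ?thesis using w by (simp only: act_W4)
    qed
  qed
  thus ?case using rel(2) by (rule act_eq_0_on_V)
qed (simp_all add: act_add_left act_scale_left act_mult V_act)

lemma act_cong: "cl G p = cl G q \<Longrightarrow> v \<in> V \<Longrightarrow> act p v = act q v"
  using act_ideal[of "p - q" v] by (simp add: cl_eq_iff act_diff_left)

text \<open>The action of the quotient. The choice of representative is harmless on \<open>V\<close>
  by \<open>act_cong\<close>, which asks nothing else of the representatives.\<close>

definition val :: "('v, 'e, 'k) free_elt set \<Rightarrow> (('v, 'e) gen list \<Rightarrow>\<^sub>0 'k) \<Rightarrow> (('v, 'e) gen list \<Rightarrow>\<^sub>0 'k)" where
  "val x v = act (SOME p. x = cl G p) v"

lemma val_cl: "v \<in> V \<Longrightarrow> val (cl G p) v = act p v"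
  unfolding val_def by (rule act_cong, rule sym, rule someI) (rule refl)

end

section \<open>Free subgroups of groups of units\<close>

lemma word_value_Cons:
  "word_value M ((s, b) # w) = (if b then s else inv\<^bsub>M\<^esub> s) \<otimes>\<^bsub>M\<^esub> word_value M w"
  by (simp add: word_value_def)

lemma word_value_Nil: "word_value M [] = \<one>\<^bsub>M\<^esub>"
  by (simp add: word_value_def)

lemma (in group) word_value_closed:
  "w \<in> lists (S \<times> UNIV) \<Longrightarrow> S \<subseteq> carrier G \<Longrightarrow> word_value G w \<in> carrier G"
  by (induction w) (auto simp: word_value_Cons word_value_Nil)

lemma (in group) word_value_subgroup:
  assumes "subgroup H G" "S \<subseteq> H" "w \<in> lists (S \<times> UNIV)"
  shows "word_value (G\<lparr>carrier := H\<rparr>) w = word_value G w"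
  using assms(3)
proof (induction w)
  case (Cons x w)
  obtain s b where x: "x = (s, b)" by force
  hence "s \<in> H" using Cons assms by auto
  thus ?case using Cons assms by (simp add: word_value_Cons x)
qed (simp add: word_value_Nil)

lemma reduced_word_Cons:
  "reduced_word (t # w) \<Longrightarrow> reduced_word w \<and> (w \<noteq> [] \<longrightarrow> \<not> (fst t = fst (hd w) \<and> snd t \<noteq> snd (hd w)))"
proof
  assume r: "reduced_word (t # w)"
  show "reduced_word w"
    unfolding reduced_word_def
  proof
    assume "\<exists>u v s b. w = u @ [(s, b), (s, \<not> b)] @ v"
    then obtain u v s b where "t # w = (t # u) @ [(s, b), (s, \<not> b)] @ v" by auto
    thus False using r unfolding reduced_word_def by blast
  qed
  show "w \<noteq> [] \<longrightarrow> \<not> (fst t = fst (hd w) \<and> snd t \<noteq> snd (hd w))"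
  proof (intro impI notI)
    assume "w \<noteq> []" and *: "fst t = fst (hd w) \<and> snd t \<noteq> snd (hd w)"
    then obtain y v where w: "w = y # v" by (cases w) auto
    have "t # w = [] @ [(fst t, snd t), (fst t, \<not> snd t)] @ v"
      using * w by (cases t; cases y) auto
    thus False using r unfolding reduced_word_def by blast
  qed
qed

lemma reduced_commutator:
  assumes "s \<noteq> t"
  shows "reduced_word [(s, True), (t, True), (s, False), (t, False)]"
  unfolding reduced_word_def using assms
  by (auto simp: Cons_eq_append_conv)

text \<open>For distinct basis elements the commutator word is reduced, yet its value in an abelian
  group is 1. This shows both that abelian free groups are cyclic and that a free group on two
  elements is not.\<close>

lemma (in comm_group) free_basis_unique:
  assumes "free_basis G S" "s \<in> S" "t \<in> S"
  shows "s = t"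
proof (rule ccontr)
  assume "s \<noteq> t"
  let ?w = "[(s, True), (t, True), (s, False), (t, False)]"
  have st: "s \<in> carrier G" "t \<in> carrier G" using assms by (auto simp: free_basis_def)
  have "word_value G ?w = s \<otimes> t \<otimes> inv (s \<otimes> t)"
    using st by (simp add: word_value_Cons word_value_Nil inv_mult m_assoc)
  hence "word_value G ?w = \<one>"
    using st by simp
  moreover have "?w \<in> lists (S \<times> UNIV)" using assms by auto
  ultimately show False
    using reduced_commutator[OF \<open>s \<noteq> t\<close>] assms(1) unfolding free_basis_def by blast
qed

lemma (in comm_group) free_imp_cyclic:
  assumes "free_group G"
  shows "cyclic_group G"
proof -
  obtain S where S: "free_basis G S" using assms by (auto simp: free_group_def)
  obtain s where s: "s \<in> carrier G" "generate G {s} = carrier G"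
  proof (cases "S = {}")
    case True
    hence "carrier G = {\<one>}" using S by (simp add: free_basis_def generate_empty)
    moreover have "generate G {\<one>} = {\<one>}"
      by (metis calculation generate_incl generate.one singletonD subsetI subset_antisym empty_subsetI insert_subset)
    ultimately show ?thesis using that[of "\<one>"] by simp
  next
    case False
    then obtain s where "s \<in> S" by blast
    hence "S = {s}" using free_basis_unique[OF S] by blast
    thus ?thesis using that[of s] S by (auto simp: free_basis_def)
  qed
  thus ?thesis
    unfolding cyclic_group_def subgroup_generated_def by (intro bexI[of _ s]) auto
qed

section \<open>Ping-pong for a pair of square-zero elements\<close>

lemma (in ring) square_zero_unit:
  assumes "c \<in> carrier R" "c \<otimes> c = \<zero>"
  shows "\<one> \<oplus> c \<in> Units R" "inv (\<one> \<oplus> c) = \<one> \<ominus> c"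
proof -
  have "(\<one> \<oplus> c) \<otimes> (\<one> \<ominus> c) = \<one>" "(\<one> \<ominus> c) \<otimes> (\<one> \<oplus> c) = \<one>"
    using assms by (simp_all add: l_distr r_distr minus_eq r_minus l_minus a_assoc r_neg l_neg)
  note * = this
  have c: "\<one> \<oplus> c \<in> carrier R" "\<one> \<ominus> c \<in> carrier R" using assms by simp_all
  show "\<one> \<oplus> c \<in> Units R" unfolding Units_def using * c by blast
  show "inv (\<one> \<oplus> c) = \<one> \<ominus> c" using inv_unique'[OF c *] by simp
qed

text \<open>On the coordinates \<open>(f, g)\<close>, left multiplication by \<open>a\<close> and \<open>b\<close> acts by the matrix units
  \<open>E\<^sub>1\<^sub>2\<close> and \<open>E\<^sub>2\<^sub>1\<close>.\<close>

locale matrix_pair = ring R for R (structure) +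
  fixes a b :: 'a and f g :: "'a \<Rightarrow> 'k::field_char_0" and x0 y0 :: 'a and l :: 'k
  assumes ab [simp]: "a \<in> carrier R" "b \<in> carrier R" "a \<otimes> a = \<zero>" "b \<otimes> b = \<zero>"
    and add: "\<And>x y. x \<in> carrier R \<Longrightarrow> y \<in> carrier R \<Longrightarrow> f (x \<oplus> y) = f x + f y"
      "\<And>x y. x \<in> carrier R \<Longrightarrow> y \<in> carrier R \<Longrightarrow> g (x \<oplus> y) = g x + g y"
    and fg: "\<And>x. x \<in> carrier R \<Longrightarrow> f (a \<otimes> x) = g x" "\<And>x. x \<in> carrier R \<Longrightarrow> g (a \<otimes> x) = 0"
      "\<And>x. x \<in> carrier R \<Longrightarrow> f (b \<otimes> x) = 0" "\<And>x. x \<in> carrier R \<Longrightarrow> g (b \<otimes> x) = f x"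
    and x0: "x0 \<in> carrier R" "f x0 = l" "g x0 = 0"
    and y0: "y0 \<in> carrier R" "f y0 = 0" "g y0 = l"
    and l: "l \<noteq> 0"
begin

lemma fg_zero: "f \<zero> = 0" "g \<zero> = 0"
  using add[of \<zero> \<zero>] by auto

lemma fg_uminus: "x \<in> carrier R \<Longrightarrow> f (\<ominus> x) = - f x" "x \<in> carrier R \<Longrightarrow> g (\<ominus> x) = - g x"
  using add[of x "\<ominus> x"] by (auto simp: r_neg fg_zero eq_neg_iff_add_eq_0 add.commute)

text \<open>The square of \<open>a\<close> is zero, but \<open>a\<close> is not, since
  \<open>f (a \<otimes> y0) = g y0 = l\<close>.\<close>

lemma not_nc_domain: "\<not> nc_domain R"
proof
  assume "nc_domain R"
  hence "a = \<zero>" using ab unfolding nc_domain_def by blast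
  hence "f (a \<otimes> y0) = f \<zero>" using y0 by simp
  thus False using fg(1)[of y0] y0 l fg_zero by simp
qed

text \<open>Sanov's matrices have off-diagonal entry 2. It is written as \<open>a \<oplus> a\<close>
  because a ring has no scalars to offer.\<close>

definition u where "u = \<one> \<oplus> (a \<oplus> a)"
definition v where "v = \<one> \<oplus> (b \<oplus> b)"

lemma uv_Units: "u \<in> Units R" "v \<in> Units R"
  and uv_inv: "inv u = \<one> \<ominus> (a \<oplus> a)" "inv v = \<one> \<ominus> (b \<oplus> b)"
  unfolding u_def v_def by (rule square_zero_unit; simp add: l_distr r_distr)+

lemma uv_closed [simp]: "u \<in> carrier R" "v \<in> carrier R" "inv u \<in> carrier R" "inv v \<in> carrier R"
  using uv_Units by auto

text \<open>The field carries no order, so the inequalities of the ping-pong argument are stated for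
  integer multiples of \<open>l\<close>. These integers are unique in characteristic 0.\<close>

definition coords :: "'a \<Rightarrow> int \<Rightarrow> int \<Rightarrow> bool" where
  "coords x m n \<longleftrightarrow> x \<in> carrier R \<and> f x = of_int m * l \<and> g x = of_int n * l"

lemma coords_step:
  assumes "coords x m n"
  shows "coords (u \<otimes> x) (m + 2 * n) n" "coords (inv u \<otimes> x) (m - 2 * n) n"
    "coords (v \<otimes> x) m (n + 2 * m)" "coords (inv v \<otimes> x) m (n - 2 * m)"
  using assms uv_closed unfolding coords_def uv_inv unfolding u_def v_def
  by (auto simp: l_distr add fg minus_eq l_minus fg_uminus algebra_simps)

lemma coords_unique: "coords x m n \<Longrightarrow> coords x m' n' \<Longrightarrow> m = m' \<and> n = n'"
  using l by (auto simp: coords_def)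

lemma coords_x0: "coords x0 1 0" and coords_y0: "coords y0 0 1"
  using x0 y0 by (auto simp: coords_def)

lemma uv_neq: "u \<noteq> v"
  using coords_unique[OF coords_step(1)[OF coords_x0], of 1 2] coords_step(3)[OF coords_x0] by auto

text \<open>The ping-pong invariant: the leading letter of a word determines which coordinate
  dominates and the relative sign of the two.\<close>

definition pp :: "'a \<times> bool \<Rightarrow> int \<Rightarrow> int \<Rightarrow> bool" where
  "pp t m n \<longleftrightarrow> 2 \<le> \<bar>m\<bar> + \<bar>n\<bar> \<and> (if fst t = u then \<bar>n\<bar> < \<bar>m\<bar> else \<bar>m\<bar> < \<bar>n\<bar>) \<and>
     (if snd t then 0 \<le> m \<and> 0 \<le> n \<or> m \<le> 0 \<and> n \<le> 0 else 0 \<le> m \<and> n \<le> 0 \<or> m \<le> 0 \<and> 0 \<le> n)"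

text \<open>The last letter of a word acts before all others. \<open>u\<close> fixes the coordinates
  (1, 0) and \<open>v\<close> fixes (0, 1), so the starting vector is the one that this letter
  moves.\<close>

definition st where "st t = (if fst t = u then y0 else x0)"

text \<open>When \<open>u\<close> or its inverse acts after a power of \<open>v\<close>, the bound
  \<open>\<bar>m\<bar> < \<bar>n\<bar>\<close> gives
  \<open>\<bar>m \<plusminus> 2 * n\<bar> > \<bar>n\<bar>\<close>. When it repeats, the relative
  sign of m and n makes the absolute values add up. Reducedness excludes the remaining combination,
  and \<open>v\<close> is symmetric.\<close>

lemma word_coords:
  assumes "w \<in> lists ({u, v} \<times> UNIV)" "reduced_word w" "w \<noteq> []"
  shows "\<exists>m n. coords (word_value (units_of R) w \<otimes> st (last w)) m n \<and> pp (hd w) m n"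
  using assms
proof (induction w rule: list.induct)
  case (Cons t w)
  interpret U: group "units_of R" by (rule units_group)
  obtain s c where t: "t = (s, c)" by force
  have sc: "s = u \<or> s = v" using Cons t by auto
  let ?s = "if c then s else inv s"
  have inv: "inv\<^bsub>units_of R\<^esub> s = inv s" using sc uv_Units units_of_inv by auto
  have w: "word_value (units_of R) w \<in> carrier R"
  proof -
    have "w \<in> lists ({u, v} \<times> UNIV)" using Cons.prems(1) by (simp add: lists_eq_set)
    thus ?thesis
      using U.word_value_closed[of w "{u, v}"] uv_Units by (simp add: units_of_carrier Units_closed)
  qed
  have s: "?s \<in> carrier R" "st (last w) \<in> carrier R" "st t \<in> carrier R"
    using sc x0 y0 by (auto simp: st_def)
  have e: "word_value (units_of R) (t # w) = ?s \<otimes> word_value (units_of R) w"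
    by (simp add: t word_value_Cons units_of_mult inv)
  have r: "reduced_word w" and h: "w \<noteq> [] \<Longrightarrow> \<not> (fst t = fst (hd w) \<and> snd t \<noteq> snd (hd w))"
    using reduced_word_Cons[OF Cons.prems(2)] by auto
  show ?case
  proof (cases "w = []")
    case True
    have "word_value (units_of R) (t # w) \<otimes> st (last (t # w)) = ?s \<otimes> st t"
      using s by (simp add: e[unfolded True] True word_value_Nil units_of_one)
    moreover have "\<exists>m n. coords (?s \<otimes> st t) m n \<and> pp t m n"
    proof (cases "s = u")
      case True
      thus ?thesis using coords_step(1,2)[OF coords_y0] by (cases c) (force simp: st_def t pp_def)+
    next
      case False
      thus ?thesis using sc coords_step(3,4)[OF coords_x0] by (cases c) (force simp: st_def t pp_def)+
    qed
    ultimately show ?thesis by (metis list.sel(1))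
  next
    case False
    let ?y = "word_value (units_of R) w \<otimes> st (last w)"
    obtain m n where mn: "coords ?y m n" "pp (hd w) m n"
      using Cons.IH Cons.prems False r by auto
    have hw: "fst (hd w) = u \<or> fst (hd w) = v" using Cons.prems False by (cases w) auto
    have "word_value (units_of R) (t # w) \<otimes> st (last (t # w)) = ?s \<otimes> ?y"
      using s w False by (simp add: e m_assoc)
    moreover have "\<exists>m n. coords (?s \<otimes> ?y) m n \<and> pp t m n"
    proof (cases "s = u")
      case True
      show ?thesis
      proof (cases c)
        case c: True
        have "pp t (m + 2 * n) n"
          using mn(2) h[OF False] hw True c uv_neq unfolding pp_def t by (auto split: if_splits)
        thus ?thesis using coords_step(1)[OF mn(1)] True c by auto
      next
        case c: False
        have "pp t (m - 2 * n) n"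
          using mn(2) h[OF False] hw True c uv_neq unfolding pp_def t by (auto split: if_splits)
        thus ?thesis using coords_step(2)[OF mn(1)] True c by auto
      qed
    next
      case su: False
      hence sv: "s = v" using sc by blast
      show ?thesis
      proof (cases c)
        case c: True
        have "pp t m (n + 2 * m)"
          using mn(2) h[OF False] hw sv c uv_neq unfolding pp_def t by (auto split: if_splits)
        thus ?thesis using coords_step(3)[OF mn(1)] sv c by auto
      next
        case c: False
        have "pp t m (n - 2 * m)"
          using mn(2) h[OF False] hw sv c uv_neq unfolding pp_def t by (auto split: if_splits)
        thus ?thesis using coords_step(4)[OF mn(1)] sv c by auto
      qed
    qed
    ultimately show ?thesis by simp
  qed
qed simp

text \<open>The identity would leave the starting vector in place. Its coordinates have absolute
  values with sum 1, below the bound 2 of the invariant.\<close>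

lemma word_value_neq_one:
  assumes "w \<in> lists ({u, v} \<times> UNIV)" "reduced_word w" "w \<noteq> []"
  shows "word_value (units_of R) w \<noteq> \<one>"
proof
  assume "word_value (units_of R) w = \<one>"
  then obtain m n where "coords (st (last w)) m n" "pp (hd w) m n"
    using word_coords[OF assms] x0 y0 by (auto simp: st_def split: if_splits)
  thus False
    using coords_unique[OF coords_x0, of m n] coords_unique[OF coords_y0, of m n]
    by (auto simp: st_def pp_def split: if_splits)
qed

theorem noncyclic_free_subgroup:
  "\<exists>H. subgroup H (units_of R) \<and> free_group ((units_of R)\<lparr>carrier := H\<rparr>) \<and>
     \<not> cyclic_group ((units_of R)\<lparr>carrier := H\<rparr>)"
proof -
  interpret U: group "units_of R" by (rule units_group)
  define H where "H = generate (units_of R) {u, v}"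
  have uv: "{u, v} \<subseteq> carrier (units_of R)" using uv_Units by (simp add: units_of_carrier)
  have H: "subgroup H (units_of R)" unfolding H_def by (rule U.generate_is_subgroup[OF uv])
  have uvH: "{u, v} \<subseteq> H" unfolding H_def by (auto intro: generate.incl)
  have fb: "free_basis ((units_of R)\<lparr>carrier := H\<rparr>) {u, v}"
    unfolding free_basis_def
  proof (intro conjI ballI impI)
    show "generate ((units_of R)\<lparr>carrier := H\<rparr>) {u, v} = carrier ((units_of R)\<lparr>carrier := H\<rparr>)"
      using U.generate_consistent[OF uvH H] by (simp add: H_def)
  next
    fix w assume "w \<in> lists ({u, v} \<times> UNIV)" "w \<noteq> [] \<and> reduced_word w"
    thus "word_value ((units_of R)\<lparr>carrier := H\<rparr>) w \<noteq> \<one>\<^bsub>(units_of R)\<lparr>carrier := H\<rparr>\<^esub>"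
      using word_value_neq_one[of w] U.word_value_subgroup[OF H uvH] by (simp add: units_of_one)
  qed (use uvH in simp)
  have gH: "group ((units_of R)\<lparr>carrier := H\<rparr>)" by (rule U.subgroup_imp_group[OF H])
  \<comment> \<open>A cyclic group is abelian, and an abelian group has no free basis with two
    elements.\<close>
  have "\<not> cyclic_group ((units_of R)\<lparr>carrier := H\<rparr>)"
    using comm_group.free_basis_unique[OF _ fb, of u v] group.cyclic_imp_abelian_group[OF gH] uv_neq
    by blast
  thus ?thesis using H fb gH by (auto simp: free_group_def)
qed

end

section \<open>Graphs outside the three cases\<close>

context fin_wgraph
begin

lemma ex_max_edge:
  assumes "\<not> is_sink G v"
  shows "\<exists>e\<in>out_edges G v. wt G e = vwt G v"
proof -
  have "Max (wt G ` out_edges G v) \<in> wt G ` out_edges G v"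
    using assms by (intro Max_in) (auto simp: is_sink_def)
  thus ?thesis unfolding vwt_def using assms by force
qed

text \<open>Prescribing the chosen edge on \<open>S\<close> allows a particular edge to be avoided
  there. The end vertex is left open, so one \<open>al\<close> serves for every choice of
  it.\<close>

lemma nf_rep_exists:
  assumes "\<And>v. v \<in> S \<Longrightarrow> h v \<in> out_edges G v \<and> wt G (h v) = vwt G v"
  shows "\<exists>al. nf_rep G al \<and> (\<forall>v\<in>S. al v = h v)"
proof -
  define al where "al v = (if v \<in> S then h v else SOME e. e \<in> out_edges G v \<and> wt G e = vwt G v)" for v
  have "al v \<in> out_edges G v \<and> wt G (al v) = vwt G v" if "\<not> is_sink G v" for v
  proof (cases "v \<in> S")
    case False
    have "\<exists>e. e \<in> out_edges G v \<and> wt G e = vwt G v" using ex_max_edge[OF that] by blast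
    from someI_ex[OF this] show ?thesis using False by (simp add: al_def)
  qed (use assms in \<open>simp add: al_def\<close>)
  hence "nf_rep G al" by unfold_locales
  moreover have "\<forall>v\<in>S. al v = h v" by (simp add: al_def)
  ultimately show ?thesis by blast
qed

end

context nf_rep
begin

lemma val_add:
  assumes "x \<in> carrier (wlpa G)" "y \<in> carrier (wlpa G)" "v \<in> V"
  shows "val (x \<oplus>\<^bsub>wlpa G\<^esub> y) v = val x v + val y v"
  using assms by (auto simp: wlpa_carrier wlpa_add val_cl act_add_left)

lemma val_mult:
  assumes "x \<in> carrier (wlpa G)" "y \<in> carrier (wlpa G)" "v \<in> V"
  shows "val (x \<otimes>\<^bsub>wlpa G\<^esub> y) v = val x (val y v)"
  using assms by (auto simp: wlpa_carrier wlpa_mult val_cl act_mult V_act)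

end

definition additive_on :: "('a, 'm) ring_scheme \<Rightarrow> ('a \<Rightarrow> 'k::field) \<Rightarrow> bool" where
  "additive_on R f \<longleftrightarrow> (\<forall>x\<in>carrier R. \<forall>y\<in>carrier R. f (x \<oplus>\<^bsub>R\<^esub> y) = f x + f y)"

context fin_wgraph
begin

text \<open>Applied to the empty word at the far end of the generator, an element yields a vector
  whose coefficient at the one-letter word is the functional. It certifies that the generators do
  not vanish in the quotient.\<close>

lemma generator_functional:
  assumes "e \<in> sedges G" "1 \<le> i" "i \<le> wt G e"
  shows "\<exists>L. additive_on (wlpa G) L \<and> L (cl G (redge G e i :: ('v, 'e, 'k::field) free_elt)) = (1 :: 'k)"
    and "\<exists>L. additive_on (wlpa G) L \<and> L (cl G (rghost G e i :: ('v, 'e, 'k::field) free_elt)) = (1 :: 'k)"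
proof -
  obtain al where al: "nf_rep G al" using nf_rep_exists[of "{}"] by auto
  show "\<exists>L. additive_on (wlpa G) L \<and> L (cl G (redge G e i :: ('v, 'e, 'k) free_elt)) = (1 :: 'k)"
  proof -
    interpret nf_rep G al "rng G e" "TYPE('k)" by (rule al)
    show ?thesis
      by (rule exI[of _ "\<lambda>x. Poly_Mapping.lookup (val x (sing [])) [Edge e i]"])
         (use assms in \<open>simp add: additive_on_def val_add lookup_add val_cl act_redge\<close>)
  qed
  show "\<exists>L. additive_on (wlpa G) L \<and> L (cl G (rghost G e i :: ('v, 'e, 'k) free_elt)) = (1 :: 'k)"
  proof -
    interpret nf_rep G al "src G e" "TYPE('k)" by (rule al)
    show ?thesis
      by (rule exI[of _ "\<lambda>x. Poly_Mapping.lookup (val x (sing [])) [Ghost e i]"])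
         (use assms in \<open>simp add: additive_on_def val_add lookup_add val_cl act_rghost\<close>)
  qed
qed

end

definition has_matrix_pair :: "('a, 'm) ring_scheme \<Rightarrow> 'k::field_char_0 itself \<Rightarrow> bool" where
  "has_matrix_pair R K \<longleftrightarrow> (\<exists>a b f (g :: 'a \<Rightarrow> 'k) x0 y0 l. matrix_pair R a b f g x0 y0 l)"

lemma additive_on_zero:
  assumes "ring R" "additive_on R L"
  shows "L \<zero>\<^bsub>R\<^esub> = 0"
proof -
  interpret ring R by fact
  have "L (\<zero>\<^bsub>R\<^esub> \<oplus>\<^bsub>R\<^esub> \<zero>\<^bsub>R\<^esub>) = L \<zero>\<^bsub>R\<^esub> + L \<zero>\<^bsub>R\<^esub>"
    using assms(2) unfolding additive_on_def by blast
  hence "L \<zero>\<^bsub>R\<^esub> + L \<zero>\<^bsub>R\<^esub> = L \<zero>\<^bsub>R\<^esub> + 0"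
    by (simp only: l_zero zero_closed add_0_right)
  thus ?thesis by (simp only: add_left_cancel)
qed

section \<open>Two ring-theoretic sources of matrix pairs\<close>

lemma matrix_units_pair:
  fixes R (structure) and L :: "'a \<Rightarrow> 'k::field_char_0"
  assumes R: "ring R" and abc: "a \<in> carrier R" "b \<in> carrier R" "c \<in> carrier R"
    and ab: "a \<otimes> a = \<zero>" "b \<otimes> b = \<zero>" "a \<otimes> b \<otimes> a = a" "b \<otimes> a \<otimes> b = b"
    and l: "additive_on R L" "L (a \<otimes> b \<otimes> c) \<noteq> 0"
  shows "has_matrix_pair R TYPE('k)"
proof -
  interpret ring R by fact
  have abc': "a \<otimes> (a \<otimes> x) = \<zero>" "b \<otimes> (b \<otimes> x) = \<zero>" "a \<otimes> (b \<otimes> (a \<otimes> x)) = a \<otimes> x"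
    "b \<otimes> (a \<otimes> (b \<otimes> x)) = b \<otimes> x" if "x \<in> carrier R" for x
    using that abc ab by (simp_all flip: m_assoc)
  have l': "L (x \<oplus> y) = L x + L y" if "x \<in> carrier R" "y \<in> carrier R" for x y
    using l(1) that by (simp add: additive_on_def)
  \<comment> \<open>Here \<open>a \<otimes> b\<close> and \<open>b \<otimes> a\<close> are
    idempotents. The coordinates read off the component cut out by \<open>a \<otimes> b\<close>,
    directly and after a shift by \<open>a\<close>, and the test vectors are the images of
    \<open>c\<close> under \<open>a \<otimes> b\<close> and \<open>b\<close>.\<close>
  have "matrix_pair R a b (\<lambda>x. L (a \<otimes> (b \<otimes> x))) (\<lambda>x. L (a \<otimes> x)) (a \<otimes> (b \<otimes> c)) (b \<otimes> c)
    (L (a \<otimes> b \<otimes> c))"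
    by unfold_locales
       (use abc ab l in \<open>simp_all add: abc' l' r_distr additive_on_zero[OF R l(1)] m_assoc\<close>)
  thus ?thesis unfolding has_matrix_pair_def by blast
qed

text \<open>Jacobson's construction: with the idempotent
  \<open>q = \<one> \<ominus> y \<otimes> x\<close> the elements \<open>y^i q x^j\<close> are matrix
  units, and the pair used is \<open>q \<otimes> x\<close>, \<open>y \<otimes> q\<close>. The
  element \<open>c\<close> killed by \<open>x\<close> is fixed by \<open>q\<close> and shows that
  \<open>q\<close> is not zero.\<close>

lemma one_sided_inverse_pair:
  fixes R (structure) and L :: "'a \<Rightarrow> 'k::field_char_0"
  assumes R: "ring R" and xyc: "x \<in> carrier R" "y \<in> carrier R" "c \<in> carrier R"
    and xy: "x \<otimes> y = \<one>" "x \<otimes> c = \<zero>"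
    and l: "additive_on R L" "L c \<noteq> 0"
  shows "has_matrix_pair R TYPE('k)"
proof -
  interpret ring R by fact
  define q where "q = \<one> \<ominus> y \<otimes> x"
  have q: "q \<in> carrier R" using xyc by (simp add: q_def)
  have xq: "x \<otimes> q = \<zero>"
  proof -
    have "x \<otimes> q = x \<ominus> x \<otimes> y \<otimes> x"
      using xyc by (simp add: q_def minus_eq r_distr r_minus m_assoc)
    thus ?thesis using xyc xy by (simp add: minus_eq r_neg)
  qed
  have qy: "q \<otimes> y = \<zero>"
  proof -
    have "q \<otimes> y = y \<ominus> y \<otimes> (x \<otimes> y)"
      using xyc by (simp add: q_def minus_eq l_distr l_minus m_assoc)
    thus ?thesis using xyc xy by (simp add: minus_eq r_neg)
  qed
  have qq: "q \<otimes> q = q"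
  proof -
    have "q \<otimes> q = q \<ominus> y \<otimes> (x \<otimes> q)"
      using xyc q by (subst q_def) (simp add: minus_eq l_distr l_minus m_assoc)
    thus ?thesis using xyc q xq by (simp add: minus_eq)
  qed
  have qc: "q \<otimes> c = c"
  proof -
    have "q \<otimes> c = c \<ominus> y \<otimes> (x \<otimes> c)"
      using xyc by (simp add: q_def minus_eq l_distr l_minus m_assoc)
    thus ?thesis using xyc xy by (simp add: minus_eq)
  qed
  have *: "x \<otimes> (y \<otimes> z) = z" "x \<otimes> (q \<otimes> z) = \<zero>" "q \<otimes> (y \<otimes> z) = \<zero>" "q \<otimes> (q \<otimes> z) = q \<otimes> z"
    if "z \<in> carrier R" for z
    using that xyc q xy xq qy qq by (simp_all flip: m_assoc)
  show ?thesis
    by (rule matrix_units_pair[OF R _ _ xyc(3), of "q \<otimes> x" "y \<otimes> q" L])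
       (use xyc q xy xq qy qq qc l in \<open>simp_all add: m_assoc *\<close>)
qed

section \<open>Matrix pairs from non-loops\<close>

context fin_wgraph
begin

lemma cl_mult_zero:
  assumes "p \<in> carrier (free_alg G)" "q \<in> carrier (free_alg G)" "u \<in> verts G" "v \<in> verts G" "u \<noteq> v"
    "cl G (p * vtx u) = cl G p" "cl G (vtx v * q) = cl G q"
  shows "cl G (p * q) = cl G 0"
proof -
  have "cl G (p * q) = cl G ((p * vtx u) * q)"
    by (rule cl_mult_right) (use assms in auto)
  also have "\<dots> = cl G ((p * vtx u) * (vtx v * q))"
    by (rule cl_mult_left) (use assms in auto)
  also have "(p * vtx u) * (vtx v * q) = p * ((vtx u * vtx v) * q)"
    by (simp add: mult.assoc)
  also have "cl G \<dots> = cl G (p * (0 * q))"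
    by (intro cl_mult_left cl_mult_right) (use assms cl_W1[of u v] in auto)
  finally show ?thesis by simp
qed

lemma edge_edge_zero:
  assumes "e \<in> sedges G" "src G e \<noteq> rng G e"
  shows "cl G (redge G e i * redge G e j) = cl G 0" "cl G (rghost G e i * rghost G e j) = cl G 0"
proof -
  show "cl G (redge G e i * redge G e j) = cl G 0"
    by (rule cl_mult_zero[of _ _ "rng G e" "src G e"]) (use assms in \<open>simp_all add: cl_W2\<close>)
  show "cl G (rghost G e i * rghost G e j) = cl G 0"
    by (rule cl_mult_zero[of _ _ "src G e" "rng G e"]) (use assms in \<open>simp_all add: cl_W2\<close>)
qed

text \<open>As soon as one of the two products is a vertex, (W2) gives \<open>a b a = a\<close> and
  \<open>b a b = b\<close>. The squares vanish because \<open>e\<close> is not a loop.\<close>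

lemma nonloop_pair:
  assumes e: "e \<in> sedges G" "src G e \<noteq> rng G e" and i: "1 \<le> i" "i \<le> wt G e"
    and or: "cl G (redge G e i * rghost G e i) = cl G (vtx (src G e) :: ('v, 'e, 'k::field_char_0) free_elt) \<or>
      cl G (rghost G e i * redge G e i) = cl G (vtx (rng G e) :: ('v, 'e, 'k::field_char_0) free_elt)"
  shows "has_matrix_pair (wlpa G :: ('k, ('v, 'e, 'k) free_elt set) module) TYPE('k)"
proof -
  let ?a = "redge G e i :: ('v, 'e, 'k) free_elt" and ?b = "rghost G e i :: ('v, 'e, 'k) free_elt"
  obtain L where l: "additive_on (wlpa G) L" "L (cl G ?a) = (1 :: 'k)"
    using generator_functional(1)[OF e(1) i] by blast
  have "cl G (?a * ?b * ?a) = cl G ?a \<and> cl G (?b * ?a * ?b) = cl G ?b"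
    using or
  proof
    assume *: "cl G (?a * ?b) = cl G (vtx (src G e))"
    have "cl G (?a * ?b * ?a) = cl G (vtx (src G e) * ?a)"
      by (intro cl_mult_right *) (use e in auto)
    moreover have "cl G (?b * (?a * ?b)) = cl G (?b * vtx (src G e))"
      by (intro cl_mult_left *) (use e in auto)
    ultimately show ?thesis by (simp add: mult.assoc cl_W2 e)
  next
    assume *: "cl G (?b * ?a) = cl G (vtx (rng G e))"
    have "cl G (?b * ?a * ?b) = cl G (vtx (rng G e) * ?b)"
      by (intro cl_mult_right *) (use e in auto)
    moreover have "cl G (?a * (?b * ?a)) = cl G (?a * vtx (rng G e))"
      by (intro cl_mult_left *) (use e in auto)
    ultimately show ?thesis by (simp add: mult.assoc cl_W2 e)
  qed
  thus ?thesis
    by (intro matrix_units_pair[OF wlpa_ring, of "cl G ?a" "cl G ?b" "cl G ?a" L])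
       (use e l edge_edge_zero[OF e] in \<open>simp_all add: wlpa_mult wlpa_zero\<close>)
qed

text \<open>Only the index 1 survives in (W4), because the higher ghosts of \<open>e\<close> are 0
  by convention.\<close>

lemma W4_weight_1:
  assumes "e \<in> sedges G" "f \<in> sedges G" "wt G e = 1"
  shows "cl G (rghost G e 1 * redge G f 1 :: ('v, 'e, 'k::field) free_elt) =
    cl G (if e = f then vtx (rng G e) else 0)"
proof -
  have "(\<Sum>i = 1..max (wt G e) (wt G f). rghost G e i * redge G f i :: ('v, 'e, 'k) free_elt) =
      (\<Sum>i\<in>{1}. rghost G e i * redge G f i)"
    using assms by (intro sum.mono_neutral_right) (auto simp: rghost_def)
  hence "cl G (rghost G e 1 * redge G f 1 :: ('v, 'e, 'k) free_elt) =
      cl G (\<Sum>i = 1..max (wt G e) (wt G f). rghost G e i * redge G f i)"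
    by simp
  also have "\<dots> = cl G (if e = f then vtx (rng G e) else 0)"
    by (rule cl_W4[OF assms(1,2)])
  finally show ?thesis .
qed

text \<open>Taking the top index on the left in (W3) kills all edges of smaller weight, so a single
  summand remains.\<close>

lemma W3_unique_max:
  assumes "e \<in> sedges G" "wt G e = vwt G (src G e)" "1 \<le> j" "j \<le> wt G e"
    and "\<And>f. f \<in> out_edges G (src G e) \<Longrightarrow> wt G f = vwt G (src G e) \<Longrightarrow> f = e"
  shows "cl G (redge G e (wt G e) * rghost G e j :: ('v, 'e, 'k::field) free_elt) =
    cl G (if j = wt G e then vtx (src G e) else 0)"
proof -
  let ?v = "src G e"
  have e: "e \<in> out_edges G ?v" "\<not> is_sink G ?v" using assms by (auto simp: out_edges_def is_sink_def)
  have "redge G f (wt G e) = (0 :: ('v, 'e, 'k) free_elt)" if "f \<in> out_edges G ?v - {e}" for f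
  proof -
    have "wt G f \<le> vwt G ?v" using e that unfolding vwt_def by (auto intro!: Max_ge)
    hence "wt G f < wt G e" using assms that by fastforce
    thus ?thesis by (simp add: redge_def)
  qed
  hence "(\<Sum>f\<in>out_edges G ?v. redge G f (wt G e) * rghost G f j :: ('v, 'e, 'k) free_elt) =
      (\<Sum>f\<in>{e}. redge G f (wt G e) * rghost G f j)"
    using e by (intro sum.mono_neutral_right) auto
  hence "cl G (redge G e (wt G e) * rghost G e j :: ('v, 'e, 'k) free_elt) =
      cl G (\<Sum>f\<in>out_edges G ?v. redge G f (wt G e) * rghost G f j)"
    by simp
  also have "\<dots> = cl G (if wt G e = j then vtx ?v else 0)"
    by (rule cl_W3) (use e assms in auto)
  finally show ?thesis by (simp add: eq_commute)
qed

end

context nf_rep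
begin

text \<open>\<open>alt e c\<close> describes the suffixes of \<open>\<dots>e\<^sub>1e\<^sub>2\<^sup>*e\<^sub>1\<close>. Adding up the coefficients of those
  of odd and of even length gives the two coordinates.\<close>

fun alt :: "'e \<Rightarrow> bool \<Rightarrow> ('v, 'e) gen list \<Rightarrow> bool" where
  "alt e c [] \<longleftrightarrow> \<not> c"
| "alt e c (Edge f i # w) \<longleftrightarrow> c \<and> f = e \<and> i = 1 \<and> alt e False w"
| "alt e c (Ghost f i # w) \<longleftrightarrow> \<not> c \<and> f = e \<and> i = 2 \<and> alt e True w"
| "alt e c (Vtx v # w) \<longleftrightarrow> False"

text \<open>A functional encoded as a linear extension whose target has a one-element index type, so
  that its linearity is that of \<open>lext\<close>.\<close>

definition altsum :: "'e \<Rightarrow> bool \<Rightarrow> (('v, 'e) gen list \<Rightarrow>\<^sub>0 'k) \<Rightarrow> 'k" where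
  "altsum e c v = Poly_Mapping.lookup (lext (\<lambda>w. Poly_Mapping.single () (of_bool (alt e c w))) v) ()"

lemma altsum_simps:
  "altsum e c (v + v') = altsum e c v + altsum e c v'" "altsum e c 0 = 0"
  "altsum e c (Poly_Mapping.single w k) = k * of_bool (alt e c w)"
  by (simp_all add: altsum_def lext_add lookup_add)

lemma alt_start: "alt e c w \<Longrightarrow> rng G e = z \<Longrightarrow> start w = (if c then src G e else z)"
  by (cases w; cases "hd w"; cases c) simp_all

text \<open>Since \<open>e\<close> is not chosen, \<open>e_1\<close> begins no bad pair; nor does
  \<open>e_2^*\<close>, as its index is not 1. Both therefore act on composable words by prepending
  a letter.\<close>

lemma altsum_act:
  assumes e: "e \<in> sedges G" "2 \<le> wt G e" "al (src G e) \<noteq> e" "rng G e = z"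
  shows "altsum e True (act (redge G e 1) v) = altsum e False v"
    "altsum e False (act (redge G e 1) v) = 0"
    "altsum e True (act (rghost G e 2) v) = 0"
    "altsum e False (act (rghost G e 2) v) = altsum e True v"
proof -
  have E: "actg (Edge e 1) w = (if start w = z then sing (Edge e 1 # w) else 0)" for w
    using e by (cases w; cases "hd w") simp_all
  have Gh: "actg (Ghost e 2) w = (if start w = src G e then sing (Ghost e 2 # w) else 0)" for w
    by (cases w; cases "hd w") simp_all
  have s: "act (redge G e 1) (Poly_Mapping.single w c) = pm_scale c (actg (Edge e 1) w)"
    "act (rghost G e 2) (Poly_Mapping.single w c) = pm_scale c (actg (Ghost e 2) w)" for w c
    using e by (simp_all add: redge_def rghost_def act_single)
  have st: "\<not> alt e False w" if "start w \<noteq> z" for w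
    using alt_start[of e False w] that e by auto
  have st': "\<not> alt e True w" if "start w \<noteq> src G e" for w
    using alt_start[of e True w] that e by auto
  show "altsum e True (act (redge G e 1) v) = altsum e False v"
  proof (induction v rule: pm_induct)
    case (single w c)
    show ?case using st[of w] by (cases "start w = z") (simp_all add: s E altsum_simps del: One_nat_def)
  qed (simp_all add: act_add altsum_simps)
  show "altsum e False (act (redge G e 1) v) = 0"
  proof (induction v rule: pm_induct)
    case (single w c)
    show ?case by (cases "start w = z") (simp_all add: s E altsum_simps del: One_nat_def)
  qed (simp_all add: act_add altsum_simps)
  show "altsum e True (act (rghost G e 2) v) = 0"
  proof (induction v rule: pm_induct)
    case (single w c)
    show ?case by (cases "start w = src G e") (simp_all add: s Gh altsum_simps)
  qed (simp_all add: act_add altsum_simps)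
  show "altsum e False (act (rghost G e 2) v) = altsum e True v"
  proof (induction v rule: pm_induct)
    case (single w c)
    show ?case using st'[of w] by (cases "start w = src G e") (simp_all add: s Gh altsum_simps)
  qed (simp_all add: act_add altsum_simps)
qed

end

context fin_wgraph
begin

text \<open>Alternating products of \<open>e_1\<close> and \<open>e_2^*\<close> give ever longer
  words. Summing coefficients over all alternating words of a given parity forgets the length, and
  on the two sums the generators act as matrix units. Choosing \<open>f\<close> at the source keeps
  \<open>e_1 e_2^*\<close> normal.\<close>

lemma nonloop_alternating_pair:
  assumes e: "e \<in> sedges G" "src G e \<noteq> rng G e" "2 \<le> wt G e"
    and f: "f \<in> out_edges G (src G e)" "f \<noteq> e" "wt G f = vwt G (src G e)"
  shows "has_matrix_pair (wlpa G :: ('k::field_char_0, ('v, 'e, 'k) free_elt set) module) TYPE('k)"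
proof -
  let ?a = "redge G e 1 :: ('v, 'e, 'k) free_elt" and ?b = "rghost G e 2 :: ('v, 'e, 'k) free_elt"
  obtain al where al0: "nf_rep G al" "al (src G e) = f"
    using nf_rep_exists[of "{src G e}" "\<lambda>_. f"] f by auto
  interpret nf_rep G al "rng G e" "TYPE('k)" by (rule al0)
  interpret A: ring "wlpa G :: ('k, ('v, 'e, 'k) free_elt set) module" by (rule wlpa_ring)
  have al': "al (src G e) \<noteq> e" using al0 f by simp
  note * = altsum_act[OF e(1,3) al' refl]
  have w: "1 \<le> wt G e" using e by simp
  have "matrix_pair (wlpa G) (cl G ?a) (cl G ?b) (\<lambda>x. altsum e True (val x (sing [])))
    (\<lambda>x. altsum e False (val x (sing []))) (cl G ?a) (cl G (vtx (rng G e))) 1"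
  proof unfold_locales
    fix x y :: "('v, 'e, 'k) free_elt set"
    assume xy: "x \<in> carrier (wlpa G)" "y \<in> carrier (wlpa G)"
    show "altsum e True (val (x \<oplus>\<^bsub>wlpa G\<^esub> y) (sing [])) = altsum e True (val x (sing [])) + altsum e True (val y (sing []))"
      using xy by (simp add: val_add altsum_simps)
    show "altsum e False (val (x \<oplus>\<^bsub>wlpa G\<^esub> y) (sing [])) = altsum e False (val x (sing [])) + altsum e False (val y (sing []))"
      using xy by (simp add: val_add altsum_simps)
  next
    fix x :: "('v, 'e, 'k) free_elt set"
    assume "x \<in> carrier (wlpa G)"
    then obtain p where p: "p \<in> carrier (free_alg G)" "x = cl G p" by (auto simp: wlpa_carrier)
    have v: "val (cl G ?a \<otimes>\<^bsub>wlpa G\<^esub> x) (sing []) = act ?a (act p (sing []))"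
      "val (cl G ?b \<otimes>\<^bsub>wlpa G\<^esub> x) (sing []) = act ?b (act p (sing []))"
      "val x (sing []) = act p (sing [])"
      using p e by (simp_all add: wlpa_mult val_cl act_mult)
    show "altsum e True (val (cl G ?a \<otimes>\<^bsub>wlpa G\<^esub> x) (sing [])) = altsum e False (val x (sing []))"
      "altsum e False (val (cl G ?a \<otimes>\<^bsub>wlpa G\<^esub> x) (sing [])) = 0"
      "altsum e True (val (cl G ?b \<otimes>\<^bsub>wlpa G\<^esub> x) (sing [])) = 0"
      "altsum e False (val (cl G ?b \<otimes>\<^bsub>wlpa G\<^esub> x) (sing [])) = altsum e True (val x (sing []))"
      unfolding v by (rule *)+
  next
    show "cl G ?a \<otimes>\<^bsub>wlpa G\<^esub> cl G ?a = \<zero>\<^bsub>wlpa G\<^esub>" "cl G ?b \<otimes>\<^bsub>wlpa G\<^esub> cl G ?b = \<zero>\<^bsub>wlpa G\<^esub>"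
      using e by (simp_all add: wlpa_mult wlpa_zero edge_edge_zero)
    show "altsum e True (val (cl G ?a) (sing [])) = 1" "altsum e False (val (cl G ?a) (sing [])) = 0"
      "altsum e True (val (cl G (vtx (rng G e))) (sing [])) = 0"
      "altsum e False (val (cl G (vtx (rng G e))) (sing [])) = 1"
      using w by (simp_all add: val_cl act_redge act_vtx altsum_simps)
  qed (use e in simp_all)
  thus ?thesis unfolding has_matrix_pair_def by blast
qed

text \<open>Weight 1 makes \<open>e_1^* e_1\<close> the range by (W4). If \<open>e\<close> alone has
  the maximal weight m, (W3) makes \<open>e_m e_m^*\<close> the source. Otherwise another edge of
  maximal weight can be chosen at the source.\<close>

lemma nonloop_has_pair:
  assumes e: "e \<in> sedges G" "src G e \<noteq> rng G e"
  shows "has_matrix_pair (wlpa G :: ('k::field_char_0, ('v, 'e, 'k) free_elt set) module) TYPE('k)"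
proof -
  have eo: "e \<in> out_edges G (src G e)" "\<not> is_sink G (src G e)"
    using e by (auto simp: out_edges_def is_sink_def)
  consider "wt G e = 1"
    | f where "2 \<le> wt G e" "f \<in> out_edges G (src G e)" "f \<noteq> e" "wt G f = vwt G (src G e)"
    | "2 \<le> wt G e" "\<And>f. f \<in> out_edges G (src G e) \<Longrightarrow> wt G f = vwt G (src G e) \<Longrightarrow> f = e"
    using wt_pos[OF e(1)] by fastforce
  thus ?thesis
  proof cases
    case 1
    thus ?thesis using W4_weight_1[OF e(1) e(1) 1, where 'k = 'k]
      by (intro nonloop_pair[OF e, of 1]) simp_all
  next
    case 2
    thus ?thesis by (intro nonloop_alternating_pair[OF e])
  next
    case 3
    have "wt G e = vwt G (src G e)" using ex_max_edge[OF eo(2)] 3(2) by blast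
    note m = this
    have "cl G (redge G e (wt G e) * rghost G e (wt G e) :: ('v, 'e, 'k) free_elt) =
        cl G (if wt G e = wt G e then vtx (src G e) else 0)"
      by (rule W3_unique_max[OF e(1) m]) (use 3 in simp_all)
    thus ?thesis using 3(1) by (intro nonloop_pair[OF e, of "wt G e"]) simp_all
  qed
qed

section \<open>Matrix pairs in graphs with one vertex\<close>

lemma one_vertex_one: "verts G = {v} \<Longrightarrow> \<one>\<^bsub>wlpa G\<^esub> = cl G (vtx v)"
  by (simp add: wlpa_one)

text \<open>(W4) gives \<open>e_1^* e_1 = 1\<close> and \<open>e_1^* f_1 = 0\<close>, so
  \<open>e_1^*\<close> has a right inverse but kills the nonzero element \<open>f_1\<close>.\<close>

lemma one_vertex_weight_1_pair:
  assumes v: "verts G = {v}" and ef: "e \<in> sedges G" "f \<in> sedges G" "e \<noteq> f" "wt G e = 1"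
  shows "has_matrix_pair (wlpa G :: ('k::field_char_0, ('v, 'e, 'k) free_elt set) module) TYPE('k)"
proof -
  obtain L where l: "additive_on (wlpa G) L" "L (cl G (redge G f 1 :: ('v, 'e, 'k) free_elt)) = (1 :: 'k)"
    using generator_functional(1)[OF ef(2), of 1] wt_pos[OF ef(2)] by auto
  have "rng G e = v" using rng_in[OF ef(1)] v by simp
  thus ?thesis
    by (intro one_sided_inverse_pair[OF wlpa_ring, of "cl G (rghost G e 1)" "cl G (redge G e 1)"
          "cl G (redge G f 1)" L])
       (use ef l in \<open>simp_all add: wlpa_mult wlpa_zero W4_weight_1 one_vertex_one[OF v] del: One_nat_def\<close>)
qed

text \<open>With m the weight of \<open>e\<close>, (W3) gives \<open>e_m e_m^* = 1\<close> and
  \<open>e_m e_1^* = 0\<close>; the two indices differ because m is at least 2.\<close>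

lemma one_vertex_unique_max_pair:
  assumes v: "verts G = {v}" and e: "e \<in> sedges G" "wt G e = vwt G v" "2 \<le> wt G e"
    and u: "\<And>f. f \<in> out_edges G v \<Longrightarrow> wt G f = vwt G v \<Longrightarrow> f = e"
  shows "has_matrix_pair (wlpa G :: ('k::field_char_0, ('v, 'e, 'k) free_elt set) module) TYPE('k)"
proof -
  obtain L where l: "additive_on (wlpa G) L" "L (cl G (rghost G e 1 :: ('v, 'e, 'k) free_elt)) = (1 :: 'k)"
    using generator_functional(2)[OF e(1), of 1] e by auto
  have s: "src G e = v" using src_in[OF e(1)] v by simp
  have W3: "cl G (redge G e (wt G e) * rghost G e j :: ('v, 'e, 'k) free_elt) =
      cl G (if j = wt G e then vtx (src G e) else 0)" if "1 \<le> j" "j \<le> wt G e" for j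
    by (rule W3_unique_max[OF e(1) _ that]) (use e(2) u s in simp_all)
  have "cl G (redge G e (wt G e) * rghost G e (wt G e) :: ('v, 'e, 'k) free_elt) = cl G (vtx v)"
    "cl G (redge G e (wt G e) * rghost G e 1 :: ('v, 'e, 'k) free_elt) = cl G 0"
    using W3[of "wt G e"] W3[of 1] e(3) s by simp_all
  note W3 = this
  show ?thesis
    by (intro one_sided_inverse_pair[OF wlpa_ring, of "cl G (redge G e (wt G e))" "cl G (rghost G e (wt G e))"
          "cl G (rghost G e 1)" L])
       (use e(1) l in \<open>simp_all add: wlpa_mult wlpa_zero W3 one_vertex_one[OF v] del: One_nat_def\<close>)
qed

text \<open>If every edge is a loop, connectedness leaves one vertex. The failure of the three
  alternatives then means an edge of weight 1 beside another edge, or no weight 1 and a single edge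
  of maximal weight.\<close>

theorem not_cond3_has_pair:
  assumes conn: "connected_wgraph G"
    and n3: "\<not> (\<exists>v. verts G = {v} \<and> sedges G = {})"
      "\<not> (\<exists>v e. verts G = {v} \<and> sedges G = {e} \<and> wt G e = 1)" "\<not> LV_rose G"
  shows "has_matrix_pair (wlpa G :: ('k::field_char_0, ('v, 'e, 'k) free_elt set) module) TYPE('k)"
proof (cases "\<exists>e\<in>sedges G. src G e \<noteq> rng G e")
  case True
  thus ?thesis using nonloop_has_pair by blast
next
  case False
  let ?R = "\<Union>e\<in>sedges G. {(src G e, rng G e), (rng G e, src G e)}"
  have "?R \<subseteq> Id" using False by auto
  hence Id: "?R\<^sup>* \<subseteq> Id" using rtrancl_mono[of ?R Id] by simp
  obtain v where "v \<in> verts G" using conn by (auto simp: connected_wgraph_def)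
  hence v: "verts G = {v}" using conn Id unfolding connected_wgraph_def by blast
  have out: "out_edges G v = sedges G" using src_in v by (auto simp: out_edges_def)
  have ne: "sedges G \<noteq> {}" using n3(1) v by blast
  show ?thesis
  proof (cases "\<exists>e\<in>sedges G. wt G e = 1")
    case True
    then obtain e where e: "e \<in> sedges G" "wt G e = 1" by blast
    hence "sedges G \<noteq> {e}" using n3(2) v by blast
    then obtain f where "f \<in> sedges G" "e \<noteq> f" using ne e by blast
    thus ?thesis using one_vertex_weight_1_pair[OF v] e by blast
  next
    case no1: False
    hence w2: "2 \<le> wt G e" if "e \<in> sedges G" for e
      using wt_pos[OF that] that by (cases "wt G e = 1") auto
    let ?M = "{e \<in> out_edges G v. wt G e = vwt G v}"
    have "\<not> 2 \<le> card ?M"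
      using n3(3) w2 wgraph conn ne v by (auto simp: LV_rose_def LV_graph_def)
    have sink: "\<not> is_sink G v" using ne out by (simp add: is_sink_def)
    obtain e where e: "e \<in> out_edges G v" "wt G e = vwt G v" using ex_max_edge[OF sink] by blast
    have u: "f = e" if "f \<in> out_edges G v" "wt G f = vwt G v" for f
    proof (rule ccontr)
      assume "f \<noteq> e"
      hence "card {e, f} = 2" by auto
      moreover have "card {e, f} \<le> card ?M" using e that by (intro card_mono) auto
      ultimately show False using \<open>\<not> 2 \<le> card ?M\<close> by simp
    qed
    show ?thesis using one_vertex_unique_max_pair[OF v _ e(2) _ u] e w2 out by blast
  qed
qed

end

section \<open>Graphs with one vertex\<close>

locale one_vertex_rep = nf_rep G al z K
  for G :: "('v, 'e) wgraph" and al z and K :: "'k::field itself" +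
  assumes verts: "verts G = {z}"
begin

lemma src_z [simp]: "e \<in> sedges G \<Longrightarrow> src G e = z" and rng_z [simp]: "e \<in> sedges G \<Longrightarrow> rng G e = z"
  using src_in[of e] rng_in[of e] verts by simp_all

lemma out_edges_z: "out_edges G z = sedges G"
  by (auto simp: out_edges_def)

lemma gens_z [simp]: "x \<in> gens G \<Longrightarrow> gsrc x = z" "x \<in> gens G \<Longrightarrow> grng x = z"
  using gen_unit(1,2)[of x] verts by simp_all

lemma letter_z [simp]: "letter x \<Longrightarrow> gsrc x = z" "letter x \<Longrightarrow> grng x = z"
  by (simp_all add: letter_def)

lemma start_z: "nod w \<Longrightarrow> start w = z"
  by (cases w) simp_all

text \<open>The free algebra contains no empty word, so the normal word \<open>[]\<close> is
  realised by the vertex.\<close>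

definition emb :: "('v, 'e) gen list \<Rightarrow> ('v, 'e, 'k) free_elt" where
  "emb w = (if w = [] then vtx z else sing w)"

lemma nod_gens: "nod w \<Longrightarrow> set w \<subseteq> gens G"
  using nod_letter[of w] by (auto simp: letter_def)

lemma emb_in: "nod w \<Longrightarrow> emb w \<in> carrier (free_alg G)"
  using nod_gens[of w] verts by (simp add: emb_def)

lemma cl_vtx_mult:
  assumes "p \<in> carrier (free_alg G)"
  shows "cl G (vtx z * p) = cl G p" "cl G (p * vtx z) = cl G p"
  using cl_one_mult[OF assms] verts by simp_all

lemma cl_single_emb:
  assumes "set u \<subseteq> gens G" "u \<noteq> []"
  shows "cl G (sing u * emb w) = cl G (sing (u @ w) :: ('v, 'e, 'k) free_elt)"
proof (cases "w = []")
  case True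
  thus ?thesis using cl_vtx_mult(2)[of "sing u"] assms by (simp add: emb_def)
next
  case False
  thus ?thesis by (simp add: emb_def mult_single list_plus_eq)
qed

lemma cl_addD: "cl G (p + q) = cl G r \<Longrightarrow> cl G p = cl G (r - q)"
  by (simp add: cl_eq_iff algebra_simps)

text \<open>This is (W3) or (W4) solved for its leading word. The chosen edge has maximal weight, so
  its indices lie in the range where (W3) applies.\<close>

lemma cl_bad:
  assumes xy: "letter x" "letter y" "bad x y"
  shows "cl G (sing [x, y]) =
    cl G ((if delta x y then vtx z else 0) - (\<Sum>(x', y')\<in>alts x y. sing [x', y']) :: ('v, 'e, 'k) free_elt)"
  using xy(1)
proof (cases rule: letter_cases)
  case (Edge e i)
  then obtain j where y: "y = Ghost e j" and al_e: "al z = e" using xy by (cases y) auto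
  have j: "1 \<le> j" "j \<le> wt G e" using xy(2) y by auto
  have sink: "\<not> is_sink G z" using Edge by (auto simp: is_sink_def out_edges_z)
  have w: "wt G e = vwt G z" using al[of z] sink verts al_e by auto
  let ?f = "\<lambda>g. redge G g i * rghost G g j :: ('v, 'e, 'k) free_elt"
  have f: "?f g = (if i \<le> wt G g \<and> j \<le> wt G g then sing [Edge g i, Ghost g j] else 0)" for g
    using Edge j by (simp add: redge_def rghost_def mult_single list_plus_eq)
  have "cl G (\<Sum>g\<in>out_edges G z. ?f g) = cl G (if i = j then vtx z else 0)"
    using Edge j w sink verts by (intro cl_W3) auto
  also have "(\<Sum>g\<in>out_edges G z. ?f g) = ?f e + (\<Sum>g\<in>out_edges G z - {e}. ?f g)"
    using Edge by (intro sum.remove) (simp_all add: out_edges_z)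
  also have "?f e = sing [x, y]"
    using Edge j y by (simp add: f)
  also have "(\<Sum>g\<in>out_edges G z - {e}. ?f g) = (\<Sum>(x', y')\<in>alts x y. sing [x', y'])"
  proof -
    let ?T = "{g \<in> out_edges G z - {e}. i \<le> wt G g \<and> j \<le> wt G g}"
    have "alts x y = (\<lambda>g. (Edge g i, Ghost g j)) ` ?T" using Edge by (simp add: y)
    hence "(\<Sum>(x', y')\<in>alts x y. sing [x', y'] :: ('v, 'e, 'k) free_elt) = (\<Sum>g\<in>?T. sing [Edge g i, Ghost g j])"
      by (simp add: sum.reindex inj_on_def)
    also have "\<dots> = (\<Sum>g\<in>out_edges G z - {e}. ?f g)"
      unfolding f by (intro sum.mono_neutral_cong_left) auto
    finally show ?thesis by (rule sym)
  qed
  finally have s: "cl G (sing [x, y] + (\<Sum>(x', y')\<in>alts x y. sing [x', y']) :: ('v, 'e, 'k) free_elt) = cl G (if i = j then vtx z else 0)" .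
  have d: "delta x y \<longleftrightarrow> i = j" by (simp add: Edge y)
  show ?thesis unfolding d by (rule cl_addD[OF s])
next
  case (Ghost e i)
  then obtain f where y: "y = Edge f 1" and i: "i = 1" using xy by (cases y) auto
  have fe: "f \<in> sedges G" "1 \<le> wt G f" "1 \<le> wt G e" using xy(2) y Ghost by auto
  let ?m = "min (wt G e) (wt G f)"
  let ?f = "\<lambda>k. rghost G e k * redge G f k :: ('v, 'e, 'k) free_elt"
  have f: "?f k = (if 1 \<le> k \<and> k \<le> ?m then sing [Ghost e k, Edge f k] else 0)" for k
    by (simp add: redge_def rghost_def mult_single list_plus_eq)
  have "cl G (\<Sum>k = 1..max (wt G e) (wt G f). ?f k) = cl G (if e = f then vtx (rng G e) else 0)"
    using Ghost fe by (intro cl_W4)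
  also have "(\<Sum>k = 1..max (wt G e) (wt G f). ?f k) = (\<Sum>k = 1..?m. sing [Ghost e k, Edge f k])"
    unfolding f by (intro sum.mono_neutral_cong_right) auto
  also have "\<dots> = sing [x, y] + (\<Sum>k = 2..?m. sing [Ghost e k, Edge f k])"
    using fe by (simp add: sum.atLeast_Suc_atMost numeral_2_eq_2 y i Ghost)
  also have "(\<Sum>k = 2..?m. sing [Ghost e k, Edge f k]) = (\<Sum>(x', y')\<in>alts x y. sing [x', y'])"
    by (simp add: Ghost y sum.reindex inj_on_def)
  finally have s: "cl G (sing [x, y] + (\<Sum>(x', y')\<in>alts x y. sing [x', y']) :: ('v, 'e, 'k) free_elt) = cl G (if e = f then vtx (rng G e) else 0)" .
  have d: "delta x y \<longleftrightarrow> e = f" "z = rng G e" using Ghost(2) by (simp_all add: Ghost(1) y)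
  show ?thesis unfolding d(1) by (subst d(2)) (rule cl_addD[OF s])
qed

text \<open>The rewriting step in \<open>actg\<close> is an identity of the algebra. Hence the
  action is left multiplication in the algebra, seen on combinations of normal words.\<close>

lemma cl_generator_emb:
  assumes x: "x \<in> gens G" and w: "nod w"
  shows "cl G (sing [x] * emb w) = cl G (lext emb (actg x w))"
proof (cases "letter x")
  case False
  hence "x = Vtx z" using x verts by (auto simp: letter_def gens_def)
  moreover have "start w = z" by (rule start_z[OF w])
  ultimately show ?thesis
    using cl_vtx_mult(1)[OF emb_in[OF w]] by (simp flip: vtx_def)
next
  case lx: True
  have st: "start w = z" by (rule start_z[OF w])
  show ?thesis
  proof (cases "w \<noteq> [] \<and> bad x (hd w)")
    case False
    hence "actg x w = sing (x # w)" using lx st by (intro actg_good) auto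
    thus ?thesis using cl_single_emb[of "[x]" w] x by (simp add: emb_def)
  next
    case True
    then obtain y w' where ww: "w = y # w'" and bd: "bad x y" by (cases w) auto
    have y: "letter y" "nod w'" using w ww by simp_all
    have gy: "y \<in> gens G" using y by (simp add: letter_def)
    have ew: "emb w' \<in> carrier (free_alg G)" by (rule emb_in[OF y(2)])
    have g: "x' \<in> gens G \<and> y' \<in> gens G" if "(x', y') \<in> alts x y" for x' y'
      using alts_props(1,2)[OF that lx y(1) bd] lx y by (simp add: letter_def)
    let ?S = "\<Sum>(x', y')\<in>alts x y. sing [x', y'] :: ('v, 'e, 'k) free_elt"
    have S: "?S \<in> carrier (free_alg G)"
      using g by (intro free_alg_sum) auto
    have "cl G (sing [x] * emb w) = cl G (sing ([x, y] @ w'))"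
      using ww by (simp add: emb_def mult_single list_plus_eq)
    also have "\<dots> = cl G (sing [x, y] * emb w')"
      using x gy by (intro cl_single_emb[symmetric]) auto
    also have "\<dots> = cl G (((if delta x y then vtx z else 0) - ?S) * emb w')"
      by (intro cl_mult_right cl_bad lx y bd ew)
    also have "\<dots> = cl G ((if delta x y then vtx z else 0) * emb w' - ?S * emb w')"
      by (simp add: left_diff_distrib)
    also have "\<dots> = cl G ((if delta x y then emb w' else 0) - (\<Sum>(x', y')\<in>alts x y. sing ([x', y'] @ w')))"
    proof (rule cl_diff_cong)
      show "cl G ((if delta x y then vtx z else 0) * emb w') = cl G (if delta x y then emb w' else 0)"
        using cl_vtx_mult(1)[OF ew] by simp
      have "cl G (?S * emb w') = cl G (\<Sum>t\<in>alts x y. (case t of (x', y') \<Rightarrow> sing [x', y']) * emb w')"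
        by (simp add: sum_distrib_right)
      also have "\<dots> = cl G (\<Sum>t\<in>alts x y. case t of (x', y') \<Rightarrow> sing ([x', y'] @ w'))"
      proof (rule cl_sum_cong)
        fix t assume t: "t \<in> alts x y"
        obtain x' y' where t': "t = (x', y')" by force
        have "set [x', y'] \<subseteq> gens G" using g t t' by simp
        from cl_single_emb[OF this, of w'] show
          "cl G ((case t of (x', y') \<Rightarrow> sing [x', y']) * emb w') =
            cl G (case t of (x', y') \<Rightarrow> sing ([x', y'] @ w'))"
          by (simp add: t')
      qed
      finally show "cl G (?S * emb w') = cl G (\<Sum>(x', y')\<in>alts x y. sing ([x', y'] @ w'))" .
    qed
    also have "(if delta x y then emb w' else 0) - (\<Sum>(x', y')\<in>alts x y. sing ([x', y'] @ w')) =
        lext emb (actg x w)"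
    proof -
      have "lext emb (actg x w) = lext emb (if delta x y then sing w' else 0) -
          (\<Sum>t\<in>alts x y. lext emb (case t of (x', y') \<Rightarrow> sing (x' # y' # w')))"
        using lx y(1) by (simp add: ww actg_bad[OF bd] lext_diff lext_sum)
      also have "(\<Sum>t\<in>alts x y. lext emb (case t of (x', y') \<Rightarrow> sing (x' # y' # w'))) =
          (\<Sum>(x', y')\<in>alts x y. sing ([x', y'] @ w'))"
        by (intro sum.cong) (auto simp: emb_def)
      finally show ?thesis by simp
    qed
    finally show ?thesis .
  qed
qed

text \<open>At the empty word this says that normal words span: the class of \<open>p\<close> is
  that of the combination \<open>act p (sing [])\<close>.\<close>

lemma cl_eq_lext:
  assumes "p \<in> carrier (free_alg G)" "v \<in> V"
  shows "cl G (p * lext emb v) = cl G (lext emb (act p v))"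
proof -
  have gen: "cl G (sing [x] * lext emb v) = cl G (lext emb (lext (actg x) v))"
    if x: "x \<in> gens G" and v: "v \<in> V" for x v
  proof (induction v rule: pm_induct)
    case (single w c)
    hence "nod w" using v V_nod by blast
    from cl_scale_cong[OF cl_generator_emb[OF x this], of c] show ?case
      by (simp add: pm_scale_mult_right lext_scale)
  next
    case (add p q)
    thus ?case unfolding lext_add distrib_left by (rule cl_add_cong)
  qed simp
  have word: "cl G (sing w * lext emb v) = cl G (lext emb (actw w v))"
    if "set w \<subseteq> gens G" "w \<noteq> []" for w
    using that
  proof (induction w)
    case (Cons x w)
    show ?case
    proof (cases "w = []")
      case True
      thus ?thesis using gen[of x v] Cons.prems assms(2) by simp
    next
      case False
      have "sing (x # w) * lext emb v = sing [x] * (sing w * lext emb v)"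
        by (simp add: mult_single list_plus_eq flip: mult.assoc)
      hence "cl G (sing (x # w) * lext emb v) = cl G (sing [x] * lext emb (actw w v))"
        using Cons False cl_mult_left[of "sing [x]" "sing w * lext emb v" "lext emb (actw w v)"] by simp
      also have "\<dots> = cl G (lext emb (lext (actg x) (actw w v)))"
        using Cons.prems assms(2) by (intro gen V_actw) auto
      finally show ?thesis by simp
    qed
  qed simp
  show ?thesis
  proof (induction p rule: pm_induct)
    case (single w c)
    hence "set w \<subseteq> gens G" "w \<noteq> []" using assms(1) by (auto simp: carrier_free_alg)
    from cl_scale_cong[OF word[OF this], of c] show ?case
      by (simp add: pm_scale_mult_left[symmetric] act_single lext_scale)
  next
    case (add p q)
    thus ?case unfolding lext_add act_add_left distrib_right by (rule cl_add_cong)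
  qed simp
qed

text \<open>Coordinates in the basis of normal words: with one vertex the empty word stands for the
  identity, so applying an element to it recovers the element.\<close>

definition nf :: "('v, 'e, 'k) free_elt set \<Rightarrow> (('v, 'e) gen list \<Rightarrow>\<^sub>0 'k)" where
  "nf x = val x (sing [])"

lemma nf_cl: "nf (cl G p) = act p (sing [])"
  by (simp add: nf_def val_cl)

lemma cl_nf: "x \<in> carrier (wlpa G) \<Longrightarrow> cl G (lext emb (nf x)) = x"
proof -
  assume "x \<in> carrier (wlpa G)"
  then obtain p where p: "p \<in> carrier (free_alg G)" "x = cl G p" by (auto simp: wlpa_carrier)
  have "cl G (lext emb (act p (sing []))) = cl G (p * lext emb (sing []))"
    by (rule cl_eq_lext[symmetric]) (use p in simp_all)
  also have "\<dots> = cl G p" using cl_vtx_mult(2)[OF p(1)] by (simp add: emb_def)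
  finally show ?thesis by (simp add: p nf_cl)
qed

lemma nf_V: "x \<in> carrier (wlpa G) \<Longrightarrow> nf x \<in> V"
  unfolding wlpa_carrier by (elim imageE) (simp add: nf_cl V_act)

lemma nf_zero_iff: "x \<in> carrier (wlpa G) \<Longrightarrow> nf x = 0 \<longleftrightarrow> x = \<zero>\<^bsub>wlpa G\<^esub>"
  using cl_nf[of x] by (metis wlpa_zero nf_cl act_0_left lext_0)

lemma nf_one: "nf \<one>\<^bsub>wlpa G\<^esub> = sing []"
  using verts by (simp add: wlpa_one nf_cl act_vtx)

text \<open>The normal word \<open>[]\<close> acts as the identity, and so does its realisation
  \<open>vtx z\<close> on \<open>V\<close>. Thus normal forms can act without being converted into
  elements of the free algebra.\<close>

lemma act_lext_emb: 
  assumes "v \<in> V"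
  shows "act (lext emb u) v = act u v"
proof (induction u rule: pm_induct)
  case (single w c)
  have "act (vtx z) v = v" using V_nod[OF assms] start_z by (intro act_vtx_lext) simp
  thus ?case by (simp add: act_scale_left act_single emb_def)
qed (simp_all add: lext_add act_add_left)

lemma nf_mult:
  assumes "x \<in> carrier (wlpa G)" "y \<in> carrier (wlpa G)"
  shows "nf (x \<otimes>\<^bsub>wlpa G\<^esub> y) = act (nf x) (nf y)"
proof -
  have "nf (x \<otimes>\<^bsub>wlpa G\<^esub> y) = val x (nf y)"
    using assms by (simp add: nf_def val_mult)
  also have "\<dots> = val (cl G (lext emb (nf x))) (nf y)"
    by (simp add: cl_nf assms)
  also have "\<dots> = act (nf x) (nf y)"
    using nf_V[OF assms(2)] by (simp add: val_cl act_lext_emb)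
  finally show ?thesis .
qed

lemma nf_scalar: "nf (k \<odot>\<^bsub>wlpa G\<^esub> wlpa_vtx G z) = Poly_Mapping.single [] k"
  by (simp add: wlpa_vtx_def cl_def[symmetric] wlpa_smult nf_cl act_scale_left act_vtx)

lemma scalar_of_nf:
  assumes "x \<in> carrier (wlpa G)" "nf x = Poly_Mapping.single [] k"
  shows "x = k \<odot>\<^bsub>wlpa G\<^esub> wlpa_vtx G z"
  using cl_nf[OF assms(1)] assms(2)
  by (simp add: wlpa_vtx_def cl_def[symmetric] wlpa_smult emb_def)

lemma scalar_in: "k \<odot>\<^bsub>wlpa G\<^esub> wlpa_vtx G z \<in> carrier (wlpa G)"
  using verts by (simp add: wlpa_vtx_def cl_def[symmetric] wlpa_smult)

lemma scalar_mult:
  "(k \<odot>\<^bsub>wlpa G\<^esub> wlpa_vtx G z) \<otimes>\<^bsub>wlpa G\<^esub> (l \<odot>\<^bsub>wlpa G\<^esub> wlpa_vtx G z) =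
    (k * l) \<odot>\<^bsub>wlpa G\<^esub> (wlpa_vtx G z :: ('v, 'e, 'k) free_elt set)"
proof -
  interpret A: ring "wlpa G :: ('k, ('v, 'e, 'k) free_elt set) module" by (rule wlpa_ring)
  have "nf ((k \<odot>\<^bsub>wlpa G\<^esub> wlpa_vtx G z) \<otimes>\<^bsub>wlpa G\<^esub> (l \<odot>\<^bsub>wlpa G\<^esub> wlpa_vtx G z)) =
    Poly_Mapping.single [] (k * l)"
    by (simp add: nf_mult scalar_in nf_scalar act_single)
  thus ?thesis by (intro scalar_of_nf) (simp_all add: scalar_in)
qed

end

section \<open>Degrees of products\<close>

context one_vertex_rep
begin

text \<open>With one vertex, normality constrains only adjacent letters, so normal words glue along
  a common letter.\<close>

lemma nod_append_iff: "nod (P @ x # q) \<longleftrightarrow> nod (P @ [x]) \<and> nod (x # q)" if "letter x"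
proof (induction P)
  case Nil
  thus ?case using that by auto
next
  case (Cons y P)
  have "start (P @ x # q) = start (P @ [x])" "hd (P @ x # q) = hd (P @ [x])"
    by (cases P; simp)+
  thus ?case using Cons by auto
qed

lemma nod_replace_last:
  assumes "nod (P @ [x])" "letter x'" "\<And>u. bad u x' \<Longrightarrow> bad u x"
  shows "nod (P @ [x'])"
  using assms(1)
proof (induction P)
  case (Cons y P)
  thus ?case using assms(2,3) start_z[of "P @ [x']"] by (cases P) auto
qed (use assms in auto)

lemma nod_butlast: "nod (P @ [x]) \<Longrightarrow> nod P"
proof (induction P)
  case (Cons y P)
  have "start (P @ [x]) = start P" "hd (P @ [x]) = hd P" if "P \<noteq> []"
    using that by (cases P; simp)+
  thus ?case using Cons by (cases "P = []") auto
qed simp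

lemma actw_sing_nod: "nod (p @ w) \<Longrightarrow> actw p (sing w) = sing (p @ w)"
proof (induction p)
  case (Cons x p)
  hence "actg x (p @ w) = sing (x # p @ w)" by (intro actg_good) auto
  thus ?case using Cons by simp
qed simp

lemma actw_length:
  assumes "set p \<subseteq> gens G" "v \<in> V" "\<And>w. w \<in> Poly_Mapping.keys v \<Longrightarrow> length w \<le> n"
    "w \<in> Poly_Mapping.keys (actw p v)"
  shows "length w \<le> length p + n"
  using assms(1,4)
proof (induction p arbitrary: w)
  case (Cons x p)
  obtain w' where w': "w' \<in> Poly_Mapping.keys (actw p v)" "w \<in> Poly_Mapping.keys (actg x w')"
    using keys_lext[of "actg x" "actw p v"] Cons.prems(2) by auto
  have "nod w'" using V_actw[of p v] Cons.prems assms(2) V_nod w'(1) by auto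
  hence "length w \<le> length w' + 1" using actg_nod[of w' x w] Cons.prems w'(2) by auto
  thus ?case using Cons.IH[OF _ w'(1)] Cons.prems by auto
qed (use assms(3) in auto)

lemma actw_length_sing:
  assumes "nod p" "nod q" "length p + length q < length w"
  shows "Poly_Mapping.lookup (actw p (sing q)) w = 0"
proof (rule ccontr)
  assume "\<not> ?thesis"
  hence "w \<in> Poly_Mapping.keys (actw p (sing q))" by (simp add: in_keys_iff)
  from actw_length[OF nod_gens[OF assms(1)] _ _ this, of "length q"] show False
    using assms by simp
qed

text \<open>The words of length \<open>length p + length q\<close> that occur in the product of the normal words
  \<open>p\<close> and \<open>q\<close>: a single rewriting step at the junction already yields normal words.\<close>

definition tops :: "('v, 'e) gen list \<Rightarrow> ('v, 'e) gen list \<Rightarrow> ('v, 'e) gen list set" where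
  "tops p q = (if bad (last p) (hd q)
     then (\<lambda>(x', y'). butlast p @ x' # y' # tl q) ` alts (last p) (hd q) else {p @ q})"

text \<open>Besides the replacement words, the rewriting step produces only the delta term, which is
  too short to contribute at \<open>W\<close>. The replacement words are distinct, and each has
  coefficient -1.\<close>

lemma actw_tops:
  assumes p: "nod p" "p \<noteq> []" and q: "nod q" "q \<noteq> []" and W: "length W = length p + length q"
  shows "Poly_Mapping.lookup (actw p (sing q)) W \<noteq> 0 \<longleftrightarrow> W \<in> tops p q"
proof -
  obtain P x where pP: "p = P @ [x]" using p(2) by (cases p rule: rev_cases) auto
  obtain y Q where qQ: "q = y # Q" using q(2) by (cases q) auto
  have x: "letter x" "letter y" "nod Q" using p q nod_letter[of p x] pP qQ by auto
  have aw: "actw p (sing q) = actw P (actg x q)" by (simp add: pP actw_append)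
  show ?thesis
  proof (cases "bad x y")
    case False
    have "nod (x # q)" using x q False by (simp add: qQ)
    hence "nod (p @ q)" using p(1) nod_append_iff[OF x(1), of P q] by (simp add: pP)
    hence "actw p (sing q) = sing (p @ q)" by (rule actw_sing_nod)
    thus ?thesis using False by (auto simp: tops_def pP qQ lookup_single when_def)
  next
    case bd: True
    have t: "actw P (sing (x' # y' # Q)) = sing (P @ x' # y' # Q)" if "(x', y') \<in> alts x y" for x' y'
    proof (rule actw_sing_nod)
      note * = alts_props[OF that x(1,2) bd]
      have *: "letter x'" "letter y'" "\<not> bad x' y'" "\<And>u. bad u x' \<Longrightarrow> bad u x" "\<And>u. bad y' u \<Longrightarrow> bad y u"
        using alts_props[OF that x(1,2) bd] x by auto
      have "nod (P @ [x'])" using nod_replace_last[of P x x'] p(1) * by (simp add: pP)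
      moreover have "nod (x' # y' # Q)" using * q(1) start_z[of Q] by (auto simp: qQ)
      ultimately show "nod (P @ x' # y' # Q)" using nod_append_iff[OF *(1)] by blast
    qed
    have P: "nod P" using p(1) unfolding pP by (rule nod_butlast)
    have d: "Poly_Mapping.lookup (actw P (if delta x y then sing Q else 0)) W = 0"
      using actw_length_sing[OF P x(3), of W] W by (simp add: pP qQ)
    have "actw P (actg x q) = actw P (if delta x y then sing Q else 0) -
        (\<Sum>t\<in>alts x y. actw P (case t of (x', y') \<Rightarrow> sing (x' # y' # Q)))"
    proof -
      have l: "actw P (u - u') = actw P u - actw P u'" for u u'
        using actw_add[of P "u - u'" u'] by simp
      have s: "actw P (sum f A) = (\<Sum>t\<in>A. actw P (f t))" for f and A :: "(('v, 'e) gen \<times> ('v, 'e) gen) set"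
        by (induction A rule: infinite_finite_induct) (simp_all add: actw_add)
      show ?thesis using x by (simp add: qQ actg_bad[OF bd] l s)
    qed
    also have "(\<Sum>t\<in>alts x y. actw P (case t of (x', y') \<Rightarrow> sing (x' # y' # Q))) =
        (\<Sum>(x', y')\<in>alts x y. sing (P @ x' # y' # Q))"
      using t by (intro sum.cong) auto
    finally have "Poly_Mapping.lookup (actw p (sing q)) W =
        - Poly_Mapping.lookup (\<Sum>(x', y')\<in>alts x y. sing (P @ x' # y' # Q)) W"
      by (simp only: aw lookup_minus d) simp
    also have "Poly_Mapping.lookup (\<Sum>(x', y')\<in>alts x y. sing (P @ x' # y' # Q) :: _ \<Rightarrow>\<^sub>0 'k) W =
        (\<Sum>t\<in>alts x y. if W = (\<lambda>(x', y'). P @ x' # y' # Q) t then 1 else 0)"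
      unfolding lookup_sum by (intro sum.cong) (auto simp: lookup_single when_def)
    also have "\<dots> = (\<Sum>u\<in>(\<lambda>(x', y'). P @ x' # y' # Q) ` alts x y. if W = u then 1 else 0)"
      by (subst sum.reindex) (auto simp: inj_on_def)
    also have "\<dots> = of_bool (W \<in> tops p q)"
      using bd by (simp add: tops_def pP qQ)
    finally show ?thesis by simp
  qed
qed

section \<open>Coefficients of products and top words reached from a single pair of factors\<close>

lemma actw_lext: "actw p v = lext (\<lambda>q. actw p (sing q)) v"
proof (induction v rule: pm_induct)
  case (single w c)
  have "Poly_Mapping.single w c = pm_scale c (sing w)" by simp
  thus ?case by (simp only: actw_scale lext_scale lext_single) simp
qed (simp_all add: actw_add lext_add)

lemma lookup_act:
  "Poly_Mapping.lookup (act a b) W = (\<Sum>p\<in>Poly_Mapping.keys a. \<Sum>q\<in>Poly_Mapping.keys b.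
     Poly_Mapping.lookup a p * (Poly_Mapping.lookup b q * Poly_Mapping.lookup (actw p (sing q)) W))"
  unfolding act_def lookup_lext by (subst actw_lext) (simp add: lookup_lext sum_distrib_left)

text \<open>If one pair of words alone contributes to \<open>W\<close>, nothing can cancel its
  contribution.\<close>

lemma lookup_act_unique:
  assumes "p \<in> Poly_Mapping.keys a" "q \<in> Poly_Mapping.keys b"
    "\<And>p' q'. p' \<in> Poly_Mapping.keys a \<Longrightarrow> q' \<in> Poly_Mapping.keys b \<Longrightarrow>
       Poly_Mapping.lookup (actw p' (sing q')) W \<noteq> 0 \<longleftrightarrow> p' = p \<and> q' = q"
  shows "Poly_Mapping.lookup (act a b) W \<noteq> 0"
proof -
  let ?c = "\<lambda>p' q'. Poly_Mapping.lookup a p' * (Poly_Mapping.lookup b q' * Poly_Mapping.lookup (actw p' (sing q')) W)"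
  have 0: "?c p' q' = 0" if "p' \<in> Poly_Mapping.keys a" "q' \<in> Poly_Mapping.keys b" "\<not> (p' = p \<and> q' = q)" for p' q'
    using assms(3)[OF that(1,2)] that(3) by simp
  have "Poly_Mapping.lookup (act a b) W = (\<Sum>p'\<in>{p}. \<Sum>q'\<in>Poly_Mapping.keys b. ?c p' q')"
    unfolding lookup_act using assms(1) 0 by (intro sum.mono_neutral_right) (auto intro!: sum.neutral)
  also have "\<dots> = (\<Sum>q'\<in>Poly_Mapping.keys b. ?c p q')" by simp
  also have "\<dots> = (\<Sum>q'\<in>{q}. ?c p q')"
    using assms(1,2) 0 by (intro sum.mono_neutral_right) auto
  finally show ?thesis using assms(1,2) assms(3)[OF assms(1,2)] by (simp add: in_keys_iff)
qed

definition twin :: "('v, 'e) gen \<Rightarrow> ('v, 'e) gen \<Rightarrow> bool" where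
  "twin x y \<longleftrightarrow> (\<exists>e i j. x = Edge e i \<and> y = Ghost e j) \<or> (\<exists>e f i. x = Ghost e i \<and> y = Edge f i)"

text \<open>Every replacement pair is a twin, so a word whose junction is not a twin cannot have
  arisen by rewriting at that place.\<close>

lemma alts_twin: "(x', y') \<in> alts x y \<Longrightarrow> twin x' y'"
  by (cases "(x, y)" rule: alts.cases) (auto simp: twin_def)

text \<open>A junction that is not a twin gives a concatenation that no rewriting can produce. If
  all junctions are twins, they are all bad or all good, and in the bad case a suitable replacement
  pair determines the letters it replaced.\<close>

lemma ex_unique_top:
  assumes lv: "\<And>e. e \<in> sedges G \<Longrightarrow> 2 \<le> wt G e"
    "\<And>e. e \<in> sedges G \<Longrightarrow> \<exists>g\<in>sedges G. g \<noteq> e \<and> wt G g = vwt G z"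
  assumes A: "A \<noteq> {}" "\<And>p. p \<in> A \<Longrightarrow> nod p \<and> length p = m"
    and B: "B \<noteq> {}" "\<And>q. q \<in> B \<Longrightarrow> nod q \<and> length q = n"
    and mn: "1 \<le> m" "1 \<le> n"
  shows "\<exists>W p q. p \<in> A \<and> q \<in> B \<and> length W = m + n \<and>
    (\<forall>p'\<in>A. \<forall>q'\<in>B. W \<in> tops p' q' \<longleftrightarrow> p' = p \<and> q' = q)"
proof -
  have ne: "p \<noteq> []" "nod p" "length p = m" if "p \<in> A" for p using A(2)[OF that] mn by auto
  have ne': "q \<noteq> []" "nod q" "length q = n" if "q \<in> B" for q using B(2)[OF that] mn by auto
  \<comment> \<open>All words in \<open>A\<close> have length \<open>m\<close>, so
    \<open>p @ q\<close> determines its factors among concatenations; only a bad junction could give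
    it in another way.\<close>
  have good: ?thesis if "p \<in> A" "q \<in> B" "\<not> bad (last p) (hd q)"
    "\<And>p' q'. p' \<in> A \<Longrightarrow> q' \<in> B \<Longrightarrow> bad (last p') (hd q') \<Longrightarrow> p @ q \<notin> tops p' q'" for p q
  proof (rule exI[of _ "p @ q"], rule exI[of _ p], rule exI[of _ q], intro conjI ballI)
    fix p' q' assume pq: "p' \<in> A" "q' \<in> B"
    show "p @ q \<in> tops p' q' \<longleftrightarrow> p' = p \<and> q' = q"
    proof (cases "bad (last p') (hd q')")
      case True
      thus ?thesis using that pq by auto
    next
      case False
      thus ?thesis using ne(3)[OF pq(1)] ne(3)[OF that(1)] by (auto simp: tops_def)
    qed
  qed (use that ne ne' in auto)
  \<comment> \<open>The outer parts of the word give \<open>butlast p\<close> and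
    \<open>tl q\<close>; by the last assumption the replacement pair gives back the two letters of
    the junction.\<close>
  have bads: ?thesis if p: "p \<in> A" and q: "q \<in> B" and bd: "bad (last p) (hd q)"
    and xy: "(x', y') \<in> alts (last p) (hd q)"
    and u: "\<And>p1 q1. p1 \<in> A \<Longrightarrow> q1 \<in> B \<Longrightarrow> bad (last p1) (hd q1) \<and>
      ((x', y') \<in> alts (last p1) (hd q1) \<longrightarrow> last p1 = last p \<and> hd q1 = hd q)" for p q x' y'
  proof (rule exI[of _ "butlast p @ x' # y' # tl q"], rule exI[of _ p], rule exI[of _ q], intro conjI ballI)
    show "length (butlast p @ x' # y' # tl q) = m + n" using ne[OF p] ne'[OF q] mn by simp
    fix p1 q1 assume pq: "p1 \<in> A" "q1 \<in> B"
    show "butlast p @ x' # y' # tl q \<in> tops p1 q1 \<longleftrightarrow> p1 = p \<and> q1 = q"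
    proof
      assume "butlast p @ x' # y' # tl q \<in> tops p1 q1"
      then obtain x1 y1 where 1: "(x1, y1) \<in> alts (last p1) (hd q1)"
        "butlast p @ x' # y' # tl q = butlast p1 @ x1 # y1 # tl q1"
        using u[OF pq] by (auto simp: tops_def)
      hence 2: "butlast p = butlast p1" "x' = x1" "y' = y1" "tl q = tl q1"
        using ne[OF p] ne[OF pq(1)] by (auto simp: append_eq_append_conv)
      hence "last p1 = last p" "hd q1 = hd q" using u[OF pq] 1 by auto
      thus "p1 = p \<and> q1 = q"
        using 2 ne[OF p] ne[OF pq(1)] ne'[OF q] ne'[OF pq(2)]
        by (metis append_butlast_last_id list.collapse)
    next
      assume "p1 = p \<and> q1 = q"
      thus "butlast p @ x' # y' # tl q \<in> tops p1 q1"
        using bd xy by (force simp: tops_def)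
    qed
  qed (use p q in auto)
  show ?thesis
  proof (cases "\<exists>p\<in>A. \<exists>q\<in>B. \<not> twin (last p) (hd q)")
    case True
    then obtain p q where pq: "p \<in> A" "q \<in> B" "\<not> twin (last p) (hd q)" by blast
    have "\<not> bad (last p) (hd q)"
      using pq(3) by (cases "(last p, hd q)" rule: bad.cases) (auto simp: twin_def)
    moreover have "p @ q \<notin> tops p' q'" if pq': "p' \<in> A" "q' \<in> B" "bad (last p') (hd q')" for p' q'
    proof
      assume "p @ q \<in> tops p' q'"
      then obtain x1 y1 where 1: "(x1, y1) \<in> alts (last p') (hd q')"
        "p @ q = butlast p' @ x1 # y1 # tl q'"
        using pq' by (auto simp: tops_def)
      have "length p = length (butlast p' @ [x1])"
        using ne(3)[OF pq(1)] ne(3)[OF pq'(1)] mn by simp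
      moreover have "p @ q = (butlast p' @ [x1]) @ y1 # tl q'" using 1(2) by simp
      ultimately have "p = butlast p' @ [x1] \<and> q = y1 # tl q'"
        using append_eq_append_conv by blast
      hence "twin (last p) (hd q)" using alts_twin[OF 1(1)] by (elim conjE) simp
      thus False using pq by blast
    qed
    ultimately show ?thesis using good pq by blast
  next
    case False
    \<comment> \<open>Compared with a fixed partner, the last letters of \<open>A\<close> share
      their edge (edges before ghosts) or their index (ghosts before edges), and likewise the heads
      of \<open>B\<close>.\<close>
    hence tw: "twin (last p) (hd q)" if "p \<in> A" "q \<in> B" for p q using that by blast
    obtain p q where pq: "p \<in> A" "q \<in> B" using A(1) B(1) by blast
    have lets: "letter (last p)" "letter (hd q)"
      using ne(1,2)[OF pq(1)] ne'(1,2)[OF pq(2)] nod_letter by (auto simp: last_in_set hd_in_set)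
    from tw[OF pq] consider e i j where "last p = Edge e i" "hd q = Ghost e j"
      | e f i where "last p = Ghost e i" "hd q = Edge f i"
      by (auto simp: twin_def)
    thus ?thesis
    proof cases
      case 1
      have e: "e \<in> sedges G" "i \<le> wt G e" "j \<le> wt G e" using lets 1 by auto
      have la: "\<exists>i'. last p' = Edge e i'" if "p' \<in> A" for p'
        using tw[OF that pq(2)] 1 by (auto simp: twin_def)
      have hb: "\<exists>j'. hd q' = Ghost e j'" if "q' \<in> B" for q'
        using tw[OF pq(1) that] 1 by (auto simp: twin_def)
      show ?thesis
      proof (cases "e = al z")
        case False
        have "\<not> bad (last p') (hd q')" if "p' \<in> A" "q' \<in> B" for p' q'
          using la[OF that(1)] hb[OF that(2)] False e by auto
        thus ?thesis using good[OF pq] pq by blast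
      next
        case True
        \<comment> \<open>Maximal weight makes \<open>g\<close> admissible for all index pairs. The
          replacement pair retains both indices, and the edge \<open>e\<close> is common to all
          junctions.\<close>
        obtain g where g: "g \<in> sedges G" "g \<noteq> e" "wt G g = vwt G z" using lv(2)[OF e(1)] by blast
        have "wt G e \<le> vwt G z" using e by (intro wt_le_vwt) (simp add: out_edges_z)
        hence "(Edge g i, Ghost g j) \<in> alts (last p) (hd q)"
          using g e by (auto simp: 1 out_edges_z)
        moreover have "bad (last p1) (hd q1) \<and> ((Edge g i, Ghost g j) \<in> alts (last p1) (hd q1) \<longrightarrow>
            last p1 = last p \<and> hd q1 = hd q)" if "p1 \<in> A" "q1 \<in> B" for p1 q1
          using la[OF that(1)] hb[OF that(2)] True e 1 by auto
        ultimately show ?thesis using bads[OF pq] pq by blast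
      qed
    next
      case 2
      have ef: "e \<in> sedges G" "f \<in> sedges G" using lets 2 by auto
      have la: "\<exists>e'. last p' = Ghost e' i" if "p' \<in> A" for p'
        using tw[OF that pq(2)] 2 by (auto simp: twin_def)
      have hb: "\<exists>f'. hd q' = Edge f' i" if "q' \<in> B" for q'
        using tw[OF pq(1) that] 2 by (auto simp: twin_def)
      show ?thesis
      proof (cases "i = 1")
        case False
        have "\<not> bad (last p') (hd q')" if "p' \<in> A" "q' \<in> B" for p' q'
          using la[OF that(1)] hb[OF that(2)] False by auto
        thus ?thesis using good[OF pq] pq by blast
      next
        case True
        \<comment> \<open>Index 2 exists on both edges because all weights are at least 2. This pair
          retains the two edges, and the index 1 is common to all junctions.\<close>
        have "(Ghost e 2, Edge f 2) \<in> alts (last p) (hd q)"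
          using lv(1)[OF ef(1)] lv(1)[OF ef(2)] by (auto simp: 2)
        moreover have "bad (last p1) (hd q1) \<and> ((Ghost e 2, Edge f 2) \<in> alts (last p1) (hd q1) \<longrightarrow>
            last p1 = last p \<and> hd q1 = hd q)" if "p1 \<in> A" "q1 \<in> B" for p1 q1
          using la[OF that(1)] hb[OF that(2)] True 2 by auto
        ultimately show ?thesis using bads[OF pq] pq by blast
      qed
    qed
  qed
qed

section \<open>Word length as a degree\<close>

definition ldeg :: "(('v, 'e) gen list \<Rightarrow>\<^sub>0 'k) \<Rightarrow> nat" where
  "ldeg v = Max (length ` Poly_Mapping.keys v)"

lemma ldeg_ge: "w \<in> Poly_Mapping.keys v \<Longrightarrow> length w \<le> ldeg v"
  by (simp add: ldeg_def)

lemma ldeg_attained: "v \<noteq> 0 \<Longrightarrow> \<exists>w\<in>Poly_Mapping.keys v. length w = ldeg v"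
proof -
  assume "v \<noteq> 0"
  hence "Max (length ` Poly_Mapping.keys v) \<in> length ` Poly_Mapping.keys v"
    by (intro Max_in) simp_all
  thus ?thesis unfolding ldeg_def by force
qed

lemma ldeg_0: "v \<noteq> 0 \<Longrightarrow> ldeg v = 0 \<Longrightarrow> \<exists>k. v = Poly_Mapping.single [] k \<and> k \<noteq> 0"
proof -
  assume v: "v \<noteq> 0" "ldeg v = 0"
  have w: "w = []" if "w \<in> Poly_Mapping.keys v" for w using ldeg_ge[OF that] v(2) by simp
  have "v = Poly_Mapping.single [] (Poly_Mapping.lookup v [])"
    using w by (intro poly_mapping_eqI) (auto simp: lookup_single when_def in_keys_iff)
  moreover from this have "Poly_Mapping.lookup v [] \<noteq> 0" using v(1) by (metis single_zero)
  ultimately show ?thesis by blast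
qed

text \<open>Only words of maximal length in both factors can reach the top length, and among them
  some word is reached exactly once. A factor of degree 0 is a scalar and is treated apart, since an
  empty word has no letter at the junction.\<close>

theorem act_top_degree:
  assumes lv: "\<And>e. e \<in> sedges G \<Longrightarrow> 2 \<le> wt G e"
    "\<And>e. e \<in> sedges G \<Longrightarrow> \<exists>g\<in>sedges G. g \<noteq> e \<and> wt G g = vwt G z"
    and ab: "a \<in> V" "b \<in> V" "a \<noteq> 0" "b \<noteq> 0"
  shows "\<exists>W\<in>Poly_Mapping.keys (act a b). length W = ldeg a + ldeg b"
proof -
  consider "ldeg a = 0" | "ldeg b = 0" | "1 \<le> ldeg a" "1 \<le> ldeg b" by linarith
  thus ?thesis
  proof cases
    case 1
    then obtain k where k: "a = Poly_Mapping.single [] k" "k \<noteq> 0" using ldeg_0[OF ab(3)] by blast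
    obtain w where "w \<in> Poly_Mapping.keys b" "length w = ldeg b" using ldeg_attained[OF ab(4)] by blast
    thus ?thesis using k 1 by (intro bexI[of _ w]) (auto simp: act_single in_keys_iff)
  next
    case 2
    then obtain k where k: "b = Poly_Mapping.single [] k" "k \<noteq> 0" using ldeg_0[OF ab(4)] by blast
    have "act a (sing []) = lext sing a"
      unfolding act_def using V_nod[OF ab(1)] by (intro lext_cong) (simp add: actw_sing_nod)
    hence "act a (sing []) = a" by (simp add: lext_id)
    moreover have "b = pm_scale k (sing [])" by (simp add: k)
    ultimately have "act a b = pm_scale k a" by (simp only: act_scale)
    moreover obtain w where "w \<in> Poly_Mapping.keys a" "length w = ldeg a" using ldeg_attained[OF ab(3)] by blast
    ultimately show ?thesis using k(2) 2 by (intro bexI[of _ w]) (auto simp: in_keys_iff)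
  next
    case 3
    define A where "A = {p \<in> Poly_Mapping.keys a. length p = ldeg a}"
    define B where "B = {q \<in> Poly_Mapping.keys b. length q = ldeg b}"
    have ne: "A \<noteq> {}" "B \<noteq> {}" using ldeg_attained ab unfolding A_def B_def by blast+
    have nA: "nod p \<and> length p = ldeg a" if "p \<in> A" for p using that V_nod ab unfolding A_def by blast
    have nB: "nod q \<and> length q = ldeg b" if "q \<in> B" for q using that V_nod ab unfolding B_def by blast
    have "\<exists>W p q. p \<in> A \<and> q \<in> B \<and> length W = ldeg a + ldeg b \<and>
        (\<forall>p'\<in>A. \<forall>q'\<in>B. W \<in> tops p' q' \<longleftrightarrow> p' = p \<and> q' = q)"
      by (rule ex_unique_top[OF lv ne(1) nA ne(2) nB 3])
    then obtain W p q where *: "p \<in> A \<and> q \<in> B \<and> length W = ldeg a + ldeg b \<and>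
        (\<forall>p'\<in>A. \<forall>q'\<in>B. W \<in> tops p' q' \<longleftrightarrow> p' = p \<and> q' = q)"
      by (elim exE)
    hence W: "p \<in> A" "q \<in> B" "length W = ldeg a + ldeg b" by simp_all
    have W4: "W \<in> tops p' q' \<longleftrightarrow> p' = p \<and> q' = q" if "p' \<in> A" "q' \<in> B" for p' q'
      using * that by simp
    have pq0: "p \<in> Poly_Mapping.keys a" "q \<in> Poly_Mapping.keys b" "length p = ldeg a" "length q = ldeg b"
      using W(1,2) by (simp_all add: A_def B_def)
    have "Poly_Mapping.lookup (act a b) W \<noteq> 0"
    proof (rule lookup_act_unique)
      fix p' q' assume pq: "p' \<in> Poly_Mapping.keys a" "q' \<in> Poly_Mapping.keys b"
      have n: "nod p'" "nod q'" using pq V_nod ab by blast+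
      have le: "length p' \<le> ldeg a" "length q' \<le> ldeg b" using pq ldeg_ge by blast+
      show "Poly_Mapping.lookup (actw p' (sing q')) W \<noteq> 0 \<longleftrightarrow> p' = p \<and> q' = q"
      proof (cases "length p' = ldeg a \<and> length q' = ldeg b")
        case True
        hence "p' \<noteq> []" "q' \<noteq> []" using 3 by auto
        hence "Poly_Mapping.lookup (actw p' (sing q')) W \<noteq> 0 \<longleftrightarrow> W \<in> tops p' q'"
          using actw_tops[OF n(1) _ n(2), of W] W(3) True by simp
        also have "\<dots> \<longleftrightarrow> p' = p \<and> q' = q"
          using pq True by (intro W4) (simp_all add: A_def B_def)
        finally show ?thesis .
      next
        case False
        hence "length p' + length q' < length W" using le W(3) by linarith
        hence "Poly_Mapping.lookup (actw p' (sing q')) W = 0" by (rule actw_length_sing[OF n])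
        thus ?thesis using False pq0(3,4) by blast
      qed
    qed (use pq0 in simp_all)
    thus ?thesis using W(3) by (intro bexI[of _ W]) (auto simp: in_keys_iff)
  qed
qed

end

section \<open>Zero divisors and units\<close>

lemma mult_ring_of_type_algebra: "x \<otimes>\<^bsub>ring_of_type_algebra\<^esub> y = (x * y :: 'k::field)"
  by (simp add: ring_of_type_algebra_def)

lemma Units_ring_of_type_algebra: "Units (ring_of_type_algebra :: 'k::field ring) = {k. k \<noteq> 0}"
proof -
  have "\<exists>y. y * k = 1 \<and> k * y = 1" if "k \<noteq> 0" for k :: 'k
    using that by (intro exI[of _ "inverse k"]) simp
  thus ?thesis by (auto simp: Units_def ring_of_type_algebra_def)
qed

context one_vertex_rep
begin

abbreviation A where "A \<equiv> wlpa G :: ('k, ('v, 'e, 'k) free_elt set) module"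

lemma one_scalar: "\<one>\<^bsub>A\<^esub> = 1 \<odot>\<^bsub>A\<^esub> wlpa_vtx G z"
proof -
  interpret A: ring A by (rule wlpa_ring)
  show ?thesis by (intro scalar_of_nf) (simp_all add: nf_one)
qed

lemma one_not_zero: "\<one>\<^bsub>A\<^esub> \<noteq> \<zero>\<^bsub>A\<^esub>"
proof
  assume "\<one>\<^bsub>A\<^esub> = \<zero>\<^bsub>A\<^esub>"
  hence "nf \<one>\<^bsub>A\<^esub> = act 0 (sing [])" by (simp add: wlpa_zero nf_cl)
  hence "sing [] = (0 :: ('v, 'e, 'k) free_elt)" by (simp add: nf_one)
  thus False by (metis lookup_single_eq lookup_zero zero_neq_one)
qed

lemma units_scalar_iso:
  assumes sc: "\<And>x. x \<in> Units A \<Longrightarrow> \<exists>k. x = k \<odot>\<^bsub>A\<^esub> wlpa_vtx G z"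
  shows "units_of A \<cong> units_of (ring_of_type_algebra :: 'k ring)"
proof -
  interpret A: ring A by (rule wlpa_ring)
  interpret F: ring "ring_of_type_algebra :: 'k ring" by (rule ring_from_type_algebra)
  let ?s = "\<lambda>k. k \<odot>\<^bsub>A\<^esub> wlpa_vtx G z"
  have unit: "?s k \<in> Units A" if "k \<noteq> 0" for k
  proof -
    have "?s k \<otimes>\<^bsub>A\<^esub> ?s (inverse k) = \<one>\<^bsub>A\<^esub>" "?s (inverse k) \<otimes>\<^bsub>A\<^esub> ?s k = \<one>\<^bsub>A\<^esub>"
      using that by (simp_all add: scalar_mult one_scalar)
    thus ?thesis unfolding Units_def using scalar_in by blast
  qed
  have "?s \<in> iso (units_of (ring_of_type_algebra :: 'k ring)) (units_of A)"
  proof (rule isoI)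
    show "?s \<in> hom (units_of (ring_of_type_algebra :: 'k ring)) (units_of A)"
      using unit
      by (intro homI)
         (simp_all add: units_of_carrier units_of_mult Units_ring_of_type_algebra scalar_mult mult_ring_of_type_algebra)
    show "bij_betw ?s (carrier (units_of (ring_of_type_algebra :: 'k ring))) (carrier (units_of A))"
      unfolding units_of_carrier Units_ring_of_type_algebra
    proof (rule bij_betw_imageI)
      show "inj_on ?s {k. k \<noteq> 0}"
      proof (rule inj_onI)
        fix k l assume "?s k = ?s l"
        hence "nf (?s k) = nf (?s l)" by simp
        hence "Poly_Mapping.single ([] :: ('v, 'e) gen list) k = Poly_Mapping.single [] l"
          unfolding nf_scalar .
        thus "k = l" by (metis lookup_single_eq)
      qed
      show "?s ` {k. k \<noteq> 0} = Units A"
      proof (intro equalityI subsetI)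
        fix x assume x: "x \<in> Units A"
        then obtain k where k: "x = ?s k" using sc by blast
        have "k \<noteq> 0"
        proof
          assume "k = 0"
          obtain y where y: "y \<in> carrier A" "x \<otimes>\<^bsub>A\<^esub> y = \<one>\<^bsub>A\<^esub>" using x by (auto simp: Units_def)
          have "nf x = 0" unfolding k \<open>k = 0\<close> nf_scalar by simp
          hence "x = \<zero>\<^bsub>A\<^esub>" using nf_zero_iff x A.Units_closed by blast
          thus False using y one_not_zero by simp
        qed
        thus "x \<in> ?s ` {k. k \<noteq> 0}" using k by blast
      qed (use unit in blast)
    qed
  qed
  thus ?thesis
    using group.iso_sym[OF F.units_group] by (auto simp: is_iso_def)
qed

context
  assumes lv: "\<And>e. e \<in> sedges G \<Longrightarrow> 2 \<le> wt G e"
    "\<And>e. e \<in> sedges G \<Longrightarrow> \<exists>g\<in>sedges G. g \<noteq> e \<and> wt G g = vwt G z"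
begin

text \<open>A product of nonzero normal forms has a word in its support. The hypotheses
  \<open>lv\<close> hold for LV-roses and, vacuously, for a vertex without edges, so both cases are
  covered.\<close>

lemma wlpa_nc_domain: "nc_domain A"
  unfolding nc_domain_def
proof (intro conjI ballI impI)
  interpret A: ring A by (rule wlpa_ring)
  show "carrier A \<noteq> {\<zero>\<^bsub>A\<^esub>}" using one_not_zero A.one_closed by blast
  fix a b assume ab: "a \<in> carrier A" "b \<in> carrier A" "a \<otimes>\<^bsub>A\<^esub> b = \<zero>\<^bsub>A\<^esub>"
  show "a = \<zero>\<^bsub>A\<^esub> \<or> b = \<zero>\<^bsub>A\<^esub>"
  proof (rule ccontr)
    assume "\<not> ?thesis"
    hence "nf a \<noteq> 0" "nf b \<noteq> 0" using ab nf_zero_iff by blast+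
    hence "act (nf a) (nf b) \<noteq> 0"
      using act_top_degree[OF lv nf_V[OF ab(1)] nf_V[OF ab(2)]] by (metis empty_iff keys_zero)
    moreover have "nf (a \<otimes>\<^bsub>A\<^esub> b) = 0" using ab(3) nf_zero_iff[OF A.zero_closed] by simp
    ultimately show False using nf_mult[OF ab(1,2)] by simp
  qed
qed (rule wlpa_ring)

text \<open>The degrees of a unit and its inverse add up to the degree 0 of the identity, so both
  vanish.\<close>

lemma wlpa_units_scalar:
  assumes "x \<in> Units A"
  shows "\<exists>k. x = k \<odot>\<^bsub>A\<^esub> wlpa_vtx G z"
proof -
  obtain y where xy: "x \<in> carrier A" "y \<in> carrier A" "x \<otimes>\<^bsub>A\<^esub> y = \<one>\<^bsub>A\<^esub>"
    using assms by (auto simp: Units_def)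
  have e: "act (nf x) (nf y) = sing []" using nf_mult[OF xy(1,2)] xy(3) by (simp add: nf_one)
  have n0: "sing [] \<noteq> (0 :: ('v, 'e, 'k) free_elt)" by (metis lookup_single_eq lookup_zero zero_neq_one)
  have "nf x \<noteq> 0" "nf y \<noteq> 0" using e n0 by (metis act_0_left, metis act_0)
  from act_top_degree[OF lv nf_V[OF xy(1)] nf_V[OF xy(2)] this]
  have "ldeg (nf x) = 0" unfolding e by simp
  from ldeg_0[OF \<open>nf x \<noteq> 0\<close> this] show ?thesis using scalar_of_nf[OF xy(1)] by blast
qed

end

end

section \<open>Laurent polynomials\<close>

lemma lookup_mult_extreme:
  fixes p q :: "int \<Rightarrow>\<^sub>0 'k::field"
  assumes "m \<in> Poly_Mapping.keys p" "n \<in> Poly_Mapping.keys q"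
    "\<And>i j. i \<in> Poly_Mapping.keys p \<Longrightarrow> j \<in> Poly_Mapping.keys q \<Longrightarrow> i + j = m + n \<Longrightarrow> i = m \<and> j = n"
  shows "Poly_Mapping.lookup (p * q) (m + n) \<noteq> 0"
proof -
  let ?c = "\<lambda>i j. Poly_Mapping.lookup p i * Poly_Mapping.lookup q j"
  have "p * q = (\<Sum>i\<in>Poly_Mapping.keys p. \<Sum>j\<in>Poly_Mapping.keys q. Poly_Mapping.single (i + j) (?c i j))"
  proof -
    have "p * q = (\<Sum>i\<in>Poly_Mapping.keys p. Poly_Mapping.single i (Poly_Mapping.lookup p i)) *
        (\<Sum>j\<in>Poly_Mapping.keys q. Poly_Mapping.single j (Poly_Mapping.lookup q j))"
      by (simp flip: poly_mapping_sum_single)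
    thus ?thesis by (simp add: sum_product mult_single)
  qed
  hence "Poly_Mapping.lookup (p * q) (m + n) =
      (\<Sum>i\<in>Poly_Mapping.keys p. \<Sum>j\<in>Poly_Mapping.keys q. if i + j = m + n then ?c i j else 0)"
    by (simp add: lookup_sum lookup_single when_def)
  also have "\<dots> = (\<Sum>i\<in>{m}. \<Sum>j\<in>Poly_Mapping.keys q. if i + j = m + n then ?c i j else 0)"
  proof (intro sum.mono_neutral_right ballI sum.neutral)
    fix i j assume "i \<in> Poly_Mapping.keys p - {m}" "j \<in> Poly_Mapping.keys q"
    thus "(if i + j = m + n then ?c i j else 0) = 0" using assms(3)[of i j] by auto
  qed (use assms(1) in simp_all)
  also have "\<dots> = (\<Sum>j\<in>Poly_Mapping.keys q. if m + j = m + n then ?c m j else 0)" by simp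
  also have "\<dots> = (\<Sum>j\<in>{n}. if m + j = m + n then ?c m j else 0)"
    using assms(2) by (intro sum.mono_neutral_right) simp_all
  finally show ?thesis using assms(1,2) by (simp add: in_keys_iff)
qed

text \<open>Highest and lowest exponents both add up to 0 in \<open>p * q = 1\<close>. As neither
  lowest exponent exceeds the highest, they coincide for \<open>p\<close>.\<close>

lemma laurent_unit_monomial:
  fixes p q :: "int \<Rightarrow>\<^sub>0 'k::field"
  assumes "p * q = 1"
  shows "\<exists>n k. p = Poly_Mapping.single n k \<and> k \<noteq> 0"
proof -
  have "p \<noteq> 0" "q \<noteq> 0" using assms by auto
  hence ne: "Poly_Mapping.keys p \<noteq> {}" "Poly_Mapping.keys q \<noteq> {}" by simp_all
  let ?M = "\<lambda>r :: int \<Rightarrow>\<^sub>0 'k. Max (Poly_Mapping.keys r)" and ?m = "\<lambda>r :: int \<Rightarrow>\<^sub>0 'k. Min (Poly_Mapping.keys r)"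
  have M: "i \<le> ?M r" "?m r \<le> i" if "i \<in> Poly_Mapping.keys r" for i and r :: "int \<Rightarrow>\<^sub>0 'k"
    using that by simp_all
  have in1: "n = 0" if "Poly_Mapping.lookup (p * q) n \<noteq> 0" for n
    using that by (simp add: assms lookup_one when_def split: if_splits)
  have "Poly_Mapping.lookup (p * q) (?M p + ?M q) \<noteq> 0"
  proof (rule lookup_mult_extreme)
    fix i j assume "i \<in> Poly_Mapping.keys p" "j \<in> Poly_Mapping.keys q" "i + j = ?M p + ?M q"
    thus "i = ?M p \<and> j = ?M q" using M(1)[of i p] M(1)[of j q] by linarith
  qed (use ne in simp_all)
  moreover have "Poly_Mapping.lookup (p * q) (?m p + ?m q) \<noteq> 0"
  proof (rule lookup_mult_extreme)
    fix i j assume "i \<in> Poly_Mapping.keys p" "j \<in> Poly_Mapping.keys q" "i + j = ?m p + ?m q"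
    thus "i = ?m p \<and> j = ?m q" using M(2)[of i p] M(2)[of j q] by linarith
  qed (use ne in simp_all)
  ultimately have "?M p + ?M q = 0" "?m p + ?m q = 0" using in1 by blast+
  moreover have "?m p \<le> ?M p" "?m q \<le> ?M q" using ne by simp_all
  ultimately have "?m p = ?M p" by linarith
  hence k: "i = ?M p" if "i \<in> Poly_Mapping.keys p" for i
    using M[OF that] by linarith
  have "p = Poly_Mapping.single (?M p) (Poly_Mapping.lookup p (?M p))"
    using k by (intro poly_mapping_eqI) (auto simp: lookup_single when_def in_keys_iff)
  moreover have "Poly_Mapping.lookup p (?M p) \<noteq> 0"
    using Max_in[OF finite_keys ne(1)] by (simp add: in_keys_iff)
  ultimately show ?thesis by blast
qed

lemma laurent_simps:
  "carrier laurent = UNIV" "p \<otimes>\<^bsub>laurent\<^esub> q = p * q" "\<one>\<^bsub>laurent\<^esub> = 1" "\<zero>\<^bsub>laurent\<^esub> = 0"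
  "p \<oplus>\<^bsub>laurent\<^esub> q = p + q" "k \<odot>\<^bsub>laurent\<^esub> p = pm_scale k p"
  by (simp_all add: laurent_def)

lemma laurent_Units: "Units (laurent :: ('k::field, int \<Rightarrow>\<^sub>0 'k) module) = {Poly_Mapping.single n k | n k. k \<noteq> 0}"
proof (intro equalityI subsetI)
  fix p :: "int \<Rightarrow>\<^sub>0 'k" assume "p \<in> Units laurent"
  then obtain q where "p * q = 1" by (auto simp: Units_def laurent_simps)
  thus "p \<in> {Poly_Mapping.single n k | n k. k \<noteq> 0}" using laurent_unit_monomial by blast
next
  fix p :: "int \<Rightarrow>\<^sub>0 'k" assume "p \<in> {Poly_Mapping.single n k | n k. k \<noteq> 0}"
  then obtain n k where p: "p = Poly_Mapping.single n k" "k \<noteq> 0" by blast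
  have "p * Poly_Mapping.single (- n) (inverse k) = 1" "Poly_Mapping.single (- n) (inverse k) * p = 1"
    using p by (simp_all add: mult_single)
  thus "p \<in> Units laurent" unfolding Units_def laurent_simps by blast
qed

lemma laurent_comm_ring: "cring (laurent :: ('k::field, int \<Rightarrow>\<^sub>0 'k) module)"
proof (rule cringI)
  show "abelian_group (laurent :: ('k, int \<Rightarrow>\<^sub>0 'k) module)"
  proof (rule abelian_groupI)
    fix x :: "int \<Rightarrow>\<^sub>0 'k"
    show "\<exists>y\<in>carrier laurent. y \<oplus>\<^bsub>laurent\<^esub> x = \<zero>\<^bsub>laurent\<^esub>"
      by (rule bexI[of _ "- x"]) (simp_all add: laurent_simps)
  qed (simp_all add: laurent_simps ac_simps)
  show "Group.comm_monoid (laurent :: ('k, int \<Rightarrow>\<^sub>0 'k) module)"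
    by (rule comm_monoidI) (simp_all add: laurent_simps ac_simps)
qed (simp_all add: laurent_simps distrib_right)

lemma laurent_generate:
  "generate (units_of (laurent :: ('k::field, int \<Rightarrow>\<^sub>0 'k) module)) {laurent_X} = range (\<lambda>n. Poly_Mapping.single n 1)"
proof -
  interpret L: cring "laurent :: ('k, int \<Rightarrow>\<^sub>0 'k) module" by (rule laurent_comm_ring)
  interpret U: comm_group "units_of (laurent :: ('k, int \<Rightarrow>\<^sub>0 'k) module)" by (rule L.units_comm_group)
  let ?U = "units_of (laurent :: ('k, int \<Rightarrow>\<^sub>0 'k) module)"
  have c: "Poly_Mapping.single n 1 \<in> carrier ?U" for n
    unfolding units_of_carrier laurent_Units by force
  have inv: "inv\<^bsub>?U\<^esub> (Poly_Mapping.single n 1) = Poly_Mapping.single (- n) 1" for n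
    by (rule U.inv_equality) (simp_all only: c, simp add: units_of_mult units_of_one laurent_simps mult_single)
  let ?X = "laurent_X :: int \<Rightarrow>\<^sub>0 'k"
  have nat: "Poly_Mapping.single (int n) 1 \<in> generate ?U {?X} \<and> Poly_Mapping.single (- int n) 1 \<in> generate ?U {?X}" for n
  proof (induction n)
    case 0
    thus ?case using generate.one[of ?U "{?X}"] by (simp add: units_of_one laurent_simps)
  next
    case (Suc n)
    have "?X \<otimes>\<^bsub>?U\<^esub> Poly_Mapping.single (int n) 1 \<in> generate ?U {?X}"
      using Suc by (intro generate.eng[OF generate.incl]) simp_all
    moreover have "inv\<^bsub>?U\<^esub> ?X \<otimes>\<^bsub>?U\<^esub> Poly_Mapping.single (- int n) 1 \<in> generate ?U {?X}"
      using Suc by (intro generate.eng[OF generate.inv]) simp_all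
    ultimately show ?case
      unfolding laurent_X_def inv by (simp add: units_of_mult laurent_simps mult_single algebra_simps)
  qed
  show ?thesis
  proof (intro equalityI subsetI)
    fix p assume "p \<in> generate ?U {?X}"
    thus "p \<in> range (\<lambda>n. Poly_Mapping.single n 1)"
    proof induction
      case one
      show ?case by (rule range_eqI[of _ _ 0]) (simp add: units_of_one laurent_simps)
    next
      case (incl h)
      thus ?case by (auto simp: laurent_X_def)
    next
      case (inv h)
      thus ?case by (auto simp: laurent_X_def \<open>\<And>n. inv\<^bsub>?U\<^esub> (Poly_Mapping.single n 1) = Poly_Mapping.single (- n) 1\<close>)
    next
      case (eng h1 h2)
      thus ?case by (auto simp: units_of_mult laurent_simps mult_single)
    qed
  next
    fix p :: "int \<Rightarrow>\<^sub>0 'k" assume "p \<in> range (\<lambda>n. Poly_Mapping.single n 1)"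
    then obtain n where "p = Poly_Mapping.single n 1" by blast
    thus "p \<in> generate ?U {?X}" using nat[of "nat n"] nat[of "nat (- n)"] by (cases "0 \<le> n") auto
  qed
qed

lemma laurent_units_eq:
  "{laurent_const k | k. k \<noteq> 0} <#>\<^bsub>units_of laurent\<^esub> generate (units_of laurent) {laurent_X} =
    Units (laurent :: ('k::field, int \<Rightarrow>\<^sub>0 'k) module)"
  unfolding laurent_generate laurent_Units set_mult_def laurent_const_def units_of_mult laurent_simps
  by (fastforce simp: mult_single)

lemma ring_iso_image_Units:
  assumes R: "ring R" and S: "ring S" and f: "\<phi> \<in> ring_iso R S"
  shows "\<phi> ` Units R = Units S"
proof -
  have h: "\<phi> \<in> ring_hom R S" "bij_betw \<phi> (carrier R) (carrier S)" using f by (auto simp: ring_iso_def)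
  have 1: "\<phi> \<one>\<^bsub>R\<^esub> = \<one>\<^bsub>S\<^esub>" and m: "\<phi> (x \<otimes>\<^bsub>R\<^esub> y) = \<phi> x \<otimes>\<^bsub>S\<^esub> \<phi> y" if "x \<in> carrier R" "y \<in> carrier R" for x y
    using ring_hom_one[OF h(1)] ring_hom_mult[OF h(1)] that by auto
  have 1: "\<phi> \<one>\<^bsub>R\<^esub> = \<one>\<^bsub>S\<^esub>" using ring_hom_one[OF h(1)] .
  have inj: "inj_on \<phi> (carrier R)" and im: "\<phi> ` carrier R = carrier S" using h(2) by (auto simp: bij_betw_def)
  interpret R: ring R by fact
  show ?thesis
  proof (intro equalityI subsetI)
    fix s assume "s \<in> \<phi> ` Units R"
    then obtain x y where xy: "s = \<phi> x" "x \<in> carrier R" "y \<in> carrier R" "x \<otimes>\<^bsub>R\<^esub> y = \<one>\<^bsub>R\<^esub>" "y \<otimes>\<^bsub>R\<^esub> x = \<one>\<^bsub>R\<^esub>"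
      by (auto simp: Units_def)
    hence "\<phi> x \<otimes>\<^bsub>S\<^esub> \<phi> y = \<one>\<^bsub>S\<^esub>" "\<phi> y \<otimes>\<^bsub>S\<^esub> \<phi> x = \<one>\<^bsub>S\<^esub>" using m[of x y] m[of y x] 1 by simp_all
    thus "s \<in> Units S" unfolding Units_def using xy im by blast
  next
    fix s assume s: "s \<in> Units S"
    then obtain t where t: "s \<in> carrier S" "t \<in> carrier S" "s \<otimes>\<^bsub>S\<^esub> t = \<one>\<^bsub>S\<^esub>" "t \<otimes>\<^bsub>S\<^esub> s = \<one>\<^bsub>S\<^esub>"
      by (auto simp: Units_def)
    then obtain x y where xy: "x \<in> carrier R" "s = \<phi> x" "y \<in> carrier R" "t = \<phi> y" using im by blast
    have "\<phi> (x \<otimes>\<^bsub>R\<^esub> y) = \<phi> \<one>\<^bsub>R\<^esub>" "\<phi> (y \<otimes>\<^bsub>R\<^esub> x) = \<phi> \<one>\<^bsub>R\<^esub>" using t xy m 1 by auto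
    hence "x \<otimes>\<^bsub>R\<^esub> y = \<one>\<^bsub>R\<^esub>" "y \<otimes>\<^bsub>R\<^esub> x = \<one>\<^bsub>R\<^esub>"
      using inj_onD[OF inj] xy R.m_closed R.one_closed by blast+
    thus "s \<in> \<phi> ` Units R" unfolding Units_def using xy by blast
  qed
qed

section \<open>A single loop of weight one\<close>

locale one_edge_rep = one_vertex_rep G al z K
  for G :: "('v, 'e) wgraph" and al z and K :: "'k::field itself" +
  fixes e :: 'e
  assumes one_edge: "sedges G = {e}" "wt G e = 1"
begin

primrec gdeg :: "('v, 'e) gen \<Rightarrow> int" where
  "gdeg (Vtx v) = 0"
| "gdeg (Edge f i) = 1"
| "gdeg (Ghost f i) = - 1"

definition wdeg :: "('v, 'e) gen list \<Rightarrow> int" where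
  "wdeg w = sum_list (map gdeg w)"

lemma wdeg_simps [simp]: "wdeg [] = 0" "wdeg (x # w) = gdeg x + wdeg w" "wdeg (u @ w) = wdeg u + wdeg w"
  by (simp_all add: wdeg_def)

text \<open>The homomorphism sending the vertex to 1, \<open>e_1\<close> to x and
  \<open>e_1^*\<close> to the inverse of x.\<close>

definition ev :: "('v, 'e, 'k) free_elt \<Rightarrow> (int \<Rightarrow>\<^sub>0 'k)" where
  "ev p = lext (\<lambda>w. sing (wdeg w)) p"

lemma ev_simps: "ev (p + q) = ev p + ev q" "ev (p - q) = ev p - ev q" "ev 0 = 0"
  "ev (pm_scale k p) = pm_scale k (ev p)" "ev (Poly_Mapping.single w c) = Poly_Mapping.single (wdeg w) c"
  by (simp_all add: ev_def lext_add lext_diff lext_scale)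

lemma ev_mult: "ev (p * q) = ev p * ev q"
proof (induction p rule: pm_induct)
  case (single w c)
  show ?case
  proof (induction q rule: pm_induct)
    case (single w' c')
    show ?case by (simp add: ev_simps mult_single list_plus_eq)
  next
    case (add q q')
    thus ?case by (simp only: distrib_left ev_simps)
  qed (simp add: ev_simps)
next
  case (add p p')
  thus ?case by (simp only: distrib_right ev_simps)
qed (simp add: ev_simps)

lemma ev_generators:
  "ev (vtx v) = 1" "ev (redge G e 1) = sing 1" "ev (rghost G e 1) = sing (- 1)"
  using one_edge by (simp_all add: vtx_def redge_def rghost_def ev_simps)

lemma vwt_z: "vwt G z = 1"
  using one_edge out_edges_z by (simp add: vwt_def is_sink_def)

text \<open>With one loop of weight 1, (W3) and (W4) are one equation each and say that
  \<open>e_1\<close> and \<open>e_1^*\<close> are mutually inverse.\<close>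

lemma ev_ideal: "p \<in> wlpa_ideal G \<Longrightarrow> ev p = 0"
proof (induction rule: wlpa_ideal.induct)
  case (rel p)
  then consider "p \<in> W1_rels G" | "p \<in> W2_rels G" | "p \<in> W3_rels G" | "p \<in> W4_rels G" by blast
  thus ?case
  proof cases
    case 1
    then obtain u v where "u \<in> verts G" "v \<in> verts G" "p = vtx u * vtx v - (if u = v then vtx u else 0)"
      unfolding W1_rels_def by blast
    thus ?thesis using verts by (simp add: ev_simps ev_mult ev_generators)
  next
    case 2
    then obtain i where i: "i \<in> {1..wt G e}"
      and p: "p \<in> {vtx (src G e) * redge G e i - redge G e i,
          redge G e i * vtx (rng G e) - redge G e i,
          vtx (rng G e) * rghost G e i - rghost G e i,
          rghost G e i * vtx (src G e) - rghost G e i}"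
      unfolding W2_rels_def one_edge(1) by blast
    have "i = 1" using i one_edge(2) by simp
    thus ?thesis using p by (elim insertE emptyE) (simp_all add: ev_simps ev_mult ev_generators del: One_nat_def)
  next
    case 3
    then obtain v i j where v: "v \<in> verts G" "i \<in> {1..vwt G v}" "j \<in> {1..vwt G v}"
      and p: "p = (\<Sum>f\<in>out_edges G v. redge G f i * rghost G f j) - (if i = j then vtx v else 0)"
      unfolding W3_rels_def by blast
    have "v = z" "i = 1" "j = 1" using v verts vwt_z by simp_all
    thus ?thesis unfolding p using one_edge(1)
      by (simp add: out_edges_z ev_simps ev_mult ev_generators mult_single del: One_nat_def)
  next
    case 4
    then obtain f g where "f \<in> sedges G" "g \<in> sedges G"
        "p = (\<Sum>i = 1..max (wt G f) (wt G g). rghost G f i * redge G g i)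
          - (if f = g then vtx (rng G f) else 0)"
      unfolding W4_rels_def by blast
    hence "p = rghost G e 1 * redge G e 1 - vtx (rng G e)" using one_edge by simp
    thus ?thesis by (simp add: ev_simps ev_mult ev_generators mult_single del: One_nat_def)
  qed
qed (simp_all add: ev_simps ev_mult)

lemma ev_cong: "cl G p = cl G q \<Longrightarrow> ev p = ev q"
  using ev_ideal[of "p - q"] by (simp add: cl_eq_iff ev_simps)

lemma ev_lext_emb: "ev (lext emb v) = lext (\<lambda>w. sing (wdeg w)) v"
proof -
  have "lext (\<lambda>w. sing (wdeg w)) (emb w) = sing (wdeg w)" for w
    by (simp add: emb_def vtx_def)
  thus ?thesis by (simp add: ev_def lext_lext)
qed

definition word :: "int \<Rightarrow> ('v, 'e) gen list" where
  "word n = (if 0 \<le> n then replicate (nat n) (Edge e 1) else replicate (nat (- n)) (Ghost e 1))"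

lemma wdeg_word: "wdeg (word n) = n"
proof -
  have "wdeg (replicate k (Edge e i)) = int k" "wdeg (replicate k (Ghost e i)) = - int k" for k i
    by (induction k) simp_all
  thus ?thesis by (simp add: word_def)
qed

lemma al_z: "al z = e"
  using al[of z] verts one_edge out_edges_z by (simp add: is_sink_def)

text \<open>Both \<open>e_1 e_1^*\<close> and \<open>e_1^* e_1\<close> are forbidden here, so a
  normal word is a power of one letter and is determined by its degree.\<close>

lemma nod_word: "nod w \<Longrightarrow> word (wdeg w) = w"
proof (induction w)
  case (Cons x w)
  hence IH: "word (wdeg w) = w" and x: "letter x" and nb: "w \<noteq> [] \<Longrightarrow> \<not> bad x (hd w)" by simp_all
  from x show ?case
  proof (cases rule: letter_cases)
    case (Edge f i)
    hence fi: "f = e" "i = 1" using one_edge by simp_all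
    have "0 \<le> wdeg w"
    proof (rule ccontr)
      assume "\<not> 0 \<le> wdeg w"
      hence "w = replicate (Suc (nat (- wdeg w) - 1)) (Ghost e 1)" using IH by (simp add: word_def)
      hence "w \<noteq> []" "hd w = Ghost e 1" by (metis list.distinct(1) replicate_Suc, metis list.sel(1) replicate_Suc)
      thus False using nb Edge(1) fi al_z one_edge by simp
    qed
    thus ?thesis using IH Edge(1) fi by (simp add: word_def nat_add_distrib)
  next
    case (Ghost f i)
    hence fi: "f = e" "i = 1" using one_edge by simp_all
    have "wdeg w \<le> 0"
    proof (rule ccontr)
      assume "\<not> wdeg w \<le> 0"
      hence "w = replicate (Suc (nat (wdeg w) - 1)) (Edge e 1)" using IH by (simp add: word_def)
      hence "w \<noteq> []" "hd w = Edge e 1" by (metis list.distinct(1) replicate_Suc, metis list.sel(1) replicate_Suc)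
      thus False using nb Ghost(1) fi by simp
    qed
    hence "w = replicate (nat (- wdeg w)) (Ghost e 1)" using IH by (auto simp: word_def split: if_splits)
    moreover have "nat (1 - wdeg w) = Suc (nat (- wdeg w))" using \<open>wdeg w \<le> 0\<close> by simp
    ultimately show ?thesis using Ghost(1) fi \<open>wdeg w \<le> 0\<close> by (simp add: word_def)
  qed
qed (simp add: word_def)

text \<open>Evaluation is constant on classes; the normal form supplies a representative.\<close>

definition toL :: "('v, 'e, 'k) free_elt set \<Rightarrow> (int \<Rightarrow>\<^sub>0 'k)" where
  "toL x = ev (lext emb (nf x))"

lemma toL_cl: "p \<in> carrier (free_alg G) \<Longrightarrow> toL (cl G p) = ev p"
  unfolding toL_def by (rule ev_cong) (simp add: cl_nf)

text \<open>Replacing each power of x by its normal word recovers the normal form from its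
  evaluation.\<close>

lemma toL_inj: "inj_on toL (carrier A)"
proof (rule inj_onI)
  fix x y assume xy: "x \<in> carrier A" "y \<in> carrier A" "toL x = toL y"
  have "lext (\<lambda>n. sing (word n)) (lext (\<lambda>w. sing (wdeg w)) v) = v" if "v \<in> V" for v
  proof -
    have "lext (\<lambda>n. sing (word n)) (lext (\<lambda>w. sing (wdeg w)) v) = lext sing v"
      using V_nod[OF that] nod_word by (simp add: lext_lext cong: lext_cong)
    thus ?thesis by (simp add: lext_id)
  qed
  hence "nf x = nf y" using xy nf_V unfolding toL_def ev_lext_emb by metis
  thus "x = y" using cl_nf xy(1,2) by metis
qed

lemma laurent_iso: "toL \<in> alg_iso A laurent"
proof -
  have hom: "toL \<in> ring_hom A laurent"
  proof (rule ring_hom_memI)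
    show "toL \<one>\<^bsub>A\<^esub> = \<one>\<^bsub>laurent\<^esub>"
      using verts by (simp add: wlpa_one toL_cl ev_generators laurent_simps)
  next
    fix x y assume "x \<in> carrier A" "y \<in> carrier A"
    then obtain p q where "p \<in> carrier (free_alg G)" "x = cl G p" "q \<in> carrier (free_alg G)" "y = cl G q"
      unfolding wlpa_carrier by blast
    thus "toL (x \<otimes>\<^bsub>A\<^esub> y) = toL x \<otimes>\<^bsub>laurent\<^esub> toL y" "toL (x \<oplus>\<^bsub>A\<^esub> y) = toL x \<oplus>\<^bsub>laurent\<^esub> toL y"
      by (simp_all add: wlpa_mult wlpa_add toL_cl ev_mult ev_simps laurent_simps)
  qed (simp add: laurent_simps)
  have "p \<in> toL ` carrier A" for p
  proof
    have w: "emb (word n) \<in> carrier (free_alg G)" for n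
    proof -
      have "set (word n) \<subseteq> gens G" using one_edge by (auto simp: word_def gens_def)
      thus ?thesis using verts by (simp add: emb_def)
    qed
    have in1: "lext (\<lambda>n. emb (word n)) p \<in> carrier (free_alg G)"
      unfolding lext_def by (intro free_alg_sum free_alg_scale w)
    thus "cl G (lext (\<lambda>n. emb (word n)) p) \<in> carrier A" by simp
    have "ev (emb (word n)) = sing n" for n
      using ev_lext_emb[of "sing (word n)"] by (simp add: wdeg_word)
    hence "ev (lext (\<lambda>n. emb (word n)) p) = lext sing p"
      unfolding ev_def lext_lext by simp
    thus "p = toL (cl G (lext (\<lambda>n. emb (word n)) p))" using in1 by (simp add: toL_cl lext_id)
  qed
  hence "bij_betw toL (carrier A) (carrier laurent)"
    using toL_inj by (auto simp: bij_betw_def laurent_simps)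
  moreover have "toL (k \<odot>\<^bsub>A\<^esub> x) = k \<odot>\<^bsub>laurent\<^esub> toL x" if "x \<in> carrier A" for k x
  proof -
    obtain p where "p \<in> carrier (free_alg G)" "x = cl G p" using \<open>x \<in> carrier A\<close> unfolding wlpa_carrier by blast
    thus ?thesis by (simp add: wlpa_smult toL_cl ev_simps laurent_simps)
  qed
  ultimately show ?thesis using hom by (simp add: alg_iso_def ring_iso_def)
qed

end

section \<open>Transport along isomorphisms\<close>

lemma laurent_iso_nc_domain:
  fixes R :: "('k::field, 'a) module"
  assumes R: "ring R" and f: "\<phi> \<in> alg_iso R (laurent :: ('k, int \<Rightarrow>\<^sub>0 'k) module)"
  shows "nc_domain R"
proof -
  interpret R: ring R by fact
  have h: "\<phi> \<in> ring_hom R laurent" and inj: "inj_on \<phi> (carrier R)"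
    using f by (auto simp: alg_iso_def ring_iso_def bij_betw_def)
  interpret L: cring "laurent :: ('k, int \<Rightarrow>\<^sub>0 'k) module" by (rule laurent_comm_ring)
  have z: "\<phi> \<zero>\<^bsub>R\<^esub> = 0"
    using ring_hom_zero[OF h R L.ring_axioms] by (simp add: laurent_simps)
  have m: "\<phi> (a \<otimes>\<^bsub>R\<^esub> b) = \<phi> a * \<phi> b" if "a \<in> carrier R" "b \<in> carrier R" for a b
    using ring_hom_mult[OF h that] by (simp add: laurent_simps)
  have o: "\<phi> \<one>\<^bsub>R\<^esub> = 1" using ring_hom_one[OF h] by (simp add: laurent_simps)
  have i0: "a = \<zero>\<^bsub>R\<^esub>" if "a \<in> carrier R" "\<phi> a = 0" for a
    using inj_onD[OF inj, of a "\<zero>\<^bsub>R\<^esub>"] that z by simp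
  show ?thesis
    unfolding nc_domain_def
  proof (intro conjI ballI impI R)
    show "carrier R \<noteq> {\<zero>\<^bsub>R\<^esub>}" using z o by (metis R.one_closed singletonD zero_neq_one)
    fix a b assume ab: "a \<in> carrier R" "b \<in> carrier R" "a \<otimes>\<^bsub>R\<^esub> b = \<zero>\<^bsub>R\<^esub>"
    hence "\<phi> a * \<phi> b = 0" using m[of a b] z by simp
    \<comment> \<open>Finitely supported functions on the ordered group of integers have no zero
      divisors, as a type class instance.\<close>
    hence "\<phi> a = 0 \<or> \<phi> b = 0" by simp
    thus "a = \<zero>\<^bsub>R\<^esub> \<or> b = \<zero>\<^bsub>R\<^esub>" using i0 ab by blast
  qed
qed

lemma laurent_iso_comm_units:
  fixes R :: "('k::field, 'a) module"
  assumes R: "ring R" and f: "\<phi> \<in> alg_iso R (laurent :: ('k, int \<Rightarrow>\<^sub>0 'k) module)"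
  shows "comm_group (units_of R)"
proof -
  interpret R: ring R by fact
  interpret U: group "units_of R" by (rule R.units_group)
  have h: "\<phi> \<in> ring_hom R laurent" and inj: "inj_on \<phi> (carrier R)"
    using f by (auto simp: alg_iso_def ring_iso_def bij_betw_def)
  show ?thesis
  proof (rule U.group_comm_groupI)
    fix x y assume "x \<in> carrier (units_of R)" "y \<in> carrier (units_of R)"
    hence xy: "x \<in> carrier R" "y \<in> carrier R" by (simp_all add: units_of_carrier R.Units_closed)
    have "\<phi> (x \<otimes>\<^bsub>R\<^esub> y) = \<phi> (y \<otimes>\<^bsub>R\<^esub> x)"
      using ring_hom_mult[OF h xy] ring_hom_mult[OF h xy(2,1)] by (simp add: laurent_simps mult.commute)
    hence "x \<otimes>\<^bsub>R\<^esub> y = y \<otimes>\<^bsub>R\<^esub> x" using inj_onD[OF inj] xy R.m_closed by blast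
    thus "x \<otimes>\<^bsub>units_of R\<^esub> y = y \<otimes>\<^bsub>units_of R\<^esub> x" by (simp add: units_of_mult)
  qed
qed

lemma comm_units_of_field_iso:
  assumes "group H" "H \<cong> units_of (ring_of_type_algebra :: 'k::field ring)"
  shows "comm_group H"
proof -
  interpret F: ring "ring_of_type_algebra :: 'k ring" by (rule ring_from_type_algebra)
  interpret U: group "units_of (ring_of_type_algebra :: 'k ring)" by (rule F.units_group)
  have "comm_group (units_of (ring_of_type_algebra :: 'k ring))"
    by (rule U.group_comm_groupI) (simp add: units_of_mult mult_ring_of_type_algebra)
  from comm_group.iso_imp_comm_group[OF this group.iso_sym[OF assms] group.is_monoid[OF assms(1)]]
  show ?thesis .
qed

lemma comm_group_no_noncyclic_free_subgroup:
  assumes "comm_group H" "subgroup S H" "free_group (H\<lparr>carrier := S\<rparr>)"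
  shows "cyclic_group (H\<lparr>carrier := S\<rparr>)"
proof -
  interpret H: comm_group H by fact
  interpret S: group "H\<lparr>carrier := S\<rparr>" by (rule H.subgroup_imp_group[OF assms(2)])
  have "comm_group (H\<lparr>carrier := S\<rparr>)"
    by (rule S.group_comm_groupI) (use subgroup.subset[OF assms(2)] H.m_comm in auto)
  from comm_group.free_imp_cyclic[OF this assms(3)] show ?thesis .
qed

context fin_wgraph
begin

text \<open>The form in which the top-word argument uses a rose: after removing any one edge, an
  edge of maximal weight is left.\<close>

lemma LV_rose_edges:
  assumes "LV_rose G" "verts G = {v}"
  shows "e \<in> sedges G \<Longrightarrow> 2 \<le> wt G e"
    "e \<in> sedges G \<Longrightarrow> \<exists>g\<in>sedges G. g \<noteq> e \<and> wt G g = vwt G v"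
proof -
  assume e: "e \<in> sedges G"
  show "2 \<le> wt G e" using assms e by (simp add: LV_rose_def LV_graph_def)
next
  assume e: "e \<in> sedges G"
  hence "src G e = v" using src_in[OF e] assms by simp
  hence "\<not> is_sink G v" using e by (auto simp: is_sink_def out_edges_def)
  hence c: "2 \<le> card {e \<in> out_edges G v. wt G e = vwt G v}" (is "2 \<le> card ?M")
    using assms by (simp add: LV_rose_def LV_graph_def)
  have "\<not> ?M \<subseteq> {e}"
  proof
    assume "?M \<subseteq> {e}"
    hence "card ?M \<le> card {e}" by (intro card_mono) simp_all
    thus False using c by simp
  qed
  thus "\<exists>g\<in>sedges G. g \<noteq> e \<and> wt G g = vwt G v" by (auto simp: out_edges_def)
qed

end

theorem theorem4:
  fixes G :: "('v, 'e) wgraph"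
    and A :: "('k::field_char_0, ('v, 'e, 'k) free_elt set) module"
  defines "A \<equiv> wlpa G"
  assumes "weighted_graph G" and "finite_wgraph G" and "connected_wgraph G"
  defines "cond1 \<equiv> comm_group (units_of A)"
    and "cond2 \<equiv> nc_domain A"
    and "cond3 \<equiv>
      (\<exists>v. verts G = {v} \<and> sedges G = {}) \<or>
      (\<exists>v e. verts G = {v} \<and> sedges G = {e} \<and> wt G e = 1) \<or>
      LV_rose G"
    and "cond4 \<equiv>
      (\<exists>v\<in>verts G. carrier A = {k \<odot>\<^bsub>A\<^esub> wlpa_vtx G v | k. True} \<and>
         units_of A \<cong> units_of (ring_of_type_algebra :: 'k ring)) \<or>
      (\<exists>\<phi>\<in>alg_iso A (laurent :: ('k, int \<Rightarrow>\<^sub>0 'k) module).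
         \<phi> ` carrier (units_of A) =
           {laurent_const k | k. k \<noteq> 0}
             <#>\<^bsub>units_of laurent\<^esub> generate (units_of laurent) {laurent_X}) \<or>
      (\<exists>v. verts G = {v} \<and> LV_rose G \<and>
         units_of A \<cong> units_of (ring_of_type_algebra :: 'k ring))"
    and "cond5 \<equiv>
      \<not> (\<exists>H. subgroup H (units_of A) \<and>
           free_group ((units_of A)\<lparr>carrier := H\<rparr>) \<and>
           \<not> cyclic_group ((units_of A)\<lparr>carrier := H\<rparr>))"
  shows "(cond1 \<longleftrightarrow> cond2) \<and> (cond2 \<longleftrightarrow> cond3) \<and> (cond3 \<longleftrightarrow> cond4) \<and> (cond4 \<longleftrightarrow> cond5)"
proof -
  interpret fin_wgraph G using assms(2,3) by unfold_locales
  interpret A: ring A unfolding A_def by (rule wlpa_ring)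
  interpret U: group "units_of A" by (rule A.units_group)
  have pair: "has_matrix_pair A TYPE('k)" if "\<not> cond3"
    unfolding A_def
    using that not_cond3_has_pair[OF assms(4)] unfolding cond3_def by blast
  have c23: "cond3" if "cond2"
  proof (rule ccontr)
    assume "\<not> cond3"
    then obtain a b f x0 y0 l and g :: "('v, 'e, 'k) free_elt set \<Rightarrow> 'k"
      where "matrix_pair A a b f g x0 y0 l"
      using pair unfolding has_matrix_pair_def by blast
    from matrix_pair.not_nc_domain[OF this] show False using that unfolding cond2_def by blast
  qed
  have c53: "cond3" if "cond5"
  proof (rule ccontr)
    assume "\<not> cond3"
    then obtain a b f x0 y0 l and g :: "('v, 'e, 'k) free_elt set \<Rightarrow> 'k"
      where "matrix_pair A a b f g x0 y0 l"
      using pair unfolding has_matrix_pair_def by blast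
    from matrix_pair.noncyclic_free_subgroup[OF this] show False using that unfolding cond5_def by blast
  qed
  have c15: "cond5" if "cond1"
    unfolding cond5_def using comm_group_no_noncyclic_free_subgroup that unfolding cond1_def by blast
  have c41: "cond1" if "cond4"
    using that unfolding cond4_def cond1_def
  proof (elim disjE bexE exE conjE)
    fix \<phi> assume "\<phi> \<in> alg_iso A (laurent :: ('k, int \<Rightarrow>\<^sub>0 'k) module)"
    thus "comm_group (units_of A)" by (rule laurent_iso_comm_units[OF A.ring_axioms])
  qed (rule comm_units_of_field_iso[OF U.group_axioms], assumption)+
  obtain al where al: "nf_rep G al" using nf_rep_exists[of "{}"] by auto
  have c3: "cond2 \<and> cond4" if "cond3"
  proof -
    from that consider (a) v where "verts G = {v}" "sedges G = {}"
      | (b) v e where "verts G = {v}" "sedges G = {e}" "wt G e = 1"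
      | (c) v where "verts G = {v}" "LV_rose G"
      unfolding cond3_def LV_rose_def by blast
    thus ?thesis
    proof cases
      case a
      interpret V: one_vertex_rep G al v "TYPE('k)"
        using al a(1) by (simp add: one_vertex_rep_def one_vertex_rep_axioms_def)
      have "cond2" unfolding cond2_def A_def by (rule V.wlpa_nc_domain) (simp_all add: a)
      moreover have "units_of A \<cong> units_of (ring_of_type_algebra :: 'k ring)"
        unfolding A_def by (rule V.units_scalar_iso, rule V.wlpa_units_scalar) (simp_all add: a)
      moreover have "carrier A = {k \<odot>\<^bsub>A\<^esub> wlpa_vtx G v | k. True}"
      proof (intro equalityI subsetI)
        fix x assume x: "x \<in> carrier A"
        \<comment> \<open>Without edges there are no letters, so the empty word is the only normal
          word and every element is a scalar.\<close>
        have "w = []" if "w \<in> Poly_Mapping.keys (V.nf x)" for w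
        proof -
          have "V.nod w" using V.V_nod[OF V.nf_V that] x unfolding A_def by blast
          have False if "y \<in> set w" for y
            using V.nod_letter[OF \<open>V.nod w\<close> that] by (cases rule: V.letter_cases) (simp_all add: a(2))
          thus ?thesis by (cases w) auto
        qed
        hence "V.nf x = Poly_Mapping.single [] (Poly_Mapping.lookup (V.nf x) [])"
          by (intro poly_mapping_eqI) (auto simp: lookup_single when_def in_keys_iff)
        thus "x \<in> {k \<odot>\<^bsub>A\<^esub> wlpa_vtx G v | k. True}"
          using V.scalar_of_nf x unfolding A_def by blast
      qed (use V.scalar_in in \<open>auto simp: A_def\<close>)
      ultimately show ?thesis using a(1) unfolding cond4_def by blast
    next
      case b
      interpret V: one_edge_rep G al v "TYPE('k)" e
        using al b by (simp add: one_vertex_rep_def one_vertex_rep_axioms_def one_edge_rep_def one_edge_rep_axioms_def)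
      have iso: "V.toL \<in> alg_iso A laurent" unfolding A_def by (rule V.laurent_iso)
      have "V.toL ` Units A = Units laurent"
        by (rule ring_iso_image_Units[OF A.ring_axioms cring.axioms(1)[OF laurent_comm_ring]])
           (use iso in \<open>simp add: alg_iso_def\<close>)
      hence "V.toL ` carrier (units_of A) = {laurent_const k | k. k \<noteq> 0}
             <#>\<^bsub>units_of laurent\<^esub> generate (units_of laurent) {laurent_X}"
        unfolding laurent_units_eq units_of_carrier .
      moreover have "cond2" unfolding cond2_def by (rule laurent_iso_nc_domain[OF A.ring_axioms iso])
      ultimately show ?thesis using iso unfolding cond4_def by blast
    next
      case c
      interpret V: one_vertex_rep G al v "TYPE('k)"
        using al c(1) by (simp add: one_vertex_rep_def one_vertex_rep_axioms_def)
      note lv = LV_rose_edges[OF c(2,1)]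
      have "cond2" unfolding cond2_def A_def by (rule V.wlpa_nc_domain[OF lv])
      moreover have "units_of A \<cong> units_of (ring_of_type_algebra :: 'k ring)"
        unfolding A_def by (rule V.units_scalar_iso, rule V.wlpa_units_scalar[OF lv])
      ultimately show ?thesis using c unfolding cond4_def by blast
    qed
  qed
  \<comment> \<open>The implications form the cycle 3, 4, 1, 5, 3 together with the equivalence of 2
    and 3.\<close>
  show ?thesis using c23 c53 c15 c41 c3 by blast
qed

end
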